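(* Suppose that $K$ is an infinite compact Hausdorff space and that $\varphi$ is a character on $\mathscr{B}(C(K))$. Then $\mathscr{G}_{c_0}(C(K))\subseteq\ker\varphi$. If $C(K)$ is a Grothendieck space, then $\mathscr{X}(C(K))$, and thus $\mathscr{G}_{c_0}(C(K))$, is contained in the ideal of strictly singular operators on $C(K)$, and so $\mathscr{X}(C(K))$ and $\mathscr{G}_{c_0}(C(K))$ have infinite codimension in $\mathscr{B}(C(K))$.
   Context: $C(K)$ is the Banach space of continuous $\mathbb{K}$-valued functions on $K$ with the supremum norm, where $\mathbb{K}$ is $\mathbb{R}$ or $\mathbb{C}$. For a Banach space $\mathcal{X}$: $\mathscr{B}(\mathcal{X})$ is the Banach algebra of bounded linear operators on $\mathcal{X}$; $\mathscr{X}(\mathcal{X})$ is the closed two-sided ideal of operators with separable range; $\mathscr{G}_{c_0}(\mathcal{X})$ is the two-sided ideal of operators $S\in\mathscr{B}(\mathcal{X})$ that factor through $c_0$, i.e. $S=VU$ for some bounded linear operators $U\colon\mathcal{X}\to c_0$ and $V\colon c_0\to\mathcal{X}$. It always holds that $\mathscr{G}_{c_0}(\mathcal{X})\subseteq\mathscr{X}(\mathcal{X})$. A character on $\mathscr{B}(\mathcal{X})$ is a nonzero linear functional $\varphi\colon\mathscr{B}(\mathcal{X})\to\mathbb{K}$ with $\varphi(TS)=\varphi(T)\varphi(S)$ for all $S,T$. A bounded linear operator is strictly singular if no restriction of it to an infinite-dimensional subspace is an isomorphism onto its range. A Banach space $\mathcal{X}$ is a Grothendieck space if every weak*-convergent sequence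 in $\mathcal{X}^*$ converges weakly. *)

theory Defs
  imports "HOL-Analysis.Analysis"
begin

section \<open>The scalar field\<close>

text \<open>
  The field of scalars is either the real or the complex numbers. The last assumption leaves
  no other possibility: the members are exactly \<open>a + b i\<close> with \<open>a\<close>, \<open>b\<close> real, where
  either \<open>i = 0\<close> (the reals) or \<open>i\<^sup>2 = -1\<close> (the complex numbers); and a multiplicative norm
  extending the absolute value of the reals is unique.
\<close>

class real_or_complex = real_normed_field + euclidean_space +
  assumes real_or_complex:
    "\<exists>i. (i = 0 \<or> i * i = - 1) \<and> (\<forall>z. \<exists>a b. z = a *\<^sub>R 1 + b *\<^sub>R i)"

instance real :: real_or_complex
  by standard (rule exI [of _ 0], auto)

instance complex :: real_or_complex
proof
  show "\<exists>i::complex. (i = 0 \<or> i * i = - 1) \<and> (\<forall>z. \<exists>a b. z = a *\<^sub>R 1 + b *\<^sub>R i)"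
    by (rule exI [of _ \<i>]) (auto simp: complex_eq_iff)
qed

section \<open>Normed spaces over the scalar field\<close>

text \<open>
  A normed space over \<open>'k\<close> is a real normed space together with a scalar multiplication
  \<open>s\<close> by elements of \<open>'k\<close> that is compatible with the real structure and with the norm. All
  notions below take \<open>s\<close> as a parameter; linearity, subspaces and spans are over \<open>'k\<close>.
\<close>

locale normed_space_over = vector_space s
  for s :: "'k::real_or_complex \<Rightarrow> 'x::real_normed_vector \<Rightarrow> 'x" +
  assumes scale_of_real: "s (of_real r) x = r *\<^sub>R x"
    and norm_scale: "norm (s c x) = norm c * norm x"

lemma normed_space_over_mult: "normed_space_over ((*) :: 'k::real_or_complex \<Rightarrow> 'k \<Rightarrow> 'k)"
  by unfold_locales (auto simp: algebra_simps norm_mult scaleR_conv_of_real)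

definition fun_scale ::
  "'k::real_or_complex \<Rightarrow> ('a::topological_space \<Rightarrow>\<^sub>C 'k) \<Rightarrow> ('a \<Rightarrow>\<^sub>C 'k)" where
  "fun_scale c f = Bcontfun (\<lambda>x. c * f x)"

lemma fun_scale_apply [simp]: "apply_bcontfun (fun_scale c f) x = c * f x"
proof -
  have "(\<lambda>x. c * f x) \<in> bcontfun"
  proof (rule bcontfun_normI)
    show "continuous_on UNIV (\<lambda>x. c * f x)"
      by (intro continuous_intros continuous_on_apply_bcontfun)
    show "norm (c * f x) \<le> norm c * norm f" for x
      by (simp add: norm_mult mult_left_mono norm_bounded)
  qed
  then show ?thesis
    by (simp add: fun_scale_def Bcontfun_inverse)
qed

definition linear_on ::
  "('k::real_or_complex \<Rightarrow> 'x::real_normed_vector \<Rightarrow> 'x) \<Rightarrow>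
   ('k \<Rightarrow> 'y::real_normed_vector \<Rightarrow> 'y) \<Rightarrow> 'x set \<Rightarrow> ('x \<Rightarrow> 'y) \<Rightarrow> bool" where
  "linear_on s1 s2 W f \<longleftrightarrow>
     (\<forall>x\<in>W. \<forall>y\<in>W. f (x + y) = f x + f y) \<and> (\<forall>c. \<forall>x\<in>W. f (s1 c x) = s2 c (f x))"

definition bounded_linear_on ::
  "('k::real_or_complex \<Rightarrow> 'x::real_normed_vector \<Rightarrow> 'x) \<Rightarrow>
   ('k \<Rightarrow> 'y::real_normed_vector \<Rightarrow> 'y) \<Rightarrow> 'x set \<Rightarrow> ('x \<Rightarrow> 'y) \<Rightarrow> bool" where
  "bounded_linear_on s1 s2 W f \<longleftrightarrow>
     linear_on s1 s2 W f \<and> (\<exists>C. \<forall>x\<in>W. norm (f x) \<le> C * norm x)"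

text \<open>
  The type \<open>\<Rightarrow>\<^sub>L\<close> only provides real-linear bounded operators; the \<open>'k\<close>-linear ones
  form the following subset.
\<close>

definition bounded_ops ::
  "('k::real_or_complex \<Rightarrow> 'x::real_normed_vector \<Rightarrow> 'x) \<Rightarrow>
   ('k \<Rightarrow> 'y::real_normed_vector \<Rightarrow> 'y) \<Rightarrow> ('x \<Rightarrow>\<^sub>L 'y) set" where
  "bounded_ops s1 s2 = {T. Vector_Spaces.linear s1 s2 (blinfun_apply T)}"

definition op_scale ::
  "('k::real_or_complex \<Rightarrow> 'y::real_normed_vector \<Rightarrow> 'y) \<Rightarrow> 'k \<Rightarrow>
   ('x::real_normed_vector \<Rightarrow>\<^sub>L 'y) \<Rightarrow> ('x \<Rightarrow>\<^sub>L 'y)" where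
  "op_scale s c T = Blinfun (\<lambda>x. s c (T x))"

definition finite_dimensional ::
  "('k::real_or_complex \<Rightarrow> 'x::real_normed_vector \<Rightarrow> 'x) \<Rightarrow> 'x set \<Rightarrow> bool" where
  "finite_dimensional s W \<longleftrightarrow> (\<exists>F. finite F \<and> module.span s F = W)"

text \<open>
  The quotient of \<open>W\<close> by its subspace \<open>I\<close> is finite-dimensional if and only if it is spanned
  by the cosets of finitely many elements of \<open>W\<close>.
\<close>

definition infinite_codimension ::
  "('k::real_or_complex \<Rightarrow> 'x::real_normed_vector \<Rightarrow> 'x) \<Rightarrow> 'x set \<Rightarrow> 'x set \<Rightarrow> bool" where
  "infinite_codimension s I W \<longleftrightarrow>
     \<not> (\<exists>F. finite F \<and> F \<subseteq> W \<and> W \<subseteq> module.span s (I \<union> F))"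

section \<open>Duality\<close>

definition dual ::
  "('k::real_or_complex \<Rightarrow> 'x::real_normed_vector \<Rightarrow> 'x) \<Rightarrow> ('x \<Rightarrow>\<^sub>L 'k) set" where
  "dual s = bounded_ops s (*)"

definition bidual ::
  "('k::real_or_complex \<Rightarrow> 'x::real_normed_vector \<Rightarrow> 'x) \<Rightarrow> (('x \<Rightarrow>\<^sub>L 'k) \<Rightarrow> 'k) set" where
  "bidual s = {\<Phi>. bounded_linear_on (op_scale (*)) (*) (dual s) \<Phi>}"

definition weak_star_convergent ::
  "('k::real_or_complex \<Rightarrow> 'x::real_normed_vector \<Rightarrow> 'x) \<Rightarrow> (nat \<Rightarrow> 'x \<Rightarrow>\<^sub>L 'k) \<Rightarrow> bool" where
  "weak_star_convergent s f \<longleftrightarrow>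
     (\<exists>l\<in>dual s. \<forall>x. (\<lambda>n. f n x) \<longlonglongrightarrow> l x)"

definition weakly_convergent ::
  "('k::real_or_complex \<Rightarrow> 'x::real_normed_vector \<Rightarrow> 'x) \<Rightarrow> (nat \<Rightarrow> 'x \<Rightarrow>\<^sub>L 'k) \<Rightarrow> bool" where
  "weakly_convergent s f \<longleftrightarrow>
     (\<exists>l\<in>dual s. \<forall>\<Phi>\<in>bidual s. (\<lambda>n. \<Phi> (f n)) \<longlonglongrightarrow> \<Phi> l)"

definition grothendieck_space ::
  "('k::real_or_complex \<Rightarrow> 'x::real_normed_vector \<Rightarrow> 'x) \<Rightarrow> bool" where
  "grothendieck_space s \<longleftrightarrow>
     (\<forall>f. (\<forall>n. f n \<in> dual s) \<and> weak_star_convergent s f \<longrightarrow> weakly_convergent s f)"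

section \<open>Operators on a Banach space\<close>

abbreviation operators ::
  "('k::real_or_complex \<Rightarrow> 'x::real_normed_vector \<Rightarrow> 'x) \<Rightarrow> ('x \<Rightarrow>\<^sub>L 'x) set" where
  "operators s \<equiv> bounded_ops s s"

definition separable_range_ops ::
  "('k::real_or_complex \<Rightarrow> 'x::real_normed_vector \<Rightarrow> 'x) \<Rightarrow> ('x \<Rightarrow>\<^sub>L 'x) set" where
  "separable_range_ops s =
     {T \<in> operators s. separable_space (top_of_set (range (blinfun_apply T)))}"

text \<open>The space \<open>c\<^sub>0\<close>, as a subspace of the space of bounded scalar sequences.\<close>

definition c0 :: "(nat \<Rightarrow>\<^sub>C 'k::real_or_complex) set" where
  "c0 = {x. apply_bcontfun x \<longlonglongrightarrow> 0}"

definition c0_factorable_ops ::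
  "('k::real_or_complex \<Rightarrow> 'x::real_normed_vector \<Rightarrow> 'x) \<Rightarrow> ('x \<Rightarrow>\<^sub>L 'x) set" where
  "c0_factorable_ops s =
     {S \<in> operators s. \<exists>U V.
        U \<in> bounded_ops s fun_scale \<and> range (blinfun_apply U) \<subseteq> c0 \<and>
        bounded_linear_on fun_scale s c0 V \<and> (\<forall>x. S x = V (U x))}"

definition strictly_singular_ops ::
  "('k::real_or_complex \<Rightarrow> 'x::real_normed_vector \<Rightarrow> 'x) \<Rightarrow> ('x \<Rightarrow>\<^sub>L 'x) set" where
  "strictly_singular_ops s =
     {T \<in> operators s. \<not> (\<exists>W. module.subspace s W \<and> \<not> finite_dimensional s W \<and>
        (\<exists>R. homeomorphism W (blinfun_apply T ` W) (blinfun_apply T) R))}"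

text \<open>No continuity is required of a character.\<close>

definition character ::
  "('k::real_or_complex \<Rightarrow> 'x::real_normed_vector \<Rightarrow> 'x) \<Rightarrow> (('x \<Rightarrow>\<^sub>L 'x) \<Rightarrow> 'k) \<Rightarrow> bool" where
  "character s \<phi> \<longleftrightarrow>
     linear_on (op_scale s) (*) (operators s) \<phi> \<and>
     (\<forall>S\<in>operators s. \<forall>T\<in>operators s. \<phi> (T o\<^sub>L S) = \<phi> T * \<phi> S) \<and>
     (\<exists>T\<in>operators s. \<phi> T \<noteq> 0)"

definition character_ker ::
  "('k::real_or_complex \<Rightarrow> 'x::real_normed_vector \<Rightarrow> 'x) \<Rightarrow> (('x \<Rightarrow>\<^sub>L 'x) \<Rightarrow> 'k) \<Rightarrow>
   ('x \<Rightarrow>\<^sub>L 'x) set" where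
  "character_ker s \<phi> = {T \<in> operators s. \<phi> T = 0}"

section \<open>The parameters are normed spaces\<close>

lemma normed_space_over_fun_scale:
  "normed_space_over (fun_scale :: 'k::real_or_complex \<Rightarrow> ('a::topological_space \<Rightarrow>\<^sub>C 'k) \<Rightarrow> _)"
proof unfold_locales
  show nle: "norm (fun_scale c f) = norm c * norm f" for c :: 'k and f :: "'a \<Rightarrow>\<^sub>C 'k"
  proof -
    have le: "norm (fun_scale c f) \<le> norm c * norm f" for c :: 'k and f :: "'a \<Rightarrow>\<^sub>C 'k"
      by (rule norm_bound) (simp add: norm_mult mult_left_mono norm_bounded)
    show ?thesis
    proof (cases "c = 0")
      case True
      then show ?thesis using le [of c f] by simp
    next
      case False
      have "fun_scale (inverse c) (fun_scale c f) = f"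
        using False by (intro bcontfun_eqI) simp
      then have "norm f \<le> norm (inverse c) * norm (fun_scale c f)"
        by (metis le)
      then have "norm c * norm f \<le> norm (fun_scale c f)"
        using False by (simp add: nonzero_norm_inverse norm_divide field_simps)
      then show ?thesis using le [of c f] by simp
    qed
  qed
qed (auto intro!: bcontfun_eqI simp: algebra_simps scaleR_conv_of_real)

context normed_space_over
begin

lemma bounded_linear_scale: "bounded_linear (s c)"
proof (rule bounded_linear_intro [where K = "norm c"])
  fix r x
  have "s c (s (of_real r) x) = s (of_real r) (s c x)"
    by (simp add: mult.commute)
  then show "s c (r *\<^sub>R x) = r *\<^sub>R s c x"
    by (simp only: scale_of_real)
qed (simp_all add: scale_right_distrib norm_scale mult.commute)

lemma op_scale_apply [simp]: "blinfun_apply (op_scale s c T) x = s c (T x)"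
  unfolding op_scale_def
  by (simp add: bounded_linear_Blinfun_apply
      bounded_linear_compose [OF bounded_linear_scale blinfun.bounded_linear_right])

lemma vector_space_op_scale:
  "vector_space (op_scale s :: 'k \<Rightarrow> ('y::real_normed_vector \<Rightarrow>\<^sub>L 'x) \<Rightarrow> _)"
  by unfold_locales
    (auto intro!: blinfun_eqI simp: blinfun.add_left scale_right_distrib scale_left_distrib)

end

end

theory Submission
  imports Defs "HOL-Complex_Analysis.Great_Picard"
begin

text \<open>
  Characters. Let \<open>S = V U\<close> factor through \<open>c\<^sub>0\<close>, and regard \<open>U V\<close> as an infinite matrix whose rows
  belong to \<open>\<ell>\<^sub>1\<close>. If the norms of the rows tend to \<open>0\<close>, then \<open>S\<^sup>2\<close> is a norm limit of operators of
  finite rank, on which a character \<open>\<phi>\<close> vanishes; so \<open>\<phi>(S)\<^sup>2 = 0\<close>, as \<open>\<phi>\<close> is contractive. Otherwise a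
  gliding hump yields an almost diagonal submatrix bounded away from \<open>0\<close>; since \<open>c\<^sub>0 \<simeq> c\<^sub>0 \<oplus> c\<^sub>0\<close>, there
  are operators with \<open>X\<^sub>i Y\<^sub>j \<approx> \<delta>\<^sub>i\<^sub>j S\<close>, whence \<open>\<phi>(S)\<^sup>2 \<approx> \<phi>(X\<^sub>0 Y\<^sub>1) \<phi>(X\<^sub>1 Y\<^sub>0) \<approx> 0\<close>.

  Strict singularity. Let \<open>T\<close> have separable range and \<open>c \<parallel>w\<parallel> \<le> \<parallel>T w\<parallel>\<close> on \<open>W\<close>. The functionals
  \<open>\<mu>\<^sub>t = T\<^sup>*\<delta>\<^sub>t\<close> form a weak* sequentially compact, hence by the Grothendieck property a weakly
  sequentially compact set. If \<open>W\<close> were infinite-dimensional, then no \<open>L\<^sub>1\<close> norm could dominate the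
  supremum norm on \<open>W\<close>, so unit vectors \<open>w\<^sub>n \<in> W\<close> could be chosen that are small with respect to
  \<open>\<mu>\<^sub>t\<close> for finitely many prescribed \<open>t\<close>. Cutting them off to make them disjoint
  contradicts the Schur property of \<open>\<ell>\<^sub>1\<close>.

  Codimension. Multiplication by a continuous function that does not vanish at a limit point of \<open>K\<close> is
  bounded below on an infinite-dimensional subspace, so it suffices that there are infinitely many
  limit points; otherwise some sequence of isolated points converges, which the Grothendieck property
  forbids.
\<close>

section \<open>Functionals on spaces of bounded continuous functions\<close>

text \<open>The unimodular factor that rotates \<open>z\<close> onto its modulus. Division by zero
  gives \<open>phase 0 = 0\<close>, so in general its norm is only bounded by 1.\<close>

definition phase :: "'k::real_normed_field \<Rightarrow> 'k" where
  "phase z = of_real (norm z) / z"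

lemma phase_mult: "phase z * z = of_real (norm z)"
  by (cases "z = 0") (auto simp: phase_def)

lemma norm_phase_le: "norm (phase z) \<le> 1"
  by (cases "z = 0") (auto simp: phase_def norm_divide)

interpretation fs: normed_space_over "fun_scale :: 'k::real_or_complex \<Rightarrow> ('a::topological_space \<Rightarrow>\<^sub>C 'k) \<Rightarrow> _"
  by (rule normed_space_over_fun_scale)

interpretation ks: normed_space_over "(*) :: 'k::real_or_complex \<Rightarrow> 'k \<Rightarrow> 'k"
  by (rule normed_space_over_mult)

lemma bounded_ops_iff:
  assumes "normed_space_over s1" "normed_space_over s2"
  shows "T \<in> bounded_ops s1 s2 \<longleftrightarrow> (\<forall>c x. T (s1 c x) = s2 c (T x))"
proof -
  interpret a: normed_space_over s1 by fact
  interpret b: normed_space_over s2 by fact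
  show ?thesis
    unfolding bounded_ops_def Vector_Spaces.linear_iff
    using a.vector_space_axioms b.vector_space_axioms by (auto simp: blinfun.add_right)
qed

lemma dual_iff:
  assumes "normed_space_over s"
  shows "\<mu> \<in> dual s \<longleftrightarrow> (\<forall>c x. \<mu> (s c x) = c * \<mu> x)"
  unfolding dual_def using bounded_ops_iff[OF assms normed_space_over_mult] .

lemma dual_scale:
  "\<mu> \<in> dual fun_scale \<Longrightarrow> \<mu> (fun_scale c f) = c * \<mu> f"
  using dual_iff[OF normed_space_over_fun_scale] by blast

lemma apply_bcontfun_sum: "apply_bcontfun (\<Sum>i\<in>I. f i) x = (\<Sum>i\<in>I. f i x)"
  by (induction I rule: infinite_finite_induct) auto

text \<open>Rotating each \<open>g i\<close> by the phase of its image makes the images add up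
  without cancellation, so the sum is the modulus of one value of \<mu>, taken at a function of norm
  at most \<open>B\<close>.\<close>

lemma dual_sum_le:
  fixes g :: "'i \<Rightarrow> 'a::topological_space \<Rightarrow>\<^sub>C 'k::real_or_complex"
  assumes \<mu>: "\<mu> \<in> dual fun_scale"
    and B: "\<And>t. (\<Sum>i\<in>I. norm (g i t)) \<le> B"
  shows "(\<Sum>i\<in>I. norm (\<mu> (g i))) \<le> norm \<mu> * B"
proof -
  define c where "c i = phase (\<mu> (g i))" for i
  define h where "h = (\<Sum>i\<in>I. fun_scale (c i) (g i))"
  have "norm h \<le> B"
  proof (rule norm_bound)
    fix t
    have "norm (h t) \<le> (\<Sum>i\<in>I. norm (c i * g i t))"
      unfolding h_def apply_bcontfun_sum fun_scale_apply by (rule norm_sum)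
    also have "\<dots> \<le> (\<Sum>i\<in>I. norm (g i t))"
      by (intro sum_mono)
        (simp add: norm_mult c_def mult_left_le_one_le norm_phase_le)
    finally show "norm (h t) \<le> B" using B[of t] by linarith
  qed
  have "\<mu> h = (\<Sum>i\<in>I. c i * \<mu> (g i))"
    unfolding h_def by (simp add: blinfun.sum_right dual_scale[OF \<mu>])
  also have "\<dots> = of_real (\<Sum>i\<in>I. norm (\<mu> (g i)))"
    by (simp add: c_def phase_mult)
  finally have "norm (\<mu> h) = (\<Sum>i\<in>I. norm (\<mu> (g i)))"
    by (simp only: norm_of_real abs_of_nonneg sum_nonneg norm_ge_zero)
  moreover have "norm (\<mu> h) \<le> norm \<mu> * B"
    using norm_blinfun[of \<mu> h] \<open>norm h \<le> B\<close>
    by (meson mult_left_mono norm_ge_zero order_trans)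
  ultimately show ?thesis by simp
qed

text \<open>A gliding hump; this is the part of the Schur property of \<open>\<ell>\<^sub>1\<close> that is needed.\<close>

lemma diagonal_null_of_subsums_null:
  fixes x :: "nat \<Rightarrow> nat \<Rightarrow> 'b::banach"
  assumes sm: "\<And>n. summable (\<lambda>k. norm (x n k))"
    and lim: "\<And>A. (\<lambda>n. \<Sum>k. if k \<in> A then x n k else 0) \<longlonglongrightarrow> 0"
  shows "(\<lambda>n. x n n) \<longlonglongrightarrow> 0"
proof (rule ccontr)
  assume "\<not> (\<lambda>n. x n n) \<longlonglongrightarrow> 0"
  then obtain \<delta> where \<delta>: "\<delta> > 0" and inf: "\<And>N. \<exists>n\<ge>N. norm (x n n) \<ge> \<delta>"
    unfolding LIMSEQ_iff by (metis diff_zero not_le)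
  have col: "(\<lambda>n. x n k) \<longlonglongrightarrow> 0" for k
  proof -
    have "(\<Sum>j. if j \<in> {k} then x n j else 0) = x n k" for n
      by (subst suminf_finite[of "{k}"]) auto
    then show ?thesis using lim[of "{k}"] by simp
  qed
  \<comment> \<open>After the hump \<open>a\<close>, the next hump \<open>b\<close> comes so late
    that row \<open>b\<close> has little mass in the columns up to \<open>a\<close>, and row
    \<open>a\<close> little mass from column \<open>b\<close> on.\<close>
  define Q where "Q a b \<longleftrightarrow> a < b \<and> norm (x b b) \<ge> \<delta> \<and> (\<Sum>k\<le>a. norm (x b k)) < \<delta>/4
      \<and> (\<Sum>k. norm (x a (k + b))) < \<delta>/4" for a b
  have ex: "\<exists>b. Q a b" for a
  proof -
    have "(\<lambda>b. \<Sum>k\<le>a. norm (x b k)) \<longlonglongrightarrow> (\<Sum>k\<le>a. norm (0::'b))"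
      by (intro tendsto_sum tendsto_norm col)
    then have "\<forall>\<^sub>F b in sequentially. (\<Sum>k\<le>a. norm (x b k)) < \<delta>/4"
      using \<delta> by (intro order_tendstoD(2)[where y = "(\<Sum>k\<le>a. norm (0::'b))"]) auto
    moreover have "(\<lambda>b. \<Sum>k. norm (x a (k + b))) \<longlonglongrightarrow> 0"
      by (rule suminf_exist_split2[OF sm])
    then have "\<forall>\<^sub>F b in sequentially. (\<Sum>k. norm (x a (k + b))) < \<delta>/4"
      using \<delta> by (intro order_tendstoD(2)[where y = 0]) auto
    ultimately have "\<forall>\<^sub>F b in sequentially. (\<Sum>k\<le>a. norm (x b k)) < \<delta>/4
        \<and> (\<Sum>k. norm (x a (k + b))) < \<delta>/4 \<and> a < b"
      using eventually_gt_at_top[of a] by eventually_elim auto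
    then obtain N where N: "\<And>b. b \<ge> N \<Longrightarrow> (\<Sum>k\<le>a. norm (x b k)) < \<delta>/4
        \<and> (\<Sum>k. norm (x a (k + b))) < \<delta>/4 \<and> a < b"
      unfolding eventually_sequentially by blast
    then show ?thesis using inf[of N] unfolding Q_def by blast
  qed
  define nxt where "nxt a = (SOME b. Q a b)" for a
  have nxt: "Q a (nxt a)" for a
    unfolding nxt_def using ex by (rule someI_ex)
  define r where "r j = (nxt ^^ j) 0" for j
  have Q: "Q (r j) (r (Suc j))" for j
    using nxt by (simp add: r_def)
  then have mono: "strict_mono r"
    by (auto simp: strict_mono_Suc_iff Q_def)
  \<comment> \<open>Row \<open>r (Suc j)\<close> meets \<open>A\<close> in its diagonal entry, in
    columns up to \<open>r j\<close> and in columns from \<open>r (Suc (Suc j))\<close> on. The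
    latter two cost less than \<delta>/4 each, so its subsum over \<open>A\<close> keeps at least
    \<delta>/2.\<close>
  define A where "A = range r"
  have big: "norm (\<Sum>k. if k \<in> A then x (r (Suc j)) k else 0) \<ge> \<delta>/2" for j
  proof -
    define n where "n = r (Suc j)"
    define y where "y k = (if k \<in> A then x n k else 0)" for k
    have sy: "summable (\<lambda>k. norm (y k))"
      by (rule summable_comparison_test'[OF sm[of n]]) (auto simp: y_def)
    then have s': "summable y" by (rule summable_norm_cancel)
    define b where "b = r (Suc (Suc j))"
    have ab: "r j < n" "n < b"
      using Q by (auto simp: Q_def n_def b_def)
    have zero: "y k = 0" if "r j < k" "k < b" "k \<noteq> n" for k
    proof -
      have "k \<notin> A"
      proof
        assume "k \<in> A"
        then obtain i where i: "k = r i" by (auto simp: A_def)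
        with that have "j < i" "i < Suc (Suc j)"
          using strict_mono_less[OF mono] by (auto simp: b_def)
        then have "i = Suc j" by linarith
        with i \<open>k \<noteq> n\<close> show False by (simp add: n_def)
      qed
      then show ?thesis by (simp add: y_def)
    qed
    have "suminf y = (\<Sum>k. y (k + b)) + sum y {..<b}"
      using suminf_split_initial_segment[OF s'] .
    also have "{..<b} = {..r j} \<union> {n} \<union> ({r j<..<b} - {n})"
      using ab by auto
    also have "sum y \<dots> = sum y {..r j} + y n + sum y ({r j<..<b} - {n})"
      using ab by (subst sum.union_disjoint; (subst sum.union_disjoint)?; auto)
    also have "sum y ({r j<..<b} - {n}) = 0"
      using zero by (intro sum.neutral) auto
    finally have eq: "y n = suminf y - (\<Sum>k. y (k + b)) - sum y {..r j}"
      by simp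
    have "norm (\<Sum>k. y (k + b)) \<le> (\<Sum>k. norm (y (k + b)))"
      by (intro summable_norm summable_ignore_initial_segment[OF sy])
    also have "\<dots> \<le> (\<Sum>k. norm (x n (k + b)))"
      by (intro suminf_le summable_ignore_initial_segment[OF sm]
          summable_ignore_initial_segment[OF sy]) (simp add: y_def)
    also have "\<dots> < \<delta>/4" using Q[of "Suc j"] by (simp add: Q_def n_def b_def)
    finally have 1: "norm (\<Sum>k. y (k + b)) < \<delta>/4" .
    have "norm (sum y {..r j}) \<le> (\<Sum>k\<le>r j. norm (x n k))"
      by (intro sum_norm_le) (auto simp: y_def)
    also have "\<dots> < \<delta>/4" using Q[of j] by (simp add: Q_def n_def)
    finally have 2: "norm (sum y {..r j}) < \<delta>/4" .
    have "y n = x n n" by (auto simp: y_def A_def n_def)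
    then have "norm (y n) \<ge> \<delta>" using Q[of j] by (simp add: Q_def n_def)
    moreover have "norm (y n) \<le> norm (suminf y) + norm (\<Sum>k. y (k + b)) + norm (sum y {..r j})"
      unfolding eq by (meson norm_triangle_ineq4 add_right_mono order_trans)
    ultimately have "norm (suminf y) \<ge> \<delta>/2" using 1 2 by linarith
    then show ?thesis unfolding y_def[abs_def] n_def .
  qed
  have "(\<lambda>j. \<Sum>k. if k \<in> A then x (r (Suc j)) k else 0) \<longlonglongrightarrow> 0"
    using LIMSEQ_subseq_LIMSEQ[OF lim[of A], of "r \<circ> Suc"] mono
    by (simp add: o_def strict_mono_def)
  then have "(\<lambda>j. norm (\<Sum>k. if k \<in> A then x (r (Suc j)) k else 0)) \<longlonglongrightarrow> 0"
    by (rule tendsto_norm_zero)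
  then have "\<delta>/2 \<le> 0"
    by (rule LIMSEQ_le_const) (use big in auto)
  with \<delta> show False by simp
qed

lemma apply_Bcontfun_compact:
  fixes f :: "'a::topological_space \<Rightarrow> 'b::real_normed_vector"
  assumes "compact (UNIV :: 'a set)" "continuous_on UNIV f"
  shows "apply_bcontfun (Bcontfun f) = f"
proof -
  have "bounded (range f)"
    using compact_continuous_image[OF assms(2,1)] by (rule compact_imp_bounded)
  then have "f \<in> bcontfun"
    using assms(2) by (simp add: bcontfun_def)
  then show ?thesis by (rule Bcontfun_inverse)
qed

text \<open>By \<open>dual_sum_le\<close> the increments of \<open>\<nu> (F J)\<close> are
  absolutely summable. The functions themselves may converge only pointwise, to a discontinuous
  limit.\<close>

lemma dual_lim_exists:
  fixes F :: "nat \<Rightarrow> 'a::topological_space \<Rightarrow>\<^sub>C 'k::real_or_complex"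
  assumes \<nu>: "\<nu> \<in> dual fun_scale"
    and var: "\<And>J t. (\<Sum>j<J. norm (F (Suc j) t - F j t)) \<le> 1"
  shows "(\<lambda>J. \<nu> (F J)) \<longlonglongrightarrow> lim (\<lambda>J. \<nu> (F J))"
proof -
  have "(\<Sum>j<J. norm (\<nu> (F (Suc j) - F j))) \<le> norm \<nu> * 1" for J
    by (rule dual_sum_le[OF \<nu>]) (use var in simp)
  then have "summable (\<lambda>j. norm (\<nu> (F (Suc j) - F j)))"
    by (intro summableI_nonneg_bounded) auto
  then have "summable (\<lambda>j. \<nu> (F (Suc j) - F j))"
    by (rule summable_norm_cancel)
  then have "convergent (\<lambda>J. \<Sum>j<J. \<nu> (F (Suc j) - F j))"
    by (simp add: summable_iff_convergent)
  moreover have "(\<Sum>j<J. \<nu> (F (Suc j) - F j)) = \<nu> (F J) - \<nu> (F 0)" for J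
    using sum_lessThan_telescope[of "\<lambda>j. \<nu> (F j)" J] by (simp add: blinfun.diff_right)
  ultimately have "convergent (\<lambda>J. \<nu> (F J) - \<nu> (F 0))" by simp
  then have "convergent (\<lambda>J. (\<nu> (F J) - \<nu> (F 0)) + \<nu> (F 0))"
    by (intro convergent_add convergent_const)
  then show ?thesis by (simp add: convergent_LIMSEQ_iff)
qed

lemma op_scale_dual_apply:
  "op_scale (*) c \<nu> f = (c::'k::real_or_complex) * blinfun_apply \<nu> f"
  by (rule ks.op_scale_apply)

text \<open>The limits of \<open>\<nu> (F k J)\<close> as \<open>J \<rightarrow> \<infinity>\<close> are the coefficients of a bounded operator from
  the dual space to \<open>\<ell>\<^sub>1\<close>; composed with the indicator functions of sets of indices it yields
  elements of the bidual.\<close>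

lemma grothendieck_diagonal_null:
  fixes F :: "nat \<Rightarrow> nat \<Rightarrow> 'a::topological_space \<Rightarrow>\<^sub>C 'k::real_or_complex"
  assumes G: "grothendieck_space (fun_scale :: 'k \<Rightarrow> ('a \<Rightarrow>\<^sub>C 'k) \<Rightarrow> _)"
    and \<mu>: "\<And>n. \<mu> n \<in> dual fun_scale" "weak_star_convergent fun_scale \<mu>"
    and disj: "\<And>J t. (\<Sum>k\<le>J. norm (F k J t)) \<le> 1"
    and var: "\<And>k J t. (\<Sum>j<J. norm (F k (Suc j) t - F k j t)) \<le> 1"
  shows "(\<lambda>n. lim (\<lambda>J. \<mu> n (F n J))) \<longlonglongrightarrow> 0"
proof -
  define \<Phi> where "\<Phi> k \<nu> = lim (\<lambda>J. blinfun_apply \<nu> (F k J))" for k and \<nu> :: "('a \<Rightarrow>\<^sub>C 'k) \<Rightarrow>\<^sub>L 'k"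
  have lim: "(\<lambda>J. \<nu> (F k J)) \<longlonglongrightarrow> \<Phi> k \<nu>" if "\<nu> \<in> dual fun_scale" for k \<nu>
    unfolding \<Phi>_def using that var by (rule dual_lim_exists)
  have sum_le: "(\<Sum>k<N. norm (\<Phi> k \<nu>)) \<le> norm \<nu>" if \<nu>: "\<nu> \<in> dual fun_scale" for N \<nu>
  proof (rule LIMSEQ_le_const2)
    show "(\<lambda>J. \<Sum>k<N. norm (\<nu> (F k J))) \<longlonglongrightarrow> (\<Sum>k<N. norm (\<Phi> k \<nu>))"
      by (intro tendsto_sum tendsto_norm lim \<nu>)
    have "(\<Sum>k<N. norm (\<nu> (F k J))) \<le> norm \<nu>" if "J \<ge> N" for J
    proof -
      have "(\<Sum>k<N. norm (\<nu> (F k J))) \<le> (\<Sum>k\<le>J. norm (\<nu> (F k J)))"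
        using that by (intro sum_mono2) auto
      also have "\<dots> \<le> norm \<nu> * 1"
        by (rule dual_sum_le[OF \<nu> disj])
      finally show ?thesis by simp
    qed
    then show "\<exists>M. \<forall>J\<ge>M. (\<Sum>k<N. norm (\<nu> (F k J))) \<le> norm \<nu>" by blast
  qed
  have sm: "summable (\<lambda>k. norm (\<Phi> k \<nu>))" if "\<nu> \<in> dual fun_scale" for \<nu>
    using sum_le[OF that] by (intro summableI_nonneg_bounded) auto
  have sm_le: "(\<Sum>k. norm (\<Phi> k \<nu>)) \<le> norm \<nu>" if "\<nu> \<in> dual fun_scale" for \<nu>
    using sum_le[OF that] by (intro suminf_le_const sm that)
  have dual_add: "\<nu> + \<nu>' \<in> dual fun_scale"
    if "\<nu> \<in> dual fun_scale" "\<nu>' \<in> dual fun_scale" for \<nu> \<nu>' :: "('a \<Rightarrow>\<^sub>C 'k) \<Rightarrow>\<^sub>L 'k"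
    using that by (simp add: dual_iff[OF normed_space_over_fun_scale] blinfun.add_left algebra_simps)
  have dual_sc: "op_scale (*) c \<nu> \<in> dual fun_scale"
    if "\<nu> \<in> dual fun_scale" for c and \<nu> :: "('a \<Rightarrow>\<^sub>C 'k) \<Rightarrow>\<^sub>L 'k"
    using that by (simp add: dual_iff[OF normed_space_over_fun_scale] op_scale_dual_apply algebra_simps)
  have add: "\<Phi> k (\<nu> + \<nu>') = \<Phi> k \<nu> + \<Phi> k \<nu>'"
    if "\<nu> \<in> dual fun_scale" "\<nu>' \<in> dual fun_scale" for k \<nu> \<nu>'
    using tendsto_add[OF lim[OF that(1)] lim[OF that(2)], of k k] lim[OF dual_add[OF that], of k]
    unfolding blinfun.add_left by (blast intro: LIMSEQ_unique)
  have scale: "\<Phi> k (op_scale (*) c \<nu>) = c * \<Phi> k \<nu>" if "\<nu> \<in> dual fun_scale" for k c \<nu>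
    using tendsto_mult_left[OF lim[OF that, of k], of c] lim[OF dual_sc[OF that, of c], of k]
    unfolding op_scale_dual_apply by (blast intro: LIMSEQ_unique)
  define \<Psi> where "\<Psi> A \<nu> = (\<Sum>k. if k \<in> A then \<Phi> k \<nu> else 0)" for A \<nu>
  have smA': "summable (\<lambda>k. norm (if k \<in> A then \<Phi> k \<nu> else 0))"
    if "\<nu> \<in> dual fun_scale" for A \<nu>
    by (rule summable_comparison_test'[OF sm[OF that]]) auto
  have smA: "summable (\<lambda>k. if k \<in> A then \<Phi> k \<nu> else 0)"
    if "\<nu> \<in> dual fun_scale" for A \<nu>
    using smA'[OF that] by (rule summable_norm_cancel)
  have bid: "\<Psi> A \<in> bidual fun_scale" for A
    unfolding bidual_def bounded_linear_on_def linear_on_def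
  proof (intro CollectI conjI ballI allI exI)
    fix \<nu> \<nu>' :: "('a \<Rightarrow>\<^sub>C 'k) \<Rightarrow>\<^sub>L 'k" and c :: 'k
    assume \<nu>: "\<nu> \<in> dual fun_scale"
    show "\<Psi> A (op_scale (*) c \<nu>) = c * \<Psi> A \<nu>"
      unfolding \<Psi>_def suminf_mult[OF smA[OF \<nu>], symmetric]
      by (intro suminf_cong) (simp add: scale \<nu>)
    have "norm (\<Psi> A \<nu>) \<le> (\<Sum>k. norm (if k \<in> A then \<Phi> k \<nu> else 0))"
      unfolding \<Psi>_def by (rule summable_norm[OF smA'[OF \<nu>]])
    also have "\<dots> \<le> (\<Sum>k. norm (\<Phi> k \<nu>))"
      by (intro suminf_le smA'[OF \<nu>] sm[OF \<nu>]) auto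
    also have "\<dots> \<le> norm \<nu>" by (rule sm_le[OF \<nu>])
    finally show "norm (\<Psi> A \<nu>) \<le> 1 * norm \<nu>" by simp
    assume \<nu>': "\<nu>' \<in> dual fun_scale"
    show "\<Psi> A (\<nu> + \<nu>') = \<Psi> A \<nu> + \<Psi> A \<nu>'"
      unfolding \<Psi>_def suminf_add[OF smA[OF \<nu>] smA[OF \<nu>']]
      by (intro suminf_cong) (simp add: add \<nu> \<nu>')
  qed
  have "weakly_convergent fun_scale \<mu>"
    using G \<mu> unfolding grothendieck_space_def by blast
  then obtain l where l: "l \<in> dual fun_scale"
    and wl: "\<And>\<Psi>. \<Psi> \<in> bidual fun_scale \<Longrightarrow> (\<lambda>n. \<Psi> (\<mu> n)) \<longlonglongrightarrow> \<Psi> l"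
    unfolding weakly_convergent_def by blast
  \<comment> \<open>Weak convergence tested on \<open>\<Psi> A\<close> says that the subsums over
    \<open>A\<close> of the differences of coefficients tend to 0. Subtracting the limit
    \<open>l\<close> is harmless on the diagonal, since its own coefficients are summable.\<close>
  have "(\<lambda>n. \<Phi> n (\<mu> n) - \<Phi> n l) \<longlonglongrightarrow> 0"
  proof (rule diagonal_null_of_subsums_null[where x = "\<lambda>n k. \<Phi> k (\<mu> n) - \<Phi> k l"])
    show "summable (\<lambda>k. norm (\<Phi> k (\<mu> n) - \<Phi> k l))" for n
      by (rule summable_comparison_test'[OF summable_add[OF sm[OF \<mu>(1)[of n]] sm[OF l]]])
        (simp add: norm_triangle_ineq4)
    show "(\<lambda>n. \<Sum>k. if k \<in> A then \<Phi> k (\<mu> n) - \<Phi> k l else 0) \<longlonglongrightarrow> 0" for A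
    proof -
      have "(\<Sum>k. if k \<in> A then \<Phi> k (\<mu> n) - \<Phi> k l else 0) = \<Psi> A (\<mu> n) - \<Psi> A l" for n
        unfolding \<Psi>_def suminf_diff[OF smA[OF \<mu>(1)] smA[OF l]]
        by (intro suminf_cong) simp
      then show ?thesis using wl[OF bid[of A]] by (simp add: LIM_zero)
    qed
  qed
  moreover have "(\<lambda>n. \<Phi> n l) \<longlonglongrightarrow> 0"
    using summable_LIMSEQ_zero[OF sm[OF l]] by (simp add: tendsto_norm_zero_iff)
  ultimately have "(\<lambda>n. \<Phi> n (\<mu> n) - \<Phi> n l + \<Phi> n l) \<longlonglongrightarrow> 0 + 0"
    by (rule tendsto_add)
  then show ?thesis by (simp add: \<Phi>_def)
qed

section \<open>Total variation\<close>

text \<open>For \<mu> in the dual of \<open>C(K)\<close> and continuous \<open>f \<ge> 0\<close>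
  this is the integral of \<open>f\<close> against the total variation of the measure representing
  \<mu>.\<close>

definition variation :: "(('a::topological_space \<Rightarrow>\<^sub>C 'k::real_or_complex) \<Rightarrow>\<^sub>L 'k) \<Rightarrow> ('a \<Rightarrow> real) \<Rightarrow> real" where
  "variation \<mu> f = (SUP g\<in>{g. \<forall>t. norm (apply_bcontfun g t) \<le> f t}. norm (blinfun_apply \<mu> g))"

lemma bdd_above_variation:
  assumes "bdd_above (range f)"
  shows "bdd_above ((\<lambda>g. norm (blinfun_apply \<mu> g)) ` {g. \<forall>t. norm (apply_bcontfun g t) \<le> f t})"
proof -
  obtain B where B: "\<And>t. f t \<le> B" using assms by (auto simp: bdd_above_def)
  have "norm (blinfun_apply \<mu> g) \<le> norm \<mu> * B" if "\<forall>t. norm (apply_bcontfun g t) \<le> f t" for g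
  proof -
    have "norm g \<le> B" by (rule norm_bound) (use that B order_trans in blast)
    then show ?thesis
      using norm_blinfun[of \<mu> g] by (meson mult_left_mono norm_ge_zero order_trans)
  qed
  then show ?thesis by (auto intro!: bdd_aboveI2)
qed

lemma variation_upper:
  assumes "bdd_above (range f)" "\<And>t. norm (apply_bcontfun g t) \<le> f t"
  shows "norm (blinfun_apply \<mu> g) \<le> variation \<mu> f"
  unfolding variation_def
  by (rule cSUP_upper[OF _ bdd_above_variation[OF assms(1)]]) (use assms(2) in simp)

lemma variation_least:
  assumes "\<And>t. 0 \<le> f t" "\<And>g. (\<And>t. norm (apply_bcontfun g t) \<le> f t) \<Longrightarrow> norm (blinfun_apply \<mu> g) \<le> b"
  shows "variation \<mu> f \<le> b"
  unfolding variation_def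
proof (rule cSUP_least)
  have "0 \<in> {g. \<forall>t. norm (apply_bcontfun g t) \<le> f t}" using assms(1) by simp
  then show "{g. \<forall>t. norm (apply_bcontfun g t) \<le> f t} \<noteq> {}" by blast
qed (use assms(2) in auto)

lemma bdd_above_continuous:
  fixes f :: "'a::topological_space \<Rightarrow> real"
  assumes "compact (UNIV :: 'a set)" "continuous_on UNIV f"
  shows "bdd_above (range f)"
  by (rule bounded_imp_bdd_above[OF compact_imp_bounded[OF compact_continuous_image[OF assms(2,1)]]])

lemma variation_nonneg:
  assumes "bdd_above (range f)" "\<And>t. 0 \<le> f t"
  shows "0 \<le> variation \<mu> f"
  using variation_upper[OF assms(1), of 0 \<mu>] assms(2) by simp

context
  fixes \<mu> :: "('a::topological_space \<Rightarrow>\<^sub>C 'k::real_or_complex) \<Rightarrow>\<^sub>L 'k"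
  assumes cpt: "compact (UNIV :: 'a set)" and \<mu>: "\<mu> \<in> dual fun_scale"
begin

text \<open>Functions \<open>u\<close> and \<open>v\<close> below \<open>f\<close> and
  \<open>g\<close> are rotated so that their images become nonnegative; the sum is then admissible
  for \<open>f + g\<close>. The suprema over \<open>u\<close> and over \<open>v\<close> are taken
  one after the other.\<close>

lemma variation_superadditive:
  assumes f: "continuous_on UNIV f" "\<And>t. 0 \<le> f t" and g: "continuous_on UNIV g" "\<And>t. 0 \<le> g t"
  shows "variation \<mu> f + variation \<mu> g \<le> variation \<mu> (\<lambda>t. f t + g t)"
proof -
  have bdd: "bdd_above (range (\<lambda>t. f t + g t))"
    by (intro bdd_above_continuous cpt continuous_intros f g)
  have *: "norm (\<mu> u) + norm (\<mu> v) \<le> variation \<mu> (\<lambda>t. f t + g t)"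
    if u: "\<And>t. norm (apply_bcontfun u t) \<le> f t" and v: "\<And>t. norm (apply_bcontfun v t) \<le> g t" for u v
  proof -
    define h where "h = fun_scale (phase (\<mu> u)) u + fun_scale (phase (\<mu> v)) v"
    have "\<mu> h = of_real (norm (\<mu> u) + norm (\<mu> v))"
      by (simp add: h_def blinfun.add_right dual_scale[OF \<mu>] phase_mult)
    then have "norm (\<mu> u) + norm (\<mu> v) = norm (\<mu> h)"
      by (simp only: norm_of_real abs_of_nonneg add_nonneg_nonneg norm_ge_zero)
    also have "\<dots> \<le> variation \<mu> (\<lambda>t. f t + g t)"
    proof (rule variation_upper[OF bdd])
      fix t
      have "norm (phase (\<mu> u) * u t) \<le> norm (u t)" "norm (phase (\<mu> v) * v t) \<le> norm (v t)"
        by (simp_all add: norm_mult mult_left_le_one_le norm_phase_le)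
      then show "norm (h t) \<le> f t + g t"
        unfolding h_def plus_bcontfun.rep_eq fun_scale_apply
        using u[of t] v[of t] norm_triangle_ineq[of "phase (\<mu> u) * u t" "phase (\<mu> v) * v t"]
        by linarith
    qed
    finally show ?thesis .
  qed
  have "variation \<mu> f \<le> variation \<mu> (\<lambda>t. f t + g t) - norm (\<mu> v)"
    if v: "\<And>t. norm (apply_bcontfun v t) \<le> g t" for v
    using *[OF _ v] by (intro variation_least f) (simp add: le_diff_eq)
  then have "variation \<mu> g \<le> variation \<mu> (\<lambda>t. f t + g t) - variation \<mu> f"
    by (intro variation_least g) (simp add: le_diff_eq add.commute)
  then show ?thesis by simp
qed

text \<open>Riesz decomposition: a function bounded by \<open>f + g\<close> is split in the ratio of \<open>f\<close> and \<open>g\<close>;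
  the summand \<open>e\<close> keeps the denominator away from zero.\<close>

lemma variation_subadditive:
  assumes f: "continuous_on UNIV f" "\<And>t. 0 \<le> f t" and g: "continuous_on UNIV g" "\<And>t. 0 \<le> g t"
  shows "variation \<mu> (\<lambda>t. f t + g t) \<le> variation \<mu> f + variation \<mu> g"
proof (rule variation_least)
  show "0 \<le> f t + g t" for t using f(2) g(2) by (simp add: add_nonneg_nonneg)
  fix h :: "'a \<Rightarrow>\<^sub>C 'k"
  assume h: "\<And>t. norm (h t) \<le> f t + g t"
  have le: "norm (\<mu> h) \<le> variation \<mu> f + variation \<mu> g + norm \<mu> * e" if e: "e > 0" for e
  proof -
    have pos: "f t + g t + e > 0" for t using f(2)[of t] g(2)[of t] e by linarith
    define part where "part k = Bcontfun (\<lambda>t. (k t / (f t + g t + e)) *\<^sub>R h t)" for k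
    have part: "part k t = (k t / (f t + g t + e)) *\<^sub>R h t" if "continuous_on UNIV k" for k t
    proof -
      have "continuous_on UNIV (\<lambda>t. (k t / (f t + g t + e)) *\<^sub>R h t)"
        using pos by (intro continuous_intros that f g) (auto simp: less_imp_neq[symmetric])
      then show ?thesis unfolding part_def by (subst apply_Bcontfun_compact[OF cpt]) auto
    qed
    have part_le: "norm (part k t) \<le> k t" if k: "continuous_on UNIV k" "\<And>t. 0 \<le> k t" for k t
    proof -
      have "k t * norm (h t) \<le> k t * (f t + g t + e)"
        using h[of t] e k(2)[of t] by (intro mult_left_mono) auto
      then have "k t * norm (h t) / (f t + g t + e) \<le> k t"
        using pos[of t] by (simp add: divide_le_eq)
      then show ?thesis using pos[of t] k by (simp add: part abs_of_nonneg)
    qed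
    have "h = part f + part g + part (\<lambda>_. e)"
    proof (rule bcontfun_eqI)
      fix t
      have "f t / (f t + g t + e) + g t / (f t + g t + e) + e / (f t + g t + e) = 1"
        using pos[of t] by (simp add: add_divide_distrib[symmetric])
      then show "h t = (part f + part g + part (\<lambda>_. e)) t"
        unfolding plus_bcontfun.rep_eq part[OF f(1)] part[OF g(1)] part[OF continuous_on_const]
          scaleR_left_distrib[symmetric] by simp
    qed
    then have "norm (\<mu> h) \<le> norm (\<mu> (part f)) + norm (\<mu> (part g)) + norm (\<mu> (part (\<lambda>_. e)))"
      using norm_triangle_ineq[of "\<mu> (part f) + \<mu> (part g)" "\<mu> (part (\<lambda>_. e))"]
        norm_triangle_ineq[of "\<mu> (part f)" "\<mu> (part g)"]
      by (simp only: blinfun.add_right)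
    moreover have "norm (\<mu> (part f)) \<le> variation \<mu> f"
      by (intro variation_upper bdd_above_continuous part_le cpt f)
    moreover have "norm (\<mu> (part g)) \<le> variation \<mu> g"
      by (intro variation_upper bdd_above_continuous part_le cpt g)
    moreover have "norm (\<mu> (part (\<lambda>_. e))) \<le> norm \<mu> * e"
    proof -
      have "norm (part (\<lambda>_. e)) \<le> e"
        by (intro norm_bound part_le) (use e in auto)
      then show ?thesis
        using norm_blinfun[of \<mu> "part (\<lambda>_. e)"] by (meson mult_left_mono norm_ge_zero order_trans)
    qed
    ultimately show ?thesis by linarith
  qed
  \<comment> \<open>The piece belonging to \<open>e\<close> contributed
    \<open>norm \<mu> * e\<close>, which disappears as \<open>e\<close> tends to 0.\<close>
  have "((\<lambda>e. variation \<mu> f + variation \<mu> g + norm \<mu> * e) \<longlongrightarrow> variation \<mu> f + variation \<mu> g + norm \<mu> * 0)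
      (at_right 0)"
    by (intro tendsto_intros)
  moreover have "\<forall>\<^sub>F e in at_right 0. norm (\<mu> h) \<le> variation \<mu> f + variation \<mu> g + norm \<mu> * e"
    using le by (auto simp: eventually_at_right_less eventually_at_filter)
  ultimately show "norm (\<mu> h) \<le> variation \<mu> f + variation \<mu> g"
    using tendsto_lowerbound[OF _ _ trivial_limit_at_right_real] by fastforce
qed

lemma variation_add:
  assumes "continuous_on UNIV f" "\<And>t. 0 \<le> f t" "continuous_on UNIV g" "\<And>t. 0 \<le> g t"
  shows "variation \<mu> (\<lambda>t. f t + g t) = variation \<mu> f + variation \<mu> g"
  using variation_superadditive variation_subadditive assms by (simp add: eq_iff)

lemma variation_zero: "variation \<mu> (\<lambda>_. 0) = 0"
  using variation_add[of "\<lambda>_. 0" "\<lambda>_. 0"] by simp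

lemma variation_scale:
  assumes f: "continuous_on UNIV f" "\<And>t. 0 \<le> f t" and "0 \<le> c"
  shows "variation \<mu> (\<lambda>t. c * f t) = c * variation \<mu> f"
proof -
  have *: "variation \<mu> (\<lambda>t. c * f t) \<le> c * variation \<mu> f"
    if f: "continuous_on UNIV f" "\<And>t. 0 \<le> f t" and c: "0 < c" for c f
  proof (rule variation_least)
    fix h :: "'a \<Rightarrow>\<^sub>C 'k"
    assume h: "\<And>t. norm (h t) \<le> c * f t"
    have "norm (\<mu> ((1/c) *\<^sub>R h)) \<le> variation \<mu> f"
      by (rule variation_upper)
        (use bdd_above_continuous[OF cpt f(1)] h c in \<open>auto simp: field_simps\<close>)
    then show "norm (\<mu> h) \<le> c * variation \<mu> f"
      using c by (simp add: blinfun.scaleR_right field_simps)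
  qed (use c f in auto)
  show ?thesis
  proof (cases "c = 0")
    case False
    then have c: "0 < c" using \<open>0 \<le> c\<close> by simp
    \<comment> \<open>The reverse inequality is the same estimate for the factor \<open>1/c\<close>
      and the function \<open>c * f\<close>.\<close>
    have "variation \<mu> (\<lambda>t. 1/c * (c * f t)) \<le> 1/c * variation \<mu> (\<lambda>t. c * f t)"
      by (rule *) (use f c in \<open>auto intro!: continuous_intros\<close>)
    then have "c * variation \<mu> f \<le> variation \<mu> (\<lambda>t. c * f t)"
      using c by (simp add: field_simps)
    then show ?thesis using *[OF f c] by simp
  qed (simp add: variation_zero)
qed

text \<open>Extends an additive map from the cone of nonnegative functions through
  \<open>f = f\<^sup>+ - f\<^sup>-\<close>, to obtain a positive linear functional.\<close>

definition variation_functional :: "('a \<Rightarrow> real) \<Rightarrow> real" where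
  "variation_functional f = variation \<mu> (\<lambda>t. max 0 (f t)) - variation \<mu> (\<lambda>t. max 0 (- f t))"

text \<open>From \<open>f\<^sup>+ + b = a + f\<^sup>-\<close> and additivity on the cone. This
  independence of the decomposition gives linearity below.\<close>

lemma variation_functional_diff:
  assumes a: "continuous_on UNIV a" "\<And>t. 0 \<le> a t" and b: "continuous_on UNIV b" "\<And>t. 0 \<le> b t"
    and f: "\<And>t. f t = a t - b t"
  shows "variation_functional f = variation \<mu> a - variation \<mu> b"
proof -
  have cf: "continuous_on UNIV f"
    using continuous_on_diff[OF a(1) b(1)] f by (simp cong: continuous_on_cong)
  have "variation \<mu> (\<lambda>t. max 0 (f t) + b t) = variation \<mu> (\<lambda>t. a t + max 0 (- f t))"
    by (rule arg_cong[where f = "variation \<mu>"]) (auto simp: f max_def)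
  then have "variation \<mu> (\<lambda>t. max 0 (f t)) + variation \<mu> b
      = variation \<mu> a + variation \<mu> (\<lambda>t. max 0 (- f t))"
    using cf a b by (subst (asm) (1 2) variation_add) (auto intro!: continuous_intros)
  then show ?thesis by (simp add: variation_functional_def)
qed

lemma variation_functional_nonneg_eq:
  assumes "continuous_on UNIV f" "\<And>t. 0 \<le> f t"
  shows "variation_functional f = variation \<mu> f"
  using variation_functional_diff[OF assms, of "\<lambda>_. 0" f] by (simp add: variation_zero)

lemma variation_functional_add:
  assumes "continuous_on UNIV f" "continuous_on UNIV g"
  shows "variation_functional (\<lambda>t. f t + g t) = variation_functional f + variation_functional g"
proof -
  have "variation_functional (\<lambda>t. f t + g t) = variation \<mu> (\<lambda>t. max 0 (f t) + max 0 (g t))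
      - variation \<mu> (\<lambda>t. max 0 (- f t) + max 0 (- g t))"
    using assms
    by (intro variation_functional_diff add_nonneg_nonneg max.cobounded1 continuous_intros)
      (simp_all add: max_def)
  also have "\<dots> = variation \<mu> (\<lambda>t. max 0 (f t)) + variation \<mu> (\<lambda>t. max 0 (g t))
      - (variation \<mu> (\<lambda>t. max 0 (- f t)) + variation \<mu> (\<lambda>t. max 0 (- g t)))"
    using assms by (subst (1 2) variation_add) (auto intro!: continuous_intros)
  finally show ?thesis by (simp add: variation_functional_def)
qed

lemma variation_functional_scale:
  assumes f: "continuous_on UNIV f"
  shows "variation_functional (\<lambda>t. c * f t) = c * variation_functional f"
proof (cases "c \<ge> 0")
  case True
  have "variation_functional (\<lambda>t. c * f t)
      = variation \<mu> (\<lambda>t. c * max 0 (f t)) - variation \<mu> (\<lambda>t. c * max 0 (- f t))"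
    using f True
    by (intro variation_functional_diff mult_nonneg_nonneg max.cobounded1 continuous_intros)
      (simp_all add: max_def)
  also have "\<dots> = c * variation \<mu> (\<lambda>t. max 0 (f t)) - c * variation \<mu> (\<lambda>t. max 0 (- f t))"
    using f True by (subst (1 2) variation_scale) (auto intro!: continuous_intros)
  finally show ?thesis by (simp add: variation_functional_def right_diff_distrib)
next
  case False
  have "variation_functional (\<lambda>t. c * f t)
      = variation \<mu> (\<lambda>t. - c * max 0 (- f t)) - variation \<mu> (\<lambda>t. - c * max 0 (f t))"
    using f False
    by (intro variation_functional_diff mult_nonneg_nonneg max.cobounded1 continuous_intros)
      (simp_all add: max_def)
  also have "\<dots> = - c * variation \<mu> (\<lambda>t. max 0 (- f t)) - - c * variation \<mu> (\<lambda>t. max 0 (f t))"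
    using f False by (subst (1 2) variation_scale) (auto intro!: continuous_intros)
  finally show ?thesis by (simp add: variation_functional_def algebra_simps)
qed

end

section \<open>Subspaces on which the supremum norm is dominated by an integral\<close>

text \<open>An abstract integral; the instance used later is a finite sum of total
  variations.\<close>

locale positive_functional =
  fixes L :: "('a::topological_space \<Rightarrow> real) \<Rightarrow> real"
  assumes cpt: "compact (UNIV :: 'a set)"
    and L_add: "\<And>f g. continuous_on UNIV f \<Longrightarrow> continuous_on UNIV g \<Longrightarrow> L (\<lambda>t. f t + g t) = L f + L g"
    and L_scale: "\<And>c f. continuous_on UNIV f \<Longrightarrow> L (\<lambda>t. c * f t) = c * L f"
    and L_nonneg: "\<And>f. continuous_on UNIV f \<Longrightarrow> (\<And>t. 0 \<le> f t) \<Longrightarrow> 0 \<le> L f"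
begin

lemma L_zero: "L (\<lambda>_. 0) = 0"
  using L_scale[of "\<lambda>_. 0" 0] by simp

lemma L_mono:
  assumes "continuous_on UNIV f" "continuous_on UNIV g" "\<And>t. f t \<le> g t"
  shows "L f \<le> L g"
proof -
  have "L (\<lambda>t. f t + (g t - f t)) = L f + L (\<lambda>t. g t - f t)"
    by (intro L_add continuous_intros assms)
  moreover have "L (\<lambda>t. g t - f t) \<ge> 0"
    by (intro L_nonneg continuous_intros assms) (use assms in simp)
  ultimately show ?thesis by simp
qed

lemma L_sum:
  assumes "\<And>i. i \<in> I \<Longrightarrow> continuous_on UNIV (f i)"
  shows "L (\<lambda>t. \<Sum>i\<in>I. f i t) = (\<Sum>i\<in>I. L (f i))"
  using assms
proof (induction I rule: infinite_finite_induct)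
  case (insert x F)
  have "L (\<lambda>t. f x t + (\<Sum>i\<in>F. f i t)) = L (f x) + L (\<lambda>t. \<Sum>i\<in>F. f i t)"
    using insert.prems by (intro L_add continuous_on_sum) auto
  with insert show ?case by simp
qed (simp_all add: L_zero)

text \<open>The real \<open>L\<^sub>2\<close> inner product for the integral \<open>L\<close>; in
  general it is only positive semidefinite.\<close>

definition ip :: "('a \<Rightarrow>\<^sub>C 'b::euclidean_space) \<Rightarrow> ('a \<Rightarrow>\<^sub>C 'b) \<Rightarrow> real" where
  "ip f g = L (\<lambda>t. f t \<bullet> g t)"

lemma ip_commute: "ip f g = ip g f"
  by (simp add: ip_def inner_commute)

lemma ip_add: "ip (f + g) h = ip f h + ip g h"
  unfolding ip_def plus_bcontfun.rep_eq inner_add_left by (intro L_add continuous_intros) auto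

lemma ip_scale: "ip (c *\<^sub>R f) h = c * ip f h"
  unfolding ip_def scaleR_bcontfun.rep_eq inner_scaleR_left by (intro L_scale continuous_intros) auto

lemma ip_zero: "ip 0 h = 0"
  by (simp add: ip_def L_zero)

lemma ip_sum: "ip (\<Sum>i\<in>I. f i) h = (\<Sum>i\<in>I. ip (f i) h)"
  by (induction I rule: infinite_finite_induct) (auto simp: ip_zero ip_add)

text \<open>If the \<open>L\<^sub>2\<close> norm dominates the supremum norm on \<open>W\<close>, then an orthonormal system
  \<open>E\<close> satisfies \<open>\<Sum>\<^bsub>e\<in>E\<^esub> \<bar>e(t)\<bar>\<^sup>2 \<le> C\<close> at each point \<open>t\<close>; integration bounds the size of \<open>E\<close>.\<close>

lemma finite_span_if_norm_le_L2:
  fixes W :: "('a \<Rightarrow>\<^sub>C 'b::euclidean_space) set"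
  assumes W: "subspace W" and \<kappa>: "0 < \<kappa>"
    and le: "\<And>w. w \<in> W \<Longrightarrow> \<kappa> * (norm w)\<^sup>2 \<le> ip w w"
  shows "\<exists>F. finite F \<and> span F = W"
proof (rule ccontr)
  assume inf: "\<nexists>F. finite F \<and> span F = W"
  define onb where "onb E \<longleftrightarrow> finite E \<and> E \<subseteq> W \<and>
      (\<forall>e\<in>E. \<forall>f\<in>E. ip e f = (if e = f then 1 else 0))" for E
  have coef: "ip (\<Sum>e\<in>E. c e *\<^sub>R e) f = c f" if "onb E" "f \<in> E" for E c f
  proof -
    have "ip (\<Sum>e\<in>E. c e *\<^sub>R e) f = (\<Sum>e\<in>E. if e = f then c e else 0)"
      unfolding ip_sum ip_scale using that by (intro sum.cong) (auto simp: onb_def)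
    also have "\<dots> = c f" using that by (simp add: onb_def)
    finally show ?thesis .
  qed
  have extend: "\<exists>E'. onb E' \<and> card E' = Suc (card E)" if E: "onb E" for E
  proof -
    have "span E \<subseteq> W" using E W by (intro span_minimal) (auto simp: onb_def)
    then obtain w where w: "w \<in> W" "w \<notin> span E"
      using inf E unfolding onb_def by blast
    define p where "p = (\<Sum>e\<in>E. ip w e *\<^sub>R e)"
    have p: "p \<in> span E" unfolding p_def by (intro span_sum span_scale span_base)
    define v where "v = w - p"
    have vW: "v \<in> W" using w p \<open>span E \<subseteq> W\<close> W by (auto simp: v_def intro: subspace_diff)
    have "v \<noteq> 0" using w p by (auto simp: v_def)
    \<comment> \<open>The domination hypothesis makes \<open>ip\<close> definite on
      \<open>W\<close>, so the Gram-Schmidt remainder \<open>v\<close> can be normalized.\<close>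
    then have pos: "ip v v > 0"
      using le[OF vW] \<kappa> by (smt (verit) mult_pos_pos zero_less_norm_iff zero_less_power)
    have orth: "ip v f = 0" if "f \<in> E" for f
    proof -
      have "ip w f = ip (v + p) f" by (simp add: v_def)
      then show ?thesis using coef[OF E that, of "ip w"] by (simp add: ip_add p_def)
    qed
    define u where "u = (1 / sqrt (ip v v)) *\<^sub>R v"
    have uu: "ip u u = 1"
      using pos by (simp add: u_def ip_scale ip_commute[of v "_ *\<^sub>R _"])
    have uE: "ip u f = 0" if "f \<in> E" for f
      using orth[OF that] by (simp add: u_def ip_scale)
    have uE': "ip f u = 0" if "f \<in> E" for f
      using uE[OF that] by (simp add: ip_commute)
    have uW: "u \<in> W" unfolding u_def by (rule subspace_scale[OF W vW])
    have "u \<notin> E"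
      using uu uE by force
    moreover have "onb (insert u E)"
      using E uu uE uE' uW unfolding onb_def by auto
    ultimately show ?thesis using E by (intro exI[of _ "insert u E"]) (simp add: onb_def)
  qed
  have ex: "\<exists>E. onb E \<and> card E = n" for n
  proof (induction n)
    case 0
    show ?case by (intro exI[of _ "{}"]) (simp add: onb_def)
  next
    case (Suc n)
    then show ?case using extend by metis
  qed
  have bound: "\<kappa> * real (card E) \<le> real DIM('b) * L (\<lambda>_. 1)" if E: "onb E" for E
  proof -
    \<comment> \<open>With respect to \<open>ip\<close>, the element \<open>v\<close> represents on
      the span of \<open>E\<close> the functional that takes coordinate \<open>b\<close> of the
      value at \<open>t\<close>; hence \<open>ip v v = S\<close>. The hypothesis turns
      \<open>S \<le> norm v\<close> into \<open>\<kappa> * S\<^sup>2 \<le> S\<close>.\<close>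
    have pt: "\<kappa> * (\<Sum>e\<in>E. (apply_bcontfun e t \<bullet> b)\<^sup>2) \<le> 1" if b: "b \<in> Basis" for t and b :: 'b
    proof -
      define S where "S = (\<Sum>e\<in>E. (apply_bcontfun e t \<bullet> b)\<^sup>2)"
      define v where "v = (\<Sum>e\<in>E. (apply_bcontfun e t \<bullet> b) *\<^sub>R e)"
      have vW: "v \<in> W" unfolding v_def using E W
        by (intro subspace_sum subspace_scale) (auto simp: onb_def)
      have ip_v: "ip e v = apply_bcontfun e t \<bullet> b" if "e \<in> E" for e
        using coef[OF E that] by (simp add: v_def ip_commute)
      have "ip v v = (\<Sum>e\<in>E. (apply_bcontfun e t \<bullet> b) * ip e v)"
        unfolding v_def by (subst (1) ip_sum) (simp add: ip_scale)
      also have "\<dots> = S"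
        unfolding S_def by (intro sum.cong refl)
          (simp add: ip_v power2_eq_square)
      finally have vv: "ip v v = S" .
      have "S = v t \<bullet> b"
        by (simp add: S_def v_def apply_bcontfun_sum inner_sum_left power2_eq_square)
      also have "\<dots> \<le> norm (v t) * norm b" by (rule norm_cauchy_schwarz)
      also have "\<dots> \<le> norm v" using b norm_bounded[of v t] by simp
      finally have Sv: "S \<le> norm v" .
      have S0: "0 \<le> S" by (simp add: S_def sum_nonneg)
      have "\<kappa> * S\<^sup>2 \<le> \<kappa> * (norm v)\<^sup>2"
        using Sv S0 \<kappa> by (intro mult_left_mono power_mono) auto
      also have "\<dots> \<le> S" using le[OF vW] vv by simp
      finally have "(\<kappa> * S) * S \<le> 1 * S" by (simp add: power2_eq_square)
      then show ?thesis
        using S0 unfolding S_def[symmetric] by (cases "S = 0") (auto dest: mult_right_le_imp_le)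
    qed
    \<comment> \<open>Each orthonormal element contributes 1 to the integral of the sum of squares,
      which the pointwise bound limits once it is summed over the coordinates.\<close>
    have "\<kappa> * real (card E) = L (\<lambda>t. \<kappa> * (\<Sum>e\<in>E. apply_bcontfun e t \<bullet> apply_bcontfun e t))"
    proof -
      have "L (\<lambda>t. \<kappa> * (\<Sum>e\<in>E. apply_bcontfun e t \<bullet> apply_bcontfun e t))
          = \<kappa> * L (\<lambda>t. \<Sum>e\<in>E. apply_bcontfun e t \<bullet> apply_bcontfun e t)"
        by (rule L_scale) (auto intro!: continuous_intros)
      also have "L (\<lambda>t. \<Sum>e\<in>E. apply_bcontfun e t \<bullet> apply_bcontfun e t) = (\<Sum>e\<in>E. ip e e)"
        unfolding ip_def by (rule L_sum) (auto intro!: continuous_intros)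
      also have "(\<Sum>e\<in>E. ip e e) = (\<Sum>e\<in>E. 1)"
        using E by (intro sum.cong) (auto simp: onb_def)
      finally show ?thesis by simp
    qed
    also have "\<dots> \<le> L (\<lambda>t. real DIM('b) * 1)"
    proof (rule L_mono)
      fix t
      have "\<kappa> * (\<Sum>e\<in>E. apply_bcontfun e t \<bullet> apply_bcontfun e t) = (\<Sum>b\<in>Basis. \<kappa> * (\<Sum>e\<in>E. (apply_bcontfun e t \<bullet> b)\<^sup>2))"
        by (subst euclidean_inner, subst sum.swap) (simp add: sum_distrib_left power2_eq_square)
      also have "\<dots> \<le> (\<Sum>b\<in>(Basis :: 'b set). 1)" by (intro sum_mono pt)
      finally show "\<kappa> * (\<Sum>e\<in>E. apply_bcontfun e t \<bullet> apply_bcontfun e t) \<le> real DIM('b) * 1" by simp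
    qed (auto intro!: continuous_intros)
    also have "\<dots> = real DIM('b) * L (\<lambda>_. 1)" by (intro L_scale continuous_intros)
    finally show ?thesis .
  qed
  obtain n where "real n > real DIM('b) * L (\<lambda>_. 1) / \<kappa>" using reals_Archimedean2 by blast
  moreover obtain E where "onb E" "card E = n" using ex by blast
  ultimately show False using bound[of E] \<kappa> by (simp add: field_simps)
qed

text \<open>If the integral of \<open>norm w\<close> exceeded \<eta> on the whole unit sphere of
  \<open>W\<close>, then \<open>2 * a * x \<le> a\<^sup>2 + x\<^sup>2\<close> would bound the
  integral of its square from below as well, and \<open>finite_span_if_norm_le_L2\<close> would
  apply.\<close>

lemma exists_norm_1_L_small:
  fixes W :: "('a \<Rightarrow>\<^sub>C 'b::euclidean_space) set"
  assumes W: "subspace W" "\<nexists>F. finite F \<and> span F = W" and \<eta>: "0 < \<eta>"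
  shows "\<exists>w\<in>W. norm w = 1 \<and> L (\<lambda>t. norm (apply_bcontfun w t)) \<le> \<eta>"
proof (rule ccontr)
  assume "\<not> ?thesis"
  then have big: "L (\<lambda>t. norm (w t)) > \<eta>" if "w \<in> W" "norm w = 1" for w
    using that by force
  define M where "M = L (\<lambda>_. 1)"
  have M: "M \<ge> 0" unfolding M_def by (intro L_nonneg) auto
  \<comment> \<open>As \<open>a * M \<le> \<eta>\<close>, the integral of \<open>a\<^sup>2\<close>
    is at most \<open>a * \<eta>\<close>, half of the lower bound \<open>2 * a * \<eta>\<close>;
    adding 1 avoids division by 0.\<close>
  define a where "a = \<eta> / (M + 1)"
  have a: "a > 0" "a * M \<le> \<eta>" using M \<eta> by (auto simp: a_def field_simps)
  have unit: "a * \<eta> \<le> ip w w" if w: "w \<in> W" "norm w = 1" for w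
  proof -
    have "L (\<lambda>t. (2 * a) * norm (w t)) \<le> L (\<lambda>t. a\<^sup>2 * 1 + w t \<bullet> w t)"
    proof (rule L_mono)
      show "2 * a * norm (w t) \<le> a\<^sup>2 * 1 + w t \<bullet> w t" for t
        using sum_squares_bound[of a "norm (w t)"] by (simp add: power2_norm_eq_inner)
    qed (auto intro!: continuous_intros)
    also have "\<dots> = L (\<lambda>t. a\<^sup>2 * 1) + ip w w"
      unfolding ip_def by (intro L_add continuous_intros) auto
    also have "L (\<lambda>t. a\<^sup>2 * 1) = a\<^sup>2 * M"
      unfolding M_def by (intro L_scale continuous_intros)
    also have "L (\<lambda>t. (2 * a) * norm (w t)) = (2 * a) * L (\<lambda>t. norm (w t))"
      by (intro L_scale continuous_intros) auto
    finally have 1: "2 * a * L (\<lambda>t. norm (w t)) \<le> a * (a * M) + ip w w"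
      by (simp add: power2_eq_square mult.assoc)
    have "a * (a * M) \<le> a * \<eta>" using a by (intro mult_left_mono) auto
    moreover have "2 * a * \<eta> \<le> 2 * a * L (\<lambda>t. norm (w t))"
      using big[OF w] a by (intro mult_left_mono) auto
    ultimately show ?thesis using 1 by linarith
  qed
  have "\<exists>F. finite F \<and> span F = W"
  proof (rule finite_span_if_norm_le_L2[OF W(1)])
    show "a * \<eta> > 0" using a \<eta> by simp
    show "a * \<eta> * (norm w)\<^sup>2 \<le> ip w w" if w: "w \<in> W" for w
    proof (cases "w = 0")
      case False
      define r where "r = norm w"
      have r: "r > 0" using False by (simp add: r_def)
      have "a * \<eta> \<le> ip ((1/r) *\<^sub>R w) ((1/r) *\<^sub>R w)"
        by (rule unit) (use r w W in \<open>auto intro: subspace_scale simp: r_def\<close>)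
      also have "\<dots> = ip w w / r\<^sup>2"
        by (simp add: ip_scale ip_commute[of w "_ *\<^sub>R _"] power2_eq_square)
      finally show ?thesis using r by (simp add: r_def[symmetric] field_simps)
    qed (simp add: ip_zero)
  qed
  with W(2) show False ..
qed

end

text \<open>The sum of the variation functionals is a single positive functional that dominates each
  summand on nonnegative functions.\<close>

lemma exists_norm_1_variation_small:
  fixes W :: "('a::topological_space \<Rightarrow>\<^sub>C 'k::real_or_complex) set"
  assumes cpt: "compact (UNIV :: 'a set)" and W: "subspace W" "\<nexists>F. finite F \<and> span F = W"
    and I: "finite I" "\<And>i. i \<in> I \<Longrightarrow> \<mu> i \<in> dual fun_scale" and \<eta>: "0 < \<eta>"
  shows "\<exists>w\<in>W. norm w = 1 \<and> (\<forall>i\<in>I. variation (\<mu> i) (\<lambda>t. norm (apply_bcontfun w t)) \<le> \<eta>)"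
proof -
  define L where "L f = (\<Sum>i\<in>I. variation_functional (\<mu> i) f)" for f
  have eq: "L f = (\<Sum>i\<in>I. variation (\<mu> i) f)" if "continuous_on UNIV f" "\<And>t. 0 \<le> f t" for f
    unfolding L_def using that by (intro sum.cong refl variation_functional_nonneg_eq cpt I)
  interpret positive_functional L
  proof
    fix f g :: "'a \<Rightarrow> real" and c
    assume f: "continuous_on UNIV f"
    show "L (\<lambda>t. c * f t) = c * L f"
      unfolding L_def sum_distrib_left by (intro sum.cong refl variation_functional_scale cpt I f)
    show "0 \<le> L f" if "\<And>t. 0 \<le> f t"
      unfolding eq[OF f that] by (intro sum_nonneg variation_nonneg bdd_above_continuous cpt f that)
    assume g: "continuous_on UNIV g"
    show "L (\<lambda>t. f t + g t) = L f + L g"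
      unfolding L_def sum.distrib[symmetric] by (intro sum.cong refl variation_functional_add cpt I f g)
  qed (rule cpt)
  obtain w where w: "w \<in> W" "norm w = 1" "L (\<lambda>t. norm (w t)) \<le> \<eta>"
    using exists_norm_1_L_small[OF W \<eta>] by blast
  have c: "continuous_on UNIV (\<lambda>t. norm (w t))" by (intro continuous_intros) auto
  have "variation (\<mu> i) (\<lambda>t. norm (w t)) \<le> \<eta>" if "i \<in> I" for i
  proof -
    have "variation (\<mu> i) (\<lambda>t. norm (w t)) \<le> L (\<lambda>t. norm (w t))"
      unfolding eq[OF c norm_ge_zero] using that I(1)
      by (intro member_le_sum variation_nonneg bdd_above_continuous cpt c) auto
    with w show ?thesis by simp
  qed
  with w show ?thesis by blast
qed

section \<open>Operators with separable range on Grothendieck spaces\<close>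

lemma variation_sum:
  fixes \<mu> :: "('a::topological_space \<Rightarrow>\<^sub>C 'k::real_or_complex) \<Rightarrow>\<^sub>L 'k"
  assumes "compact (UNIV :: 'a set)" "\<mu> \<in> dual fun_scale"
    and f: "\<And>i. i \<in> I \<Longrightarrow> continuous_on UNIV (f i)" "\<And>i t. i \<in> I \<Longrightarrow> 0 \<le> f i t"
  shows "variation \<mu> (\<lambda>t. \<Sum>i\<in>I. f i t) = (\<Sum>i\<in>I. variation \<mu> (f i))"
  using f
proof (induction I rule: infinite_finite_induct)
  case (insert x F)
  have "variation \<mu> (\<lambda>t. f x t + (\<Sum>i\<in>F. f i t)) = variation \<mu> (f x) + variation \<mu> (\<lambda>t. \<Sum>i\<in>F. f i t)"
    using insert.prems by (intro variation_add assms(1,2) continuous_on_sum sum_nonneg) auto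
  with insert show ?case by simp
qed (simp_all add: variation_zero assms(1,2))

lemma variation_const_le:
  fixes \<mu> :: "('a::topological_space \<Rightarrow>\<^sub>C 'k::real_or_complex) \<Rightarrow>\<^sub>L 'k"
  assumes "0 \<le> e"
  shows "variation \<mu> (\<lambda>_. e) \<le> norm \<mu> * e"
proof (rule variation_least)
  fix g :: "'a \<Rightarrow>\<^sub>C 'k"
  assume "\<And>t. norm (apply_bcontfun g t) \<le> e"
  then have "norm g \<le> e" by (rule norm_bound)
  then show "norm (blinfun_apply \<mu> g) \<le> norm \<mu> * e"
    using norm_blinfun[of \<mu> g] by (meson mult_left_mono norm_ge_zero order_trans)
qed (rule assms)

definition point_eval :: "'a::topological_space \<Rightarrow> ('a \<Rightarrow>\<^sub>C 'k::real_or_complex) \<Rightarrow>\<^sub>L 'k" where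
  "point_eval t = Blinfun (\<lambda>f. apply_bcontfun f t)"

lemma point_eval_apply: "blinfun_apply (point_eval t) f = apply_bcontfun f t"
proof -
  have "bounded_linear (\<lambda>f. apply_bcontfun f t)"
    by (rule bounded_linear_intro[where K = 1]) (simp_all add: norm_bounded)
  then show ?thesis
    unfolding point_eval_def by (subst bounded_linear_Blinfun_apply) auto
qed

lemma operators_iff:
  "T \<in> operators fun_scale \<longleftrightarrow> (\<forall>c f. blinfun_apply T (fun_scale c f) = fun_scale c (T f))"
  using bounded_ops_iff[OF normed_space_over_fun_scale normed_space_over_fun_scale] .

lemma point_eval_compose_dual:
  assumes "T \<in> operators fun_scale"
  shows "point_eval t o\<^sub>L T \<in> dual fun_scale"
  using assms by (simp add: dual_iff[OF normed_space_over_fun_scale] operators_iff point_eval_apply)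

lemma norm_point_eval_compose_le: "norm (point_eval t o\<^sub>L T) \<le> norm T"
proof (rule norm_blinfun_bound)
  fix f
  show "norm ((point_eval t o\<^sub>L T) f) \<le> norm T * norm f"
    using norm_bounded[of "T f" t] norm_blinfun[of T f] by (simp add: point_eval_apply)
qed simp

text \<open>A diagonal argument makes the values at the points \<open>t (r n)\<close> converge for
  every function in the countable set \<open>D\<close>; approximation extends this to the range of
  \<open>T\<close>. The points themselves need not have a convergent subsequence.\<close>

lemma weak_star_convergent_subsequence:
  fixes T :: "('a::topological_space \<Rightarrow>\<^sub>C 'k::real_or_complex) \<Rightarrow>\<^sub>L ('a \<Rightarrow>\<^sub>C 'k)"
    and t :: "nat \<Rightarrow> 'a"
  assumes T: "T \<in> operators fun_scale" and D: "countable D" "range T \<subseteq> closure D"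
  obtains r where "strict_mono r"
    "weak_star_convergent fun_scale (\<lambda>n. point_eval (t (r n)) o\<^sub>L T)"
proof -
  \<comment> \<open>The diagonal argument asks for one bound valid for all members of
    \<open>D\<close>, hence the normalization; \<open>1 + norm d\<close> is never 0.\<close>
  have "norm ((1 / (1 + norm d)) *\<^sub>R apply_bcontfun d (t n)) \<le> 1" for d :: "'a \<Rightarrow>\<^sub>C 'k" and n
  proof -
    have "norm (d (t n)) \<le> 1 + norm d" using norm_bounded[of d "t n"] by simp
    moreover have "1 + norm d > 0" by (rule add_pos_nonneg) simp_all
    ultimately show ?thesis by (simp add: divide_le_eq)
  qed
  then obtain r where r: "strict_mono r"
    and ex: "\<And>d. d \<in> D \<Longrightarrow> \<exists>l. (\<lambda>n. (1 / (1 + norm d)) *\<^sub>R apply_bcontfun d (t (r n))) \<longlonglongrightarrow> l"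
    using function_convergent_subsequence[OF D(1),
        of "\<lambda>n d. (1 / (1 + norm d)) *\<^sub>R apply_bcontfun d (t n)" 1] by blast
  have convD: "Cauchy (\<lambda>n. apply_bcontfun d (t (r n)))" if dD: "d \<in> D" for d
  proof -
    obtain l where "(\<lambda>n. (1 / (1 + norm d)) *\<^sub>R apply_bcontfun d (t (r n))) \<longlonglongrightarrow> l"
      using ex[OF dD] by blast
    then have "(\<lambda>n. (1 + norm d) *\<^sub>R (1 / (1 + norm d)) *\<^sub>R apply_bcontfun d (t (r n))) \<longlonglongrightarrow> (1 + norm d) *\<^sub>R l"
      by (intro tendsto_intros)
    moreover have "1 + norm d \<noteq> 0" by (smt (verit) norm_ge_zero)
    ultimately have "(\<lambda>n. apply_bcontfun d (t (r n))) \<longlonglongrightarrow> (1 + norm d) *\<^sub>R l"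
      by simp
    then show ?thesis by (rule LIMSEQ_imp_Cauchy)
  qed
  have "Cauchy (\<lambda>n. apply_bcontfun (T f) (t (r n)))" for f
  proof (rule CauchyI)
    fix e :: real assume e: "0 < e"
    have "T f \<in> closure D" using D(2) by blast
    then obtain d where d: "d \<in> D" "dist d (T f) < e/3"
      using e unfolding closure_approachable by (meson divide_pos_pos zero_less_numeral)
    have near: "norm (d s - T f s) < e/3" for s
      using d(2) norm_bounded[of "d - T f" s] by (simp add: dist_norm)
    obtain M where M: "\<And>m n. m \<ge> M \<Longrightarrow> n \<ge> M \<Longrightarrow> norm (d (t (r m)) - d (t (r n))) < e/3"
      using CauchyD[OF convD[OF d(1)], of "e/3"] e by auto
    show "\<exists>M. \<forall>m\<ge>M. \<forall>n\<ge>M. norm (T f (t (r m)) - T f (t (r n))) < e"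
    proof (intro exI allI impI)
      fix m n assume "m \<ge> M" "n \<ge> M"
      then have "norm (d (t (r m)) - d (t (r n))) < e/3" by (rule M)
      moreover have "norm (T f (t (r m)) - T f (t (r n))) \<le> norm (d (t (r m)) - d (t (r n)))
          + norm (d (t (r m)) - T f (t (r m))) + norm (d (t (r n)) - T f (t (r n)))"
        using norm_triangle_ineq4[of "d (t (r m)) - d (t (r n))" "d (t (r m)) - T f (t (r m))"]
          norm_triangle_ineq[of "d (t (r m)) - d (t (r n)) - (d (t (r m)) - T f (t (r m)))"
            "d (t (r n)) - T f (t (r n))"]
        by (simp add: algebra_simps)
      ultimately show "norm (T f (t (r m)) - T f (t (r n))) < e"
        using near[of "t (r m)"] near[of "t (r n)"] by linarith
    qed
  qed
  then have lim: "(\<lambda>n. apply_bcontfun (T f) (t (r n))) \<longlonglongrightarrow> lim (\<lambda>n. apply_bcontfun (T f) (t (r n)))" for f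
    by (simp add: Cauchy_convergent_iff convergent_LIMSEQ_iff)
  define l where "l f = lim (\<lambda>n. apply_bcontfun (T f) (t (r n)))" for f
  note lim = lim[folded l_def]
  have "bounded_linear l"
  proof (rule bounded_linear_intro[where K = "norm T"])
    fix f g :: "'a \<Rightarrow>\<^sub>C 'k" and c
    show "l (f + g) = l f + l g"
      using lim[of "f + g"] tendsto_add[OF lim[of f] lim[of g]]
      unfolding blinfun.add_right plus_bcontfun.rep_eq by (rule LIMSEQ_unique)
    show "l (c *\<^sub>R f) = c *\<^sub>R l f"
      using lim[of "c *\<^sub>R f"] tendsto_scaleR[OF tendsto_const lim[of f], of c]
      unfolding blinfun.scaleR_right scaleR_bcontfun.rep_eq by (rule LIMSEQ_unique)
    have "norm (T f (t (r n))) \<le> norm f * norm T" for n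
      using norm_bounded[of "T f"] norm_blinfun[of T f] by (metis mult.commute order_trans)
    then show "norm (l f) \<le> norm f * norm T"
      by (intro LIMSEQ_le_const2[OF tendsto_norm[OF lim]]) auto
  qed
  then have l: "blinfun_apply (Blinfun l) = l" by (rule bounded_linear_Blinfun_apply)
  have "l (fun_scale c f) = c * l f" for c f
  proof -
    have "(\<lambda>n. c * apply_bcontfun (T f) (t (r n))) \<longlonglongrightarrow> l (fun_scale c f)"
      using lim[of "fun_scale c f"] T by (simp add: operators_iff)
    then show ?thesis
      using tendsto_mult_left[OF lim[of f], of c] by (rule LIMSEQ_unique)
  qed
  then have "Blinfun l \<in> dual fun_scale"
    by (simp add: dual_iff[OF normed_space_over_fun_scale] l)
  then have "weak_star_convergent fun_scale (\<lambda>n. point_eval (t (r n)) o\<^sub>L T)"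
    unfolding weak_star_convergent_def
    by (intro bexI[of _ "Blinfun l"]) (auto simp: l point_eval_apply lim)
  with r show ?thesis by (rule that)
qed

text \<open>Passes to the real structure, in which the \<open>L\<^sub>2\<close> argument is carried
  out: a finite set spanning \<open>W\<close> over the reals also spans it over the scalar
  field.\<close>

lemma not_finitely_spanned_over_reals:
  assumes "fs.subspace W" "\<not> finite_dimensional fun_scale W"
  shows "subspace W" "\<nexists>F. finite F \<and> span F = W"
proof -
  have sc: "c *\<^sub>R w \<in> W" if "w \<in> W" for c w
    using fs.subspace_scale[OF assms(1) that, of "of_real c"] by (simp add: fs.scale_of_real)
  show sub: "subspace W"
    using assms(1) sc by (simp add: fs.subspace_def subspace_def)
  show "\<nexists>F. finite F \<and> span F = W"
  proof clarify
    fix F assume F: "finite F" "W = span F"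
    have "fs.span F = W"
    proof
      show "fs.span F \<subseteq> W"
        unfolding F(2) using assms(1) span_superset by (intro fs.span_minimal) (auto simp: F(2))
      have "subspace (fs.span F)"
        unfolding subspace_def
        by (metis fs.scale_of_real fs.span_add fs.span_scale fs.span_zero)
      then show "W \<subseteq> fs.span F"
        unfolding F(2) using fs.span_superset by (intro span_minimal)
    qed
    with F assms(2) show False by (auto simp: finite_dimensional_def)
  qed
qed

lemma sum_half_powers_le: "finite A \<Longrightarrow> (\<Sum>m\<in>A. (1/2::real) ^ Suc m) \<le> 1"
proof -
  assume A: "finite A"
  have "(\<Sum>m\<in>A. (1/2::real) ^ Suc m) \<le> (\<Sum>m. (1/2) ^ Suc m)"
    using power_half_series A by (intro sum_le_suminf) (auto simp: sums_iff)
  also have "\<dots> = 1" using power_half_series by (simp add: sums_iff)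
  finally show ?thesis .
qed


text \<open>Functions \<open>w n \<in> W\<close> and points \<open>t n\<close> are chosen with \<open>\<bar>T (w n) (t n)\<bar>\<close> bounded below and
  \<open>w m\<close> small in the sense of the total variation of the functionals at \<open>t n\<close>, \<open>n < m\<close>. Cutting
  \<open>w n\<close> off wherever a later \<open>w m\<close> is large makes the sequence disjoint; only finitely many \<open>m\<close>
  can be dealt with inside \<open>C(K)\<close>, whence the limits in \<open>grothendieck_diagonal_null\<close>.\<close>

lemma finite_dimensional_if_bounded_below:
  fixes T :: "('a::topological_space \<Rightarrow>\<^sub>C 'k::real_or_complex) \<Rightarrow>\<^sub>L ('a \<Rightarrow>\<^sub>C 'k)"
  assumes cpt: "compact (UNIV :: 'a set)"
    and G: "grothendieck_space (fun_scale :: 'k \<Rightarrow> ('a \<Rightarrow>\<^sub>C 'k) \<Rightarrow> _)"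
    and T: "T \<in> operators fun_scale" and D: "countable D" "range T \<subseteq> closure D"
    and W: "fs.subspace W" and c: "0 < c" "\<And>w. w \<in> W \<Longrightarrow> c * norm w \<le> norm (T w)"
  shows "finite_dimensional fun_scale W"
proof (rule ccontr)
  assume "\<not> ?thesis"
  note WR = not_finitely_spanned_over_reals[OF W this]
  define \<mu> where "\<mu> s = point_eval s o\<^sub>L T" for s
  have \<mu>: "\<mu> s \<in> dual fun_scale" "norm (\<mu> s) \<le> norm T" "\<mu> s f = T f s" for s f
    unfolding \<mu>_def
    by (simp_all add: point_eval_compose_dual[OF T] norm_point_eval_compose_le point_eval_apply)
  \<comment> \<open>Strictly below \<open>c\<close>, so that for every unit vector \<open>w\<close>
    of \<open>W\<close> there is a point where \<open>T w\<close> has modulus at least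
    \<delta>.\<close>
  define \<delta> where "\<delta> = c / 2"
  have \<delta>: "0 < \<delta>" "\<delta> < c" using c by (auto simp: \<delta>_def)
  \<comment> \<open>Values of \<open>w n\<close> of size up to \<open>2 / \<Lambda>\<close> will be
    sacrificed; the functionals, of norm at most \<open>norm T\<close>, see at most \<delta>/4 of
    them.\<close>
  define \<Lambda> where "\<Lambda> = 8 * (norm T + 1) / \<delta>"
  have \<Lambda>: "0 < \<Lambda>" "norm T * (2 / \<Lambda>) \<le> \<delta> / 4"
  proof -
    have "0 < norm T + 1" by (rule add_nonneg_pos) simp_all
    then show "0 < \<Lambda>" "norm T * (2 / \<Lambda>) \<le> \<delta> / 4" using \<delta> by (simp_all add: \<Lambda>_def field_simps)
  qed
  \<comment> \<open>The sum of all \<open>\<Lambda> * \<eta> m\<close> is \<delta>/4, the price of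
    cutting off at all later \<open>w m\<close>.\<close>
  define \<eta> where "\<eta> m = \<delta> / (4 * \<Lambda>) * (1/2) ^ Suc m" for m
  have \<eta>: "0 < \<eta> m" for m using \<delta> \<Lambda> by (simp add: \<eta>_def)
  \<comment> \<open>Pairs of a function and a point: the function is small for the functionals at
    all earlier points, and the point is then placed where its image under \<open>T\<close> is
    large.\<close>
  have "\<exists>p. \<forall>n. fst (p n) \<in> W \<and> norm (fst (p n)) = 1 \<and> \<delta> \<le> norm (apply_bcontfun (T (fst (p n))) (snd (p n)))
      \<and> (\<forall>i<n. variation (\<mu> (snd (p i))) (\<lambda>s. norm (apply_bcontfun (fst (p n)) s)) \<le> \<eta> n)"
  proof (rule dependent_wellorder_choice)
    fix n and p :: "nat \<Rightarrow> ('a \<Rightarrow>\<^sub>C 'k) \<times> 'a"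
    obtain w where w: "w \<in> W" "norm w = 1"
      "\<And>i. i \<in> {..<n} \<Longrightarrow> variation (\<mu> (snd (p i))) (\<lambda>s. norm (apply_bcontfun w s)) \<le> \<eta> n"
      using exists_norm_1_variation_small[OF cpt WR finite_lessThan[of n],
          where \<mu> = "\<lambda>i. \<mu> (snd (p i))" and \<eta> = "\<eta> n"] \<mu>(1) \<eta> by blast
    have "\<exists>s. \<delta> \<le> norm (apply_bcontfun (T w) s)"
    proof (rule ccontr)
      assume "\<not> ?thesis"
      then have "norm (T w) \<le> \<delta>" by (intro norm_bound) (simp add: not_le less_imp_le)
      then show False using c(2)[OF w(1)] w(2) \<delta> by simp
    qed
    then obtain s where "\<delta> \<le> norm (apply_bcontfun (T w) s)" ..
    with w show "\<exists>r. fst r \<in> W \<and> norm (fst r) = 1 \<and> \<delta> \<le> norm (apply_bcontfun (T (fst r)) (snd r))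
      \<and> (\<forall>i<n. variation (\<mu> (snd (p i))) (\<lambda>s. norm (apply_bcontfun (fst r) s)) \<le> \<eta> n)"
      by (intro exI[of _ "(w, s)"]) auto
  qed auto
  then obtain p where p: "\<And>n. norm (fst (p n)) = 1" "\<And>n. \<delta> \<le> norm (apply_bcontfun (T (fst (p n))) (snd (p n)))"
    "\<And>n i. i < n \<Longrightarrow> variation (\<mu> (snd (p i))) (\<lambda>s. norm (apply_bcontfun (fst (p n)) s)) \<le> \<eta> n"
    by metis
  obtain r where r: "strict_mono r"
    "weak_star_convergent fun_scale (\<lambda>n. \<mu> (snd (p (r n))))"
    using weak_star_convergent_subsequence[OF T D, of "\<lambda>n. snd (p n)"] unfolding \<mu>_def by blast
  define w where "w n = fst (p (r n))" for n
  define t where "t n = snd (p (r n))" for n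
  have w1: "norm (w n) = 1" for n by (simp add: w_def p)
  have w1': "norm (w n s) \<le> 1" for n s using norm_bounded[of "w n" s] by (simp add: w1)
  have big: "\<delta> \<le> norm (\<mu> (t n) (w n))" for n by (simp add: w_def t_def p \<mu>)
  \<comment> \<open>Passing to the subsequence keeps the bound because \<open>r n \<ge> n\<close>
    and \<eta> decreases.\<close>
  have small: "variation (\<mu> (t i)) (\<lambda>s. norm (w n s)) \<le> \<eta> n" if "i < n" for i n
  proof -
    have "variation (\<mu> (t i)) (\<lambda>s. norm (w n s)) \<le> \<eta> (r n)"
      using that r(1) unfolding w_def t_def by (intro p) (simp add: strict_mono_less)
    also have "\<dots> \<le> \<eta> n"
      unfolding \<eta>_def using strict_mono_imp_increasing[OF r(1), of n] \<delta> \<Lambda>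
      by (intro mult_left_mono power_decreasing) auto
    finally show ?thesis .
  qed
  \<comment> \<open>\<open>b m\<close> vanishes where \<open>\<Lambda> * norm (w m s)\<close> is at
    most 1 and equals 1 where it is at least 2; \<open>v k J\<close> vanishes where the sum over the
    later indices reaches \<open>1 / \<Lambda>\<close>. So \<open>v k J\<close> and
    \<open>b m\<close> are never both nonzero when \<open>k < m \<le> J\<close>.\<close>
  define b where "b m s = min 1 (max 0 (\<Lambda> * norm (w m s) - 1))" for m s
  define v where "v k J s = max 0 (1 - \<Lambda> * (\<Sum>m\<in>{k<..J}. norm (w m s)))" for k J s
  have b01: "0 \<le> b m s" "b m s \<le> 1" for m s by (auto simp: b_def)
  have v01: "0 \<le> v k J s" "v k J s \<le> 1" for k J s
    using \<Lambda> by (auto simp: v_def sum_nonneg)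
  have cw: "continuous_on UNIV (apply_bcontfun (w m))" for m by simp
  define F where "F k J = Bcontfun (\<lambda>s. (b k s * v k J s) *\<^sub>R w k s)" for k J
  have F: "F k J s = (b k s * v k J s) *\<^sub>R w k s" for k J s
  proof -
    have "continuous_on UNIV (\<lambda>s. (b k s * v k J s) *\<^sub>R w k s)"
      unfolding b_def v_def by (intro continuous_intros cw)
    then show ?thesis unfolding F_def by (subst apply_Bcontfun_compact[OF cpt]) auto
  qed
  have disj: "F m J s = 0" if "k < m" "m \<le> J" "F k J s \<noteq> 0" for k m J s
  proof -
    have "norm (w m s) \<le> (\<Sum>m\<in>{k<..J}. norm (w m s))"
      using that by (intro member_le_sum) auto
    then have "\<Lambda> * norm (w m s) \<le> \<Lambda> * (\<Sum>m\<in>{k<..J}. norm (w m s))"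
      using \<Lambda> by (intro mult_left_mono) auto
    moreover have "v k J s \<noteq> 0" using that by (auto simp: F)
    ultimately have "b m s = 0" by (auto simp: b_def v_def max_def split: if_splits)
    then show ?thesis by (simp add: F)
  qed
  have F1: "norm (F k J s) \<le> 1" for k J s
    using b01[of k s] v01[of k J s] w1'[of k s] by (simp add: F mult_le_one)
  have var: "(\<Sum>j<J. norm (F k (Suc j) s - F k j s)) \<le> 1" for k J s
  proof -
    \<comment> \<open>As \<open>v k J\<close> decreases in \<open>J\<close>, the sum of the
      increments telescopes.\<close>
    have "norm (F k (Suc j) s - F k j s) \<le> v k j s - v k (Suc j) s" for j
    proof -
      have "(\<Sum>m\<in>{k<..j}. norm (w m s)) \<le> (\<Sum>m\<in>{k<..Suc j}. norm (w m s))"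
        by (intro sum_mono2) auto
      then have "\<Lambda> * (\<Sum>m\<in>{k<..j}. norm (w m s)) \<le> \<Lambda> * (\<Sum>m\<in>{k<..Suc j}. norm (w m s))"
        using \<Lambda> by (intro mult_left_mono) auto
      then have v: "v k (Suc j) s \<le> v k j s" by (auto simp: v_def)
      have "F k (Suc j) s - F k j s = (b k s * (v k (Suc j) s - v k j s)) *\<^sub>R w k s"
        by (simp add: F algebra_simps)
      then have "norm (F k (Suc j) s - F k j s) = (b k s * norm (w k s)) * (v k j s - v k (Suc j) s)"
        using b01[of k s] v by (simp add: abs_mult)
      also have "\<dots> \<le> 1 * (v k j s - v k (Suc j) s)"
        using b01[of k s] v w1'[of k s] by (intro mult_right_mono mult_le_one) auto
      finally show ?thesis by simp
    qed
    then have "(\<Sum>j<J. norm (F k (Suc j) s - F k j s)) \<le> (\<Sum>j<J. v k j s - v k (Suc j) s)"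
      by (rule sum_mono)
    also have "\<dots> = v k 0 s - v k J s" by (rule sum_lessThan_telescope')
    finally show ?thesis using v01[of k 0 s] v01[of k J s] by linarith
  qed
  have lim: "(\<lambda>n. lim (\<lambda>J. \<mu> (t n) (F n J))) \<longlonglongrightarrow> 0"
  proof (rule grothendieck_diagonal_null[OF G])
    show "weak_star_convergent fun_scale (\<lambda>n. \<mu> (t n))" using r(2) by (simp add: t_def)
    show "(\<Sum>k\<le>J. norm (F k J s)) \<le> 1" for J s
    proof (cases "\<exists>k\<le>J. F k J s \<noteq> 0")
      case True
      then obtain k where k: "k \<le> J" "F k J s \<noteq> 0" by blast
      have "F m J s = 0" if "m \<le> J" "m \<noteq> k" for m
        using disj[of k m J s] disj[of m k J s] k that by (cases "k < m") auto
      then have "(\<Sum>m\<le>J. norm (F m J s)) = (\<Sum>m\<in>{k}. norm (F m J s))"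
        using k by (intro sum.mono_neutral_right) auto
      then show ?thesis using F1 by simp
    qed auto
  qed (rule \<mu> var)+
  \<comment> \<open>Replacing \<open>w n\<close> by \<open>F n J\<close> loses at most \<delta>/4
    through \<open>b\<close> and \<delta>/4 through \<open>v\<close>, out of the \<delta> in
    \<open>big\<close>.\<close>
  have large: "\<delta> / 2 \<le> norm (\<mu> (t n) (F n J))" for n J
  proof -
    define S where "S = (\<lambda>s. \<Sum>m\<in>{n<..J}. norm (w m s))"
    have cS: "continuous_on UNIV S" unfolding S_def by (intro continuous_intros cw)
    have S0: "0 \<le> S s" for s by (simp add: S_def sum_nonneg)
    have "norm (\<mu> (t n) (w n - F n J)) \<le> variation (\<mu> (t n)) (\<lambda>s. 2 / \<Lambda> + \<Lambda> * S s)"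
    proof (rule variation_upper)
      show "bdd_above (range (\<lambda>s. 2 / \<Lambda> + \<Lambda> * S s))"
        by (intro bdd_above_continuous cpt continuous_intros cS)
      fix s
      have 1: "norm (w n s) * (1 - b n s) \<le> 2 / \<Lambda>"
      proof (cases "\<Lambda> * norm (w n s) \<ge> 2")
        case True
        then have "b n s = 1" by (simp add: b_def)
        then show ?thesis using \<Lambda> by simp
      next
        case False
        then have "norm (w n s) \<le> 2 / \<Lambda>" using \<Lambda> by (simp add: field_simps)
        moreover have "norm (w n s) * (1 - b n s) \<le> norm (w n s) * 1"
          using b01 by (intro mult_left_mono) auto
        ultimately show ?thesis by simp
      qed
      have "norm (w n s) * b n s * (1 - v n J s) \<le> 1 * (1 - v n J s)"
        using b01[of n s] v01[of n J s] w1'[of n s] by (intro mult_right_mono mult_le_one) auto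
      also have "\<dots> \<le> \<Lambda> * S s" by (simp add: v_def S_def)
      finally have 2: "norm (w n s) * b n s * (1 - v n J s) \<le> \<Lambda> * S s" .
      have "b n s * v n J s \<le> 1" using b01[of n s] v01[of n J s] by (intro mult_le_one) auto
      moreover have "(w n - F n J) s = (1 - b n s * v n J s) *\<^sub>R w n s"
        by (simp add: F algebra_simps)
      ultimately have "norm ((w n - F n J) s) = (1 - b n s * v n J s) * norm (w n s)"
        by simp
      also have "\<dots> = norm (w n s) * (1 - b n s) + norm (w n s) * b n s * (1 - v n J s)"
        by (simp add: algebra_simps)
      finally show "norm ((w n - F n J) s) \<le> 2 / \<Lambda> + \<Lambda> * S s" using 1 2 by linarith
    qed
    also have "\<dots> = variation (\<mu> (t n)) (\<lambda>_. 2 / \<Lambda>) + variation (\<mu> (t n)) (\<lambda>s. \<Lambda> * S s)"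
      using \<Lambda> S0 by (intro variation_add cpt \<mu> continuous_intros cS mult_nonneg_nonneg) auto
    finally have le: "norm (\<mu> (t n) (w n - F n J)) \<le> \<dots>" .
    have "variation (\<mu> (t n)) S = (\<Sum>m\<in>{n<..J}. variation (\<mu> (t n)) (\<lambda>s. norm (w m s)))"
      unfolding S_def by (intro variation_sum cpt \<mu> continuous_intros cw) auto
    also have "\<dots> \<le> (\<Sum>m\<in>{n<..J}. \<eta> m)" by (intro sum_mono small) auto
    also have "\<dots> = \<delta> / (4 * \<Lambda>) * (\<Sum>m\<in>{n<..J}. (1/2) ^ Suc m)"
      by (simp only: \<eta>_def sum_distrib_left)
    also have "\<dots> \<le> \<delta> / (4 * \<Lambda>) * 1"
      using \<delta> \<Lambda> by (intro mult_left_mono sum_half_powers_le) auto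
    finally have "\<Lambda> * variation (\<mu> (t n)) S \<le> \<delta> / 4" using \<Lambda> by (simp add: field_simps)
    moreover have "variation (\<mu> (t n)) (\<lambda>s. \<Lambda> * S s) = \<Lambda> * variation (\<mu> (t n)) S"
      using \<Lambda> S0 by (intro variation_scale cpt \<mu> cS) auto
    moreover have "variation (\<mu> (t n)) (\<lambda>_. 2 / \<Lambda>) \<le> \<delta> / 4"
    proof -
      have "variation (\<mu> (t n)) (\<lambda>_. 2 / \<Lambda>) \<le> norm (\<mu> (t n)) * (2 / \<Lambda>)"
        using \<Lambda> by (intro variation_const_le) auto
      also have "\<dots> \<le> norm T * (2 / \<Lambda>)" using \<Lambda> \<mu> by (intro mult_right_mono) auto
      also have "\<dots> \<le> \<delta> / 4" by (rule \<Lambda>)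
      finally show ?thesis .
    qed
    ultimately have "norm (\<mu> (t n) (w n - F n J)) \<le> \<delta> / 2" using le by linarith
    then show ?thesis
      using big[of n] norm_triangle_sub[of "\<mu> (t n) (w n)" "\<mu> (t n) (F n J)"]
      by (simp add: blinfun.diff_right)
  qed
  have lower: "\<delta> / 2 \<le> norm (lim (\<lambda>J. \<mu> (t n) (F n J)))" for n
  proof (rule LIMSEQ_le_const)
    have "(\<lambda>J. \<mu> (t n) (F n J)) \<longlonglongrightarrow> lim (\<lambda>J. \<mu> (t n) (F n J))"
      by (rule dual_lim_exists[OF \<mu>(1) var])
    then show "(\<lambda>J. norm (\<mu> (t n) (F n J))) \<longlonglongrightarrow> norm (lim (\<lambda>J. \<mu> (t n) (F n J)))"
      by (rule tendsto_norm)
  qed (use large in blast)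
  have "\<delta> / 2 \<le> norm (0::'k)"
    by (rule LIMSEQ_le_const[OF tendsto_norm[OF lim]]) (use lower in blast)
  with \<delta> show False by simp
qed

section \<open>Infinite codimension\<close>

text \<open>Urysohn's lemma for the closed sets \<open>- U\<close> and \<open>{x}\<close>, a compact
  Hausdorff space being normal.\<close>

lemma compact_Hausdorff_bump:
  fixes x :: "'a::t2_space"
  assumes "compact (UNIV :: 'a set)" "open U" "x \<in> U"
  obtains u :: "'a \<Rightarrow> real" where "continuous_on UNIV u" "u x = 1" "\<And>y. y \<notin> U \<Longrightarrow> u y = 0"
proof -
  have "compact_space (euclidean :: 'a topology)"
    using assms(1) by (simp add: compact_space_def)
  moreover have "Hausdorff_space (euclidean :: 'a topology)"
    by (simp add: Hausdorff_space_def disjnt_def) (metis hausdorff)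
  ultimately have "normal_space (euclidean :: 'a topology)"
    by (simp add: compact_Hausdorff_or_regular_imp_normal_space)
  moreover have "closedin euclidean (- U)" "closedin euclidean {x}" "disjnt (- U) {x}"
    using assms by (auto simp: disjnt_def)
  ultimately obtain u :: "'a \<Rightarrow> real" where "continuous_map euclidean euclideanreal u" "u ` (- U) \<subseteq> {0}" "u ` {x} \<subseteq> {1}"
    by (rule Urysohn_lemma_alt)
  then show ?thesis by (intro that[of u]) auto
qed

text \<open>Bump functions for \<open>x\<close> inside the set \<open>U - (X - {x})\<close>, which
  is open because finite sets are closed.\<close>

lemma exists_kronecker_functions:
  fixes X :: "'a::t2_space set"
  assumes cpt: "compact (UNIV :: 'a set)" and X: "finite X" "X \<subseteq> U" "open U"
  obtains u :: "'a \<Rightarrow> 'a \<Rightarrow>\<^sub>C 'k::real_or_complex"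
  where "\<And>x y. x \<in> X \<Longrightarrow> y \<in> X \<Longrightarrow> u x y = (if x = y then 1 else 0)"
    "\<And>x y. x \<in> X \<Longrightarrow> y \<notin> U \<Longrightarrow> u x y = 0"
proof -
  have "\<exists>u :: 'a \<Rightarrow>\<^sub>C 'k. u x = 1 \<and> (\<forall>y. y \<notin> U - (X - {x}) \<longrightarrow> u y = 0)" if "x \<in> X" for x
  proof -
    have "open (U - (X - {x}))" using X by (intro open_Diff finite_imp_closed) auto
    then obtain v :: "'a \<Rightarrow> real" where v: "continuous_on UNIV v" "v x = 1"
      "\<And>y. y \<notin> U - (X - {x}) \<Longrightarrow> v y = 0"
      using compact_Hausdorff_bump[OF cpt, of "U - (X - {x})" x] X \<open>x \<in> X\<close> by blast
    have "apply_bcontfun (Bcontfun (\<lambda>y. of_real (v y) :: 'k)) = (\<lambda>y. of_real (v y))"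
      by (intro apply_Bcontfun_compact cpt continuous_intros v)
    then show ?thesis
      using v(2,3) by (intro exI[of _ "Bcontfun (\<lambda>y. of_real (v y))"]) simp
  qed
  then obtain u :: "'a \<Rightarrow> 'a \<Rightarrow>\<^sub>C 'k" where
    "\<And>x. x \<in> X \<Longrightarrow> u x x = 1 \<and> (\<forall>y. y \<notin> U - (X - {x}) \<longrightarrow> u x y = 0)"
    by metis
  then show ?thesis by (intro that[of u]) auto
qed

text \<open>Kronecker functions at \<open>card F + 1\<close> points of \<open>U\<close> are linearly
  independent, too many for the span of \<open>F\<close>.\<close>

lemma not_finite_dimensional_supported:
  fixes U :: "'a::t2_space set"
  assumes cpt: "compact (UNIV :: 'a set)" and U: "open U" "infinite U"
  shows "\<not> finite_dimensional (fun_scale :: 'k::real_or_complex \<Rightarrow> _) {f :: 'a \<Rightarrow>\<^sub>C 'k. \<forall>y. y \<notin> U \<longrightarrow> f y = 0}"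
proof
  assume "finite_dimensional (fun_scale :: 'k \<Rightarrow> _) {f :: 'a \<Rightarrow>\<^sub>C 'k. \<forall>y. y \<notin> U \<longrightarrow> f y = 0}"
  then obtain F :: "('a \<Rightarrow>\<^sub>C 'k) set" where F: "finite F" "fs.span F = {f. \<forall>y. y \<notin> U \<longrightarrow> apply_bcontfun f y = 0}"
    unfolding finite_dimensional_def by blast
  obtain X where X: "X \<subseteq> U" "finite X" "card X = Suc (card F)"
    using infinite_arbitrarily_large[OF U(2)] by blast
  obtain u :: "'a \<Rightarrow> 'a \<Rightarrow>\<^sub>C 'k" where u: "\<And>x y. x \<in> X \<Longrightarrow> y \<in> X \<Longrightarrow> u x y = (if x = y then 1 else 0)"
    "\<And>x y. x \<in> X \<Longrightarrow> y \<notin> U \<Longrightarrow> u x y = 0"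
    using exists_kronecker_functions[OF cpt X(2,1) U(1)] by metis
  have inj: "inj_on u X"
  proof (rule inj_onI)
    fix x y assume "x \<in> X" "y \<in> X" "u x = u y"
    then show "x = y" using u(1)[of x y] u(1)[of y y] by (auto split: if_splits)
  qed
  have "fs.independent (u ` X)"
  proof
    assume "fs.dependent (u ` X)"
    then obtain c z where z: "z \<in> X" "c (u z) \<noteq> 0" "(\<Sum>f\<in>u ` X. fun_scale (c f) f) = 0"
      using fs.dependent_finite[of "u ` X"] X(2) by auto
    have "0 = apply_bcontfun (\<Sum>f\<in>u ` X. fun_scale (c f) f) z" by (simp add: z)
    also have "\<dots> = (\<Sum>x\<in>X. c (u x) * u x z)"
      by (simp add: sum.reindex[OF inj] apply_bcontfun_sum)
    also have "\<dots> = (\<Sum>x\<in>X. if x = z then c (u x) else 0)"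
      by (intro sum.cong) (use u(1) z in auto)
    also have "\<dots> = c (u z)" using X(2) z by simp
    finally show False using z by simp
  qed
  moreover have "u ` X \<subseteq> fs.span F" unfolding F(2) using u(2) by auto
  ultimately have "card (u ` X) \<le> card F"
    using fs.independent_span_bound[OF F(1)] by blast
  then show False using card_image[OF inj] X by simp
qed

text \<open>With only finitely many limit points, one of them, \<open>p\<close>, would be the limit
  of a sequence of distinct isolated points. The evaluations there converge weak* to that at
  \<open>p\<close>, yet take the value 1 at the indicator functions of these points, against
  \<open>grothendieck_diagonal_null\<close>.\<close>

lemma infinite_limit_points:
  assumes cpt: "compact (UNIV :: 'a::t2_space set)" and inf: "infinite (UNIV :: 'a set)"
    and G: "grothendieck_space (fun_scale :: 'k::real_or_complex \<Rightarrow> ('a \<Rightarrow>\<^sub>C 'k) \<Rightarrow> _)"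
  shows "infinite {x :: 'a. x islimpt UNIV}"
proof
  assume fin: "finite {x :: 'a. x islimpt UNIV}" (is "finite ?L")
  have acc: "\<exists>x. x islimpt A" if "infinite A" for A :: "'a set"
    using Heine_Borel_imp_Bolzano_Weierstrass[OF cpt that] by auto
  obtain p :: 'a where p: "p islimpt UNIV" using acc[OF inf] by blast
  have "\<exists>U V. open U \<and> open V \<and> p \<in> U \<and> q \<in> V \<and> U \<inter> V = {}" if "q \<noteq> p" for q
    using hausdorff[of p q] that by blast
  then obtain U V where UV: "\<And>q. q \<noteq> p \<Longrightarrow> open (U q) \<and> open (V q) \<and> p \<in> U q \<and> q \<in> V q \<and> U q \<inter> V q = {}"
    by metis
  \<comment> \<open>\<open>A\<close> consists of isolated points, and \<open>V q\<close> keeps it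
    away from every limit point \<open>q\<close> other than \<open>p\<close>, so it can accumulate
    only at \<open>p\<close>.\<close>
  define A where "A = (\<Inter>q\<in>?L - {p}. U q) - ?L"
  have "infinite (\<Inter>q\<in>?L - {p}. U q)"
  proof -
    have "open (\<Inter>q\<in>?L - {p}. U q)" using fin UV by (intro open_INT) auto
    moreover have "p \<in> (\<Inter>q\<in>?L - {p}. U q)" using UV by auto
    ultimately show ?thesis using p unfolding islimpt_eq_acc_point by auto
  qed
  then have infA: "infinite A" unfolding A_def using fin by simp
  have only: "q = p" if "q islimpt A" for q
  proof (rule ccontr)
    assume "q \<noteq> p"
    moreover have "q \<in> ?L" using that islimpt_subset[of q A UNIV] by simp
    ultimately have "A \<subseteq> U q" unfolding A_def by blast
    then have "V q \<inter> A = {}" using UV[OF \<open>q \<noteq> p\<close>] by blast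
    then show False using that UV[OF \<open>q \<noteq> p\<close>] unfolding islimpt_eq_acc_point by force
  qed
  obtain x :: "nat \<Rightarrow> 'a" where x: "inj x" "range x \<subseteq> A"
    using infinite_countable_subset[OF infA] by blast
  have iso: "open {x n}" for n
    using x(2) unfolding A_def by (auto simp: islimpt_UNIV_iff)
  have conv: "x \<longlonglongrightarrow> p"
  proof (rule topological_tendstoI)
    fix N assume N: "open N" "p \<in> N"
    have "finite {n. x n \<notin> N}"
    proof (rule ccontr)
      assume "infinite {n. x n \<notin> N}"
      then have "infinite (x ` {n. x n \<notin> N})"
        using x(1) finite_imageD inj_on_subset by blast
      then obtain q where q: "q islimpt x ` {n. x n \<notin> N}" using acc by blast
      then have "q islimpt A" by (rule islimpt_subset) (use x(2) in auto)
      then have "q = p" by (rule only)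
      then show False using q N unfolding islimpt_def by blast
    qed
    then show "\<forall>\<^sub>F n in sequentially. x n \<in> N"
      unfolding cofinite_eq_sequentially[symmetric] eventually_cofinite .
  qed
  have ev: "point_eval y \<in> dual (fun_scale :: 'k \<Rightarrow> _)" for y :: 'a
    by (simp add: dual_iff[OF normed_space_over_fun_scale] point_eval_apply)
  define F where "F k = Bcontfun (\<lambda>y. if y = x k then 1 else 0 :: 'k)" for k
  have F: "F k y = (if y = x k then 1 else 0)" for k y
  proof -
    have "continuous_on (- {x k}) (\<lambda>y. if y = x k then 1 else 0 :: 'k)"
      by (rule continuous_on_eq[OF continuous_on_const[of _ 0]]) auto
    then have "continuous_on ({x k} \<union> - {x k}) (\<lambda>y. if y = x k then 1 else 0 :: 'k)"
      using iso[of k] by (intro continuous_on_open_Un) (auto simp: open_Compl)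
    then have "continuous_on UNIV (\<lambda>y. if y = x k then 1 else 0 :: 'k)" by simp
    then show ?thesis unfolding F_def by (subst apply_Bcontfun_compact[OF cpt]) auto
  qed
  \<comment> \<open>The functions are indicators of isolated points, hence continuous, and do not
    depend on the second index, so the inner limit is trivial.\<close>
  have "(\<lambda>n. lim (\<lambda>J::nat. point_eval (x n) (F n))) \<longlonglongrightarrow> 0"
  proof (rule grothendieck_diagonal_null[where F = "\<lambda>k _. F k", OF G])
    show "weak_star_convergent fun_scale (\<lambda>n. point_eval (x n) :: ('a \<Rightarrow>\<^sub>C 'k) \<Rightarrow>\<^sub>L 'k)"
      unfolding weak_star_convergent_def point_eval_apply
    proof (intro bexI[of _ "point_eval p"] allI)
      fix f :: "'a \<Rightarrow>\<^sub>C 'k"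
      show "(\<lambda>n. f (x n)) \<longlonglongrightarrow> point_eval p f"
        unfolding point_eval_apply
        by (rule continuous_on_tendsto_compose[OF continuous_on_apply_bcontfun[of UNIV] conv]) auto
    qed (rule ev)
    show "(\<Sum>k\<le>J. norm (F k y)) \<le> 1" for J y
    proof (cases "\<exists>k. y = x k")
      case True
      then obtain k where "y = x k" by blast
      then have "(\<Sum>j\<le>J. norm (F j y)) = (\<Sum>j\<le>J. if j = k then 1 else 0)"
        using x(1) by (intro sum.cong) (auto simp: F inj_def)
      then show ?thesis by simp
    qed (simp add: F)
  qed (auto intro: ev)
  then show False by (simp add: point_eval_apply F LIMSEQ_const_iff)
qed

text \<open>The countable set is not required to lie in the range, so no appeal to the heredity of
  separability is needed.\<close>

definition separably_dominated_ops :: "(('a::topological_space \<Rightarrow>\<^sub>C 'k::real_or_complex) \<Rightarrow>\<^sub>L ('a \<Rightarrow>\<^sub>C 'k)) set" where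
  "separably_dominated_ops = {T \<in> operators fun_scale. \<exists>D. countable D \<and> range (blinfun_apply T) \<subseteq> closure D}"

lemma separable_range_subset:
  "separable_range_ops fun_scale \<subseteq> (separably_dominated_ops
    :: (('a::topological_space \<Rightarrow>\<^sub>C 'k::real_or_complex) \<Rightarrow>\<^sub>L ('a \<Rightarrow>\<^sub>C 'k)) set)"
proof
  fix T :: "('a \<Rightarrow>\<^sub>C 'k) \<Rightarrow>\<^sub>L ('a \<Rightarrow>\<^sub>C 'k)"
  assume "T \<in> separable_range_ops fun_scale"
  then obtain C where "T \<in> operators fun_scale" "countable C" "C \<subseteq> range T"
    "top_of_set (range T) closure_of C = range T"
    unfolding separable_range_ops_def separable_space_def by auto
  moreover from this have "range T \<subseteq> closure C"
    by (simp add: closure_of_subtopology Int_absorb1) blast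
  ultimately show "T \<in> separably_dominated_ops"
    unfolding separably_dominated_ops_def by blast
qed

lemma discrete_bcontfun:
  fixes f :: "nat \<Rightarrow> 'b::real_normed_vector"
  assumes "bounded (range f)"
  shows "apply_bcontfun (Bcontfun f) = f"
  using assms by (intro Bcontfun_inverse) (auto simp: bcontfun_def)

lemma c0_diff: "y \<in> c0 \<Longrightarrow> z \<in> c0 \<Longrightarrow> y - z \<in> c0"
  unfolding c0_def using tendsto_diff[of "apply_bcontfun y" 0 sequentially "apply_bcontfun z" 0] by simp

lemma linear_on_c0_diff:
  assumes "linear_on fun_scale s c0 V" "y \<in> c0" "z \<in> c0"
  shows "V (y - z) = V y - V z"
  using assms c0_diff[OF assms(2,3)] unfolding linear_on_def
  by (metis diff_add_cancel eq_diff_eq)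

text \<open>Finitely supported sequences with entries in a countable dense set of scalars are dense
  in \<open>c0\<close>; their images under \<open>V\<close> form the required countable set.\<close>

lemma c0_factorable_subset:
  "c0_factorable_ops fun_scale \<subseteq> (separably_dominated_ops
    :: (('a::topological_space \<Rightarrow>\<^sub>C 'k::real_or_complex) \<Rightarrow>\<^sub>L ('a \<Rightarrow>\<^sub>C 'k)) set)"
proof
  fix S :: "('a \<Rightarrow>\<^sub>C 'k) \<Rightarrow>\<^sub>L ('a \<Rightarrow>\<^sub>C 'k)"
  assume "S \<in> c0_factorable_ops fun_scale"
  then obtain U :: "('a \<Rightarrow>\<^sub>C 'k) \<Rightarrow>\<^sub>L (nat \<Rightarrow>\<^sub>C 'k)" and V C where S: "S \<in> operators fun_scale"
    and U: "range U \<subseteq> c0" and V: "linear_on fun_scale fun_scale c0 V"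
    and C: "\<And>y. y \<in> c0 \<Longrightarrow> norm (V y) \<le> C * norm y" and SV: "\<And>x. S x = V (U x)"
    unfolding c0_factorable_ops_def bounded_linear_on_def by blast
  obtain Q :: "'k set" where Q: "countable Q" "\<And>X. open X \<Longrightarrow> X \<noteq> {} \<Longrightarrow> \<exists>q\<in>Q. q \<in> X"
    using countable_dense_setE by blast
  define d where "d qs = Bcontfun (\<lambda>n. if n < length qs then qs ! n else 0 :: 'k)" for qs
  have d: "d qs n = (if n < length qs then qs ! n else 0)" for qs n
  proof -
    have "range (\<lambda>n. if n < length qs then qs ! n else 0) \<subseteq> insert 0 (set qs)" by auto
    then have "bounded (range (\<lambda>n. if n < length qs then qs ! n else 0))"
      by (rule bounded_subset[rotated]) (simp add: finite_imp_bounded)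
    then show ?thesis unfolding d_def by (subst discrete_bcontfun) auto
  qed
  have dc0: "d qs \<in> c0" for qs
  proof -
    have "\<forall>\<^sub>F n in sequentially. d qs n = 0"
      using eventually_ge_at_top[of "length qs"] by eventually_elim (simp add: d)
    then show ?thesis by (simp add: c0_def tendsto_eventually)
  qed
  have "V y \<in> closure ((\<lambda>qs. V (d qs)) ` lists Q)" if y: "y \<in> c0" for y
    unfolding closure_approachable
  proof (intro allI impI)
    fix e :: real assume e: "0 < e"
    \<comment> \<open>The sign of \<open>C\<close> is unknown, hence the absolute value; adding 1
      keeps the denominator positive.\<close>
    define \<epsilon> where "\<epsilon> = e / (\<bar>C\<bar> + 1)"
    have \<epsilon>: "0 < \<epsilon>" using e by (simp add: \<epsilon>_def)
    obtain N where N: "\<And>n. n \<ge> N \<Longrightarrow> norm (y n) < \<epsilon>"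
      using y \<epsilon> unfolding c0_def LIMSEQ_iff by auto
    have "\<exists>q\<in>Q. q \<in> ball (y n) \<epsilon>" for n
      using \<epsilon> by (intro Q) auto
    then obtain q where q: "\<And>n. q n \<in> Q" "\<And>n. dist (y n) (q n) < \<epsilon>" by (metis mem_ball)
    define qs where "qs = map q [0..<N]"
    have "norm (d qs - y) \<le> \<epsilon>"
    proof (rule norm_bound)
      show "norm ((d qs - y) n) \<le> \<epsilon>" for n
        using N[of n] q(2)[of n] by (auto simp: d qs_def dist_norm norm_minus_commute)
    qed
    then have "\<bar>C\<bar> * norm (d qs - y) \<le> \<bar>C\<bar> * \<epsilon>" by (intro mult_left_mono) auto
    moreover have "C * norm (d qs - y) \<le> \<bar>C\<bar> * norm (d qs - y)" by (intro mult_right_mono) auto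
    ultimately have "norm (V (d qs - y)) \<le> \<bar>C\<bar> * \<epsilon>"
      using C[OF c0_diff[OF dc0 y], of qs] by linarith
    also have "\<dots> < e" using e by (simp add: \<epsilon>_def field_simps)
    finally have "dist (V (d qs)) (V y) < e"
      by (simp add: dist_norm linear_on_c0_diff[OF V dc0 y])
    moreover have "qs \<in> lists Q" using q(1) by (auto simp: qs_def)
    ultimately show "\<exists>z\<in>(\<lambda>qs. V (d qs)) ` lists Q. dist z (V y) < e" by blast
  qed
  then have "range S \<subseteq> closure ((\<lambda>qs. V (d qs)) ` lists Q)"
    using U SV by auto
  then show "S \<in> separably_dominated_ops"
    unfolding separably_dominated_ops_def using S Q(1) by blast
qed

text \<open>Continuity of the inverse at 0, together with homogeneity, turns a homeomorphic
  restriction into a lower bound, so that \<open>finite_dimensional_if_bounded_below\<close>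
  applies.\<close>

lemma separably_dominated_strictly_singular:
  assumes cpt: "compact (UNIV :: 'a::topological_space set)"
    and G: "grothendieck_space (fun_scale :: 'k::real_or_complex \<Rightarrow> ('a \<Rightarrow>\<^sub>C 'k) \<Rightarrow> _)"
  shows "(separably_dominated_ops :: (('a \<Rightarrow>\<^sub>C 'k) \<Rightarrow>\<^sub>L _) set) \<subseteq> strictly_singular_ops fun_scale"
proof
  fix T :: "('a \<Rightarrow>\<^sub>C 'k) \<Rightarrow>\<^sub>L ('a \<Rightarrow>\<^sub>C 'k)"
  assume "T \<in> separably_dominated_ops"
  then obtain D where T: "T \<in> operators fun_scale" "countable D" "range T \<subseteq> closure D"
    unfolding separably_dominated_ops_def by blast
  have "finite_dimensional fun_scale W"
    if W: "fs.subspace W" and R: "homeomorphism W (T ` W) T R" for W R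
  proof -
    have 0: "0 \<in> W" using W by (rule fs.subspace_0)
    have RT: "\<And>w. w \<in> W \<Longrightarrow> R (T w) = w" and "continuous_on (T ` W) R"
      using R by (auto simp: homeomorphism_def)
    then have "\<exists>\<delta>>0. \<forall>y\<in>T ` W. dist y 0 < \<delta> \<longrightarrow> dist (R y) (R (T 0)) < 1"
      using 0 unfolding continuous_on_iff by (metis blinfun.zero_right imageI zero_less_one)
    then obtain \<delta> where \<delta>: "\<delta> > 0" "\<And>w. w \<in> W \<Longrightarrow> norm (T w) < \<delta> \<Longrightarrow> norm w < 1"
      using RT RT[OF 0] by (auto simp: dist_norm)
    show ?thesis
    proof (rule finite_dimensional_if_bounded_below[OF cpt G T W])
      show "\<delta> / 2 > 0" using \<delta> by simp
      fix w assume w: "w \<in> W"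
      show "\<delta> / 2 * norm w \<le> norm (T w)"
      proof (rule ccontr)
        assume "\<not> ?thesis"
        then have less: "norm (T w) < \<delta> / 2 * norm w" by simp
        then have n0: "norm w > 0" using \<delta> by (cases "w = 0") auto
        define v where "v = (1 / norm w) *\<^sub>R w"
        have "\<delta> / 2 * norm w < \<delta> * norm w" using \<delta> n0 by simp
        then have "norm (T w) < \<delta> * norm w" using less by linarith
        then have "norm (T v) < \<delta>"
          using n0 by (simp add: v_def blinfun.scaleR_right field_simps)
        moreover have "v \<in> W"
          unfolding v_def fs.scale_of_real[symmetric] using W w by (rule fs.subspace_scale)
        ultimately have "norm v < 1" by (intro \<delta>)
        then show False using n0 by (simp add: v_def)
      qed
    qed
  qed
  then show "T \<in> strictly_singular_ops fun_scale"
    unfolding strictly_singular_ops_def using T(1) by blast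
qed


text \<open>Otherwise \<open>g\<close> is bounded away from 0 on a neighbourhood \<open>U\<close> of
  \<open>x\<close>, infinite because \<open>x\<close> is a limit point, and \<open>N\<close> is
  bounded below on the infinite-dimensional space of functions vanishing off
  \<open>U\<close>.\<close>

lemma eq_0_at_limit_point_if_multiplication_separably_dominated:
  fixes g :: "'a::t2_space \<Rightarrow>\<^sub>C 'k::real_or_complex"
  assumes cpt: "compact (UNIV :: 'a set)"
    and G: "grothendieck_space (fun_scale :: 'k \<Rightarrow> ('a \<Rightarrow>\<^sub>C 'k) \<Rightarrow> _)"
    and N: "N \<in> separably_dominated_ops" "\<And>f t. N f t = g t * f t"
    and x: "x islimpt UNIV"
  shows "g x = 0"
proof (rule ccontr)
  assume gx: "g x \<noteq> 0"
  define \<delta> where "\<delta> = norm (g x) / 2"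
  have \<delta>: "0 < \<delta>" "\<delta> < norm (g x)" using gx by (auto simp: \<delta>_def)
  define U where "U = {y. \<delta> < norm (g y)}"
  have U: "open U"
    unfolding U_def by (intro open_Collect_less continuous_intros) auto
  have "infinite U"
    using x U \<delta> unfolding islimpt_eq_acc_point by (auto simp: U_def)
  define W where "W = {f :: 'a \<Rightarrow>\<^sub>C 'k. \<forall>y. y \<notin> U \<longrightarrow> f y = 0}"
  obtain D where D: "N \<in> operators fun_scale" "countable D" "range N \<subseteq> closure D"
    using N unfolding separably_dominated_ops_def by blast
  have "finite_dimensional fun_scale W"
  proof (rule finite_dimensional_if_bounded_below[OF cpt G D _ \<delta>(1)])
    show "fs.subspace W" unfolding W_def fs.subspace_def by auto
    fix f assume f: "f \<in> W"
    have "norm f \<le> norm (N f) / \<delta>"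
    proof (rule norm_bound)
      fix t
      have "\<delta> * norm (f t) \<le> norm (N f t)"
        using f by (cases "t \<in> U") (auto simp: N U_def W_def norm_mult intro: mult_right_mono)
      also have "\<dots> \<le> norm (N f)" by (rule norm_bounded)
      finally show "norm (f t) \<le> norm (N f) / \<delta>" using \<delta> by (simp add: field_simps)
    qed
    then show "\<delta> * norm f \<le> norm (N f)" using \<delta> by (simp add: field_simps)
  qed
  then show False
    using not_finite_dimensional_supported[OF cpt U \<open>infinite U\<close>] unfolding W_def by blast
qed

section \<open>Multiplication operators and the count of dimensions\<close>

text \<open>Linear dependence for families instead of sets: if two members coincide, the
  coefficients 1 and -1 serve; otherwise the image set is dependent.\<close>

lemma (in vector_space) exists_nontrivial_combination_eq_0:
  assumes "finite X" "finite F" "card F < card X" "\<And>x. x \<in> X \<Longrightarrow> b x \<in> span F"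
  shows "\<exists>c. (\<exists>x\<in>X. c x \<noteq> 0) \<and> (\<Sum>x\<in>X. scale (c x) (b x)) = 0"
proof (cases "inj_on b X")
  case True
  have "dependent (b ` X)"
    using independent_span_bound[OF assms(2), of "b ` X"] assms(3,4) card_image[OF True] by auto
  then obtain c where "\<exists>v\<in>b ` X. c v \<noteq> 0" "(\<Sum>v\<in>b ` X. scale (c v) v) = 0"
    using dependent_finite[of "b ` X"] assms(1) by auto
  then show ?thesis
    by (intro exI[of _ "c \<circ> b"]) (auto simp: sum.reindex[OF True])
next
  case False
  then obtain x y where xy: "x \<in> X" "y \<in> X" "x \<noteq> y" "b x = b y"
    unfolding inj_on_def by blast
  define c where "c z = (if z = x then 1 else if z = y then - 1 else 0 :: 'a)" for z
  have "(\<Sum>z\<in>X. scale (c z) (b z)) = (\<Sum>z\<in>{x, y}. scale (c z) (b z))"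
    using xy assms(1) by (intro sum.mono_neutral_right) (auto simp: c_def)
  also have "\<dots> = 0" using xy by (simp add: c_def)
  finally show ?thesis using xy by (intro exI[of _ c]) (auto simp: c_def intro!: bexI[of _ x])
qed

text \<open>Of the multiplications by Kronecker functions at \<open>card F + 1\<close> limit points,
  some nontrivial combination would be separably dominated. It is the multiplication by a function
  \<open>g\<close> with \<open>g x = c x\<close>, nonzero at some limit point.\<close>

lemma infinite_codimension_separably_dominated:
  assumes cpt: "compact (UNIV :: 'a::t2_space set)" and inf: "infinite (UNIV :: 'a set)"
    and G: "grothendieck_space (fun_scale :: 'k::real_or_complex \<Rightarrow> ('a \<Rightarrow>\<^sub>C 'k) \<Rightarrow> _)"
    and I: "I \<subseteq> (separably_dominated_ops :: (('a \<Rightarrow>\<^sub>C 'k) \<Rightarrow>\<^sub>L ('a \<Rightarrow>\<^sub>C 'k)) set)"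
  shows "infinite_codimension (op_scale fun_scale) I (operators fun_scale)"
  unfolding infinite_codimension_def
proof clarify
  let ?J = "separably_dominated_ops :: (('a \<Rightarrow>\<^sub>C 'k) \<Rightarrow>\<^sub>L ('a \<Rightarrow>\<^sub>C 'k)) set"
  interpret ops: vector_space "op_scale fun_scale :: 'k \<Rightarrow> (('a \<Rightarrow>\<^sub>C 'k) \<Rightarrow>\<^sub>L ('a \<Rightarrow>\<^sub>C 'k)) \<Rightarrow> _"
    by (rule fs.vector_space_op_scale)
  fix F :: "(('a \<Rightarrow>\<^sub>C 'k) \<Rightarrow>\<^sub>L ('a \<Rightarrow>\<^sub>C 'k)) set"
  assume F: "finite F" and span: "operators fun_scale \<subseteq> ops.span (I \<union> F)"
  \<comment> \<open>\<open>I\<close> is an arbitrary subset; since \<open>?J\<close> is a subspace,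
    it contains the span of \<open>I\<close>.\<close>
  have J: "ops.subspace ?J"
    unfolding ops.subspace_def
  proof (intro conjI ballI allI)
    show "0 \<in> ?J"
      unfolding separably_dominated_ops_def
      by (auto simp: operators_iff intro!: exI[of _ "{0}"] bcontfun_eqI)
    fix S assume "S \<in> ?J"
    then obtain D where D: "S \<in> operators fun_scale" "countable D" "range S \<subseteq> closure D"
      unfolding separably_dominated_ops_def by blast
    show "op_scale fun_scale c S \<in> ?J" for c
    proof -
      have "bounded_linear (fun_scale c :: ('a \<Rightarrow>\<^sub>C 'k) \<Rightarrow> _)" by (rule fs.bounded_linear_scale)
      then have "fun_scale c ` closure D \<subseteq> closure (fun_scale c ` D)"
        by (rule closure_bounded_linear_image_subset)
      then have "range (op_scale fun_scale c S) \<subseteq> closure (fun_scale c ` D)"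
        using D(3) by auto
      moreover have "op_scale fun_scale c S \<in> operators fun_scale"
        using D(1) by (auto simp: operators_iff mult.commute)
      ultimately show ?thesis
        unfolding separably_dominated_ops_def using D(2) by blast
    qed
    fix T assume "T \<in> ?J"
    then obtain E where E: "T \<in> operators fun_scale" "countable E" "range T \<subseteq> closure E"
      unfolding separably_dominated_ops_def by blast
    have "range (S + T) \<subseteq> closure ((\<lambda>(d, e). d + e) ` (D \<times> E))"
    proof clarify
      fix f
      have "(S f, T f) \<in> closure (D \<times> E)" using D(3) E(3) by (auto simp: closure_Times)
      moreover have "(\<lambda>(d, e). d + e) ` closure (D \<times> E) \<subseteq> closure ((\<lambda>(d, e). d + e) ` (D \<times> E))"
        by (rule continuous_image_closure_subset[where A = UNIV])
          (auto simp: case_prod_unfold intro!: continuous_intros)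
      ultimately show "(S + T) f \<in> closure ((\<lambda>(d, e). d + e) ` (D \<times> E))"
        by (force simp: blinfun.add_left)
    qed
    moreover have "S + T \<in> operators fun_scale"
      using D(1) E(1) by (auto simp: operators_iff blinfun.add_left fs.scale_right_distrib)
    moreover have "countable ((\<lambda>(d, e). d + e) ` (D \<times> E))" using D(2) E(2) by simp
    ultimately show "S + T \<in> ?J"
      unfolding separably_dominated_ops_def by blast
  qed
  obtain X :: "'a set" where X: "X \<subseteq> {x. x islimpt UNIV}" "finite X" "card X = Suc (card F)"
    using infinite_arbitrarily_large[OF infinite_limit_points[OF cpt inf G]] by blast
  obtain u :: "'a \<Rightarrow> 'a \<Rightarrow>\<^sub>C 'k" where u: "\<And>x y. x \<in> X \<Longrightarrow> y \<in> X \<Longrightarrow> u x y = (if x = y then 1 else 0)"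
    using exists_kronecker_functions[OF cpt X(2) subset_UNIV open_UNIV] by metis
  define P where "P g f = Bcontfun (\<lambda>t. apply_bcontfun g t * apply_bcontfun f t)"
    for g f :: "'a \<Rightarrow>\<^sub>C 'k"
  have P: "P g f t = g t * f t" for g f t
  proof -
    have "continuous_on UNIV (\<lambda>t. g t * f t)" by (intro continuous_intros) auto
    then show ?thesis unfolding P_def by (subst apply_Bcontfun_compact[OF cpt]) auto
  qed
  define M where "M g = Blinfun (P g)" for g
  have M: "M g f t = g t * f t" for g f t
  proof -
    have "bounded_linear (P g)"
    proof (rule bounded_linear_intro[where K = "norm g"])
      show "norm (P g f) \<le> norm f * norm g" for f
        by (rule norm_bound) (simp add: P norm_mult mult.commute[of "norm f"] mult_mono norm_bounded)
    qed (auto intro!: bcontfun_eqI simp: P algebra_simps)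
    then show ?thesis unfolding M_def by (subst bounded_linear_Blinfun_apply) (simp_all add: P)
  qed
  have "M g \<in> operators fun_scale" for g
    unfolding operators_iff by (auto intro!: bcontfun_eqI simp: M algebra_simps)
  then have "\<exists>a b. M g = a + b \<and> a \<in> ?J \<and> b \<in> ops.span F" for g
    using span I ops.span_minimal[OF I J] unfolding ops.span_Un by blast
  then obtain a b where ab: "\<And>g. M g = a g + b g" "\<And>g. a g \<in> ?J" "\<And>g. b g \<in> ops.span F"
    by metis
  \<comment> \<open>Only the components in the span of \<open>F\<close> have to cancel; the
    combination of those in \<open>?J\<close> stays there.\<close>
  obtain c x where x: "x \<in> X" "c x \<noteq> 0" and c: "(\<Sum>x\<in>X. op_scale fun_scale (c x) (b (u x))) = 0"
    using ops.exists_nontrivial_combination_eq_0[OF X(2) F, of "\<lambda>x. b (u x)"] X(3) ab(3) by auto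
  define N where "N = (\<Sum>x\<in>X. op_scale fun_scale (c x) (M (u x)))"
  define g where "g = (\<Sum>x\<in>X. fun_scale (c x) (u x))"
  have "N = (\<Sum>x\<in>X. op_scale fun_scale (c x) (a (u x)))"
    unfolding N_def ab(1) ops.scale_right_distrib sum.distrib c by simp
  also have "\<dots> \<in> ?J"
    by (intro ops.subspace_sum J ops.subspace_scale ab)
  finally have "N \<in> ?J" .
  moreover have "N f t = g t * f t" for f t
    by (simp add: N_def g_def blinfun.sum_left apply_bcontfun_sum M sum_distrib_right mult.assoc)
  ultimately have "g x = 0"
    using X(1) x(1) eq_0_at_limit_point_if_multiplication_separably_dominated[OF cpt G] by blast
  moreover have "g x = (\<Sum>y\<in>X. if y = x then c y else 0)"
    unfolding g_def apply_bcontfun_sum using x u by (intro sum.cong) auto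
  ultimately show False using x X(2) by simp
qed

section \<open>Characters\<close>

text \<open>The library has this only for metric domains.\<close>

lemma complete_bcontfun: "complete (UNIV :: ('a::topological_space \<Rightarrow>\<^sub>C 'b::complete_space) set)"
  unfolding complete_def
proof (intro allI impI, elim conjE)
  fix f :: "nat \<Rightarrow> 'a \<Rightarrow>\<^sub>C 'b" assume f: "Cauchy f"
  have "\<forall>e>0. \<exists>N. \<forall>m n x. N \<le> m \<and> N \<le> n \<and> True \<longrightarrow> dist (f m x) (f n x) < e"
    using f dist_fun_lt_imp_dist_val_lt unfolding Cauchy_def by metis
  then obtain g where "uniform_limit UNIV (\<lambda>n. apply_bcontfun (f n)) g sequentially"
    using uniformly_convergent_eq_cauchy[of "\<lambda>_. True" "\<lambda>n. apply_bcontfun (f n)"]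
    unfolding uniform_limit_sequentially_iff by auto
  then show "\<exists>l\<in>UNIV. f \<longlonglongrightarrow> l"
    using uniform_limit_bcontfunE[OF _ sequentially_bot] by (metis UNIV_I)
qed

text \<open>\<open>Q\<close> is the inverse of \<open>1 - R\<close>: for each \<open>f\<close> the
  contraction taking \<open>y\<close> to \<open>f + R y\<close> has a unique fixed point, and
  uniqueness gives linearity in \<open>f\<close>.\<close>

lemma exists_resolvent:
  fixes R :: "('a::topological_space \<Rightarrow>\<^sub>C 'k::real_or_complex) \<Rightarrow>\<^sub>L ('a \<Rightarrow>\<^sub>C 'k)"
  assumes R: "R \<in> operators fun_scale" "norm R < 1"
  obtains Q where "Q \<in> operators fun_scale" "id_blinfun + (R o\<^sub>L Q) = Q"
proof -
  have ex1: "\<exists>!y. f + R y = y" for f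
  proof -
    have "\<exists>!y. y \<in> UNIV \<and> f + R y = y"
    proof (rule Banach_fix[OF complete_bcontfun _ norm_ge_zero R(2)])
      show "dist (f + R y) (f + R z) \<le> norm R * dist y z" for y z
        using norm_blinfun[of R "y - z"] by (simp add: dist_norm blinfun.diff_right)
    qed auto
    then show ?thesis by simp
  qed
  define q where "q f = (THE y. f + R y = y)" for f
  have q: "f + R (q f) = q f" for f unfolding q_def by (rule theI'[OF ex1])
  have unique: "f + R y = y \<Longrightarrow> q f = y" for f y using ex1[of f] q by blast
  have scale: "q (fun_scale c f) = fun_scale c (q f)" for c f
  proof (rule unique)
    have "fun_scale c f + R (fun_scale c (q f)) = fun_scale c (f + R (q f))"
      using R(1) by (simp add: operators_iff fs.scale_right_distrib)
    then show "fun_scale c f + R (fun_scale c (q f)) = fun_scale c (q f)" by (simp only: q)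
  qed
  have "bounded_linear q"
  proof (rule bounded_linear_intro[where K = "1 / (1 - norm R)"])
    fix f g c
    have "f + g + R (q f + q g) = (f + R (q f)) + (g + R (q g))"
      by (simp add: blinfun.add_right)
    then show "q (f + g) = q f + q g" by (intro unique) (simp only: q)
    show "q (c *\<^sub>R f) = c *\<^sub>R q f" using scale[of "of_real c" f] by (simp add: fs.scale_of_real)
    have "norm (q f) \<le> norm f + norm R * norm (q f)"
      using norm_triangle_ineq[of f "R (q f)"] norm_blinfun[of R "q f"] q[of f] by simp
    then show "norm (q f) \<le> norm f * (1 / (1 - norm R))"
      using R(2) by (simp add: field_simps)
  qed
  then have Q: "blinfun_apply (Blinfun q) = q" by (rule bounded_linear_Blinfun_apply)
  show ?thesis
  proof
    show "Blinfun q \<in> operators fun_scale" by (simp add: operators_iff Q scale)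
    show "id_blinfun + (R o\<^sub>L Blinfun q) = Blinfun q"
    proof (rule blinfun_eqI)
      fix f
      have "(id_blinfun + (R o\<^sub>L Blinfun q)) f = f + R (q f)" by (simp add: Q blinfun.add_left)
      then show "(id_blinfun + (R o\<^sub>L Blinfun q)) f = Blinfun q f" by (simp only: q Q)
    qed
  qed
qed

lemma operators_compose:
  "S \<in> operators fun_scale \<Longrightarrow> T \<in> operators fun_scale \<Longrightarrow> S o\<^sub>L T \<in> operators fun_scale"
  by (simp add: operators_iff)

lemma operators_add:
  "S \<in> operators fun_scale \<Longrightarrow> T \<in> operators fun_scale \<Longrightarrow> S + T \<in> operators fun_scale"
  by (simp add: operators_iff blinfun.add_left fs.scale_right_distrib)

lemma operators_scale:
  "T \<in> operators fun_scale \<Longrightarrow> op_scale fun_scale c T \<in> operators fun_scale"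
  by (simp add: operators_iff mult.commute)

lemma operators_minus:
  "S \<in> operators fun_scale \<Longrightarrow> T \<in> operators fun_scale \<Longrightarrow> S - T \<in> operators fun_scale"
  by (simp add: operators_iff blinfun.diff_left fs.scale_right_diff_distrib)

context
  fixes \<phi> :: "(('a::topological_space \<Rightarrow>\<^sub>C 'k::real_or_complex) \<Rightarrow>\<^sub>L ('a \<Rightarrow>\<^sub>C 'k)) \<Rightarrow> 'k"
  assumes \<phi>: "character fun_scale \<phi>"
begin

lemma character_add:
  "S \<in> operators fun_scale \<Longrightarrow> T \<in> operators fun_scale \<Longrightarrow> \<phi> (S + T) = \<phi> S + \<phi> T"
  using \<phi> unfolding character_def linear_on_def by blast

lemma character_scale:
  "T \<in> operators fun_scale \<Longrightarrow> \<phi> (op_scale fun_scale c T) = c * \<phi> T"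
  using \<phi> unfolding character_def linear_on_def by blast

lemma character_compose:
  "S \<in> operators fun_scale \<Longrightarrow> T \<in> operators fun_scale \<Longrightarrow> \<phi> (S o\<^sub>L T) = \<phi> S * \<phi> T"
  using \<phi> unfolding character_def by blast

lemma character_diff:
  assumes "S \<in> operators fun_scale" "T \<in> operators fun_scale"
  shows "\<phi> (S - T) = \<phi> S - \<phi> T"
  using character_add[OF operators_minus[OF assms] assms(2)] by simp

lemma zero_operator: "0 \<in> operators fun_scale"
  by (auto simp: operators_iff intro!: bcontfun_eqI)

lemma character_zero: "\<phi> 0 = 0"
  using character_diff[OF zero_operator zero_operator] by simp

lemma character_sum:
  assumes "\<And>i. i \<in> I \<Longrightarrow> T i \<in> operators fun_scale"
  shows "(\<Sum>i\<in>I. T i) \<in> operators fun_scale \<and> \<phi> (\<Sum>i\<in>I. T i) = (\<Sum>i\<in>I. \<phi> (T i))"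
  using assms
  by (induction I rule: infinite_finite_induct)
    (auto simp: zero_operator character_zero character_add operators_add)

text \<open>If \<open>\<phi> R = 1\<close> with \<open>\<parallel>R\<parallel> < 1\<close>, then \<open>Q = 1 + R Q\<close> has a solution, whence \<open>\<phi> 1 = 0\<close>.\<close>

lemma norm_character_le:
  assumes T: "T \<in> operators fun_scale"
  shows "norm (\<phi> T) \<le> norm T"
proof (rule ccontr)
  assume "\<not> ?thesis"
  then have less: "norm T < norm (\<phi> T)" by simp
  then have nz: "\<phi> T \<noteq> 0" by auto
  define R where "R = op_scale fun_scale (1 / \<phi> T) T"
  have R: "R \<in> operators fun_scale" unfolding R_def by (rule operators_scale[OF T])
  have \<phi>R: "\<phi> R = 1" using nz by (simp add: R_def character_scale T)
  have "norm R \<le> norm T / norm (\<phi> T)"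
  proof (rule norm_blinfun_bound)
    fix f
    have "norm (T f) / norm (\<phi> T) \<le> norm T * norm f / norm (\<phi> T)"
      by (intro divide_right_mono norm_blinfun) simp
    then show "norm (R f) \<le> norm T / norm (\<phi> T) * norm f"
      by (simp add: R_def fs.norm_scale norm_divide)
  qed simp
  also have "\<dots> < 1" using less nz by simp
  finally have R1: "norm R < 1" .
  let ?A = "operators fun_scale :: (('a \<Rightarrow>\<^sub>C 'k) \<Rightarrow>\<^sub>L ('a \<Rightarrow>\<^sub>C 'k)) set"
  have id: "id_blinfun \<in> ?A" by (simp add: operators_iff)
  obtain Q where Q: "Q \<in> ?A" "id_blinfun + (R o\<^sub>L Q) = Q"
    by (rule exists_resolvent[OF R R1])
  have "\<phi> Q = \<phi> id_blinfun + \<phi> R * \<phi> Q"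
    using character_add[OF id operators_compose[OF R Q(1)]]
    unfolding Q(2) character_compose[OF R Q(1)] .
  then have "\<phi> id_blinfun = 0" by (simp add: \<phi>R)
  moreover have "T o\<^sub>L id_blinfun = T" by (intro blinfun_eqI) simp
  ultimately show False using character_compose[OF T id] nz by simp
qed

end

section \<open>Rank-one operators\<close>

definition rank_one :: "('a::topological_space \<Rightarrow>\<^sub>C 'k::real_or_complex) \<Rightarrow> (('a \<Rightarrow>\<^sub>C 'k) \<Rightarrow>\<^sub>L 'k)
    \<Rightarrow> (('a \<Rightarrow>\<^sub>C 'k) \<Rightarrow>\<^sub>L ('a \<Rightarrow>\<^sub>C 'k))" where
  "rank_one h \<mu> = Blinfun (\<lambda>f. fun_scale (\<mu> f) h)"

lemma rank_one_apply: "rank_one h \<mu> f = fun_scale (\<mu> f) h"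
proof -
  have "bounded_linear (\<lambda>f. fun_scale (\<mu> f) h)"
  proof (rule bounded_linear_intro[where K = "norm \<mu> * norm h"])
    fix f
    have "norm (\<mu> f) * norm h \<le> norm \<mu> * norm f * norm h"
      by (intro mult_right_mono norm_blinfun) simp
    then show "norm (fun_scale (\<mu> f) h) \<le> norm f * (norm \<mu> * norm h)"
      by (simp add: fs.norm_scale mult_ac)
  qed (auto intro!: bcontfun_eqI simp: blinfun.add_right blinfun.scaleR_right algebra_simps)
  then show ?thesis unfolding rank_one_def by (subst bounded_linear_Blinfun_apply) auto
qed

lemma rank_one_operator:
  "\<mu> \<in> dual fun_scale \<Longrightarrow> rank_one h \<mu> \<in> operators fun_scale"
  by (auto simp: operators_iff rank_one_apply dual_scale mult.assoc intro!: bcontfun_eqI)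

lemma point_eval_dual: "point_eval t \<in> dual fun_scale"
  by (simp add: dual_iff[OF normed_space_over_fun_scale] point_eval_apply)

text \<open>Multiplicativity on products of rank-one operators gives \<open>comp\<close>. For a
  nonzero \<open>y\<close> in the kernel of \<mu> it yields first
  \<open>\<phi> (rank_one y \<mu>) = 0\<close> and then, with an evaluation that does not vanish at
  \<open>y\<close>, the claim. Such a \<open>y\<close> exists because \<open>C(K)\<close> has
  dimension at least 2.\<close>

lemma character_rank_one:
  fixes \<phi> :: "(('a::t2_space \<Rightarrow>\<^sub>C 'k::real_or_complex) \<Rightarrow>\<^sub>L ('a \<Rightarrow>\<^sub>C 'k)) \<Rightarrow> 'k"
  assumes cpt: "compact (UNIV :: 'a set)" and inf: "infinite (UNIV :: 'a set)"
    and \<phi>: "character fun_scale \<phi>" and \<mu>: "\<mu> \<in> dual fun_scale"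
  shows "\<phi> (rank_one x \<mu>) = 0"
proof (rule ccontr)
  assume nz: "\<phi> (rank_one x \<mu>) \<noteq> 0"
  have comp: "\<nu> y * \<phi> (rank_one h \<mu>) = \<phi> (rank_one h \<nu>) * \<phi> (rank_one y \<mu>)"
    if "\<nu> \<in> dual fun_scale" for h y \<nu>
  proof -
    have "rank_one h \<nu> o\<^sub>L rank_one y \<mu> = op_scale fun_scale (\<nu> y) (rank_one h \<mu>)"
      using that by (auto intro!: blinfun_eqI bcontfun_eqI simp: rank_one_apply dual_scale)
    then show ?thesis
      using character_compose[OF \<phi> rank_one_operator[OF that] rank_one_operator[OF \<mu>], of h y]
        character_scale[OF \<phi> rank_one_operator[OF \<mu>], of "\<nu> y" h] by simp
  qed
  have \<mu>x: "\<mu> x \<noteq> 0" using comp[OF \<mu>, of x x] nz by auto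
  \<comment> \<open>Two Kronecker functions at distinct points cannot both be multiples of
    \<open>x\<close>.\<close>
  have "\<exists>z. \<forall>a. z \<noteq> fun_scale a x"
  proof (rule ccontr)
    assume "\<not> ?thesis"
    then have all: "\<exists>a. z = fun_scale a x" for z by blast
    obtain p :: 'a where "p \<in> UNIV" by blast
    obtain q where q: "q \<noteq> p" using inf by (metis (full_types) UNIV_eq_I finite.emptyI finite_insert insertI1)
    obtain u :: "'a \<Rightarrow> 'a \<Rightarrow>\<^sub>C 'k" where u: "\<And>x y. x \<in> {p, q} \<Longrightarrow> y \<in> {p, q} \<Longrightarrow> u x y = (if x = y then 1 else 0)"
      using exists_kronecker_functions[OF cpt, of "{p, q}" UNIV] by auto
    obtain a b where "u p = fun_scale a x" "u q = fun_scale b x" using all by metis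
    then have "u p p = a * x p" "u p q = a * x q" "u q q = b * x q" by (metis fun_scale_apply)+
    then show False using u q by (auto split: if_splits)
  qed
  then obtain z where z: "\<And>a. z \<noteq> fun_scale a x" by blast
  define y where "y = z - fun_scale (\<mu> z / \<mu> x) x"
  have \<mu>y: "\<mu> y = 0" using \<mu>x by (simp add: y_def blinfun.diff_right dual_scale[OF \<mu>])
  have "y \<noteq> 0" using z by (simp add: y_def)
  then obtain t where t: "y t \<noteq> 0" by (metis bcontfun_eqI zero_bcontfun.rep_eq)
  have "\<phi> (rank_one y \<mu>) = 0" using comp[OF \<mu>, of y y] \<mu>y by simp
  then have "y t * \<phi> (rank_one x \<mu>) = 0"
    using comp[OF point_eval_dual, of t y x] by (simp add: point_eval_apply)
  with t nz show False by simp
qed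

section \<open>Operators factoring through \<open>c\<^sub>0\<close>\<close>

definition c0_unit :: "nat \<Rightarrow> (nat \<Rightarrow>\<^sub>C 'k::real_or_complex)" where
  "c0_unit k = Bcontfun (\<lambda>n. if n = k then 1 else 0)"

lemma c0_unit_apply: "c0_unit k n = (if n = k then 1 else 0)"
proof -
  have "bounded (range (\<lambda>n. if n = k then 1 else 0 :: 'a))"
    by (rule bounded_subset[of "{0, 1}"]) auto
  then show ?thesis unfolding c0_unit_def by (subst discrete_bcontfun) auto
qed

definition finite_sequence :: "nat \<Rightarrow> (nat \<Rightarrow> 'k) \<Rightarrow> (nat \<Rightarrow>\<^sub>C 'k::real_or_complex)" where
  "finite_sequence N a = (\<Sum>k<N. fun_scale (a k) (c0_unit k))"

lemma finite_sequence_apply: "finite_sequence N a n = (if n < N then a n else 0)"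
  by (simp add: finite_sequence_def apply_bcontfun_sum c0_unit_apply if_distrib cong: if_cong)

lemma finite_sequence_c0: "finite_sequence N a \<in> c0"
proof -
  have "\<forall>\<^sub>F n in sequentially. finite_sequence N a n = 0"
    using eventually_ge_at_top[of N] by eventually_elim (simp add: finite_sequence_apply)
  then show ?thesis by (simp add: c0_def tendsto_eventually)
qed

text \<open>One form for two operators on \<open>c0\<close>: selecting a subsequence of coordinates
  (\<beta> constantly 1), and spreading each coordinate over blocks of positions with
  weights.\<close>

definition weighted_comp :: "(nat \<Rightarrow> 'k) \<Rightarrow> (nat \<Rightarrow> nat) \<Rightarrow> (nat \<Rightarrow>\<^sub>C 'k) \<Rightarrow> (nat \<Rightarrow>\<^sub>C 'k::real_or_complex)" where
  "weighted_comp \<beta> \<iota> y = Bcontfun (\<lambda>k. \<beta> k * y (\<iota> k))"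

context
  fixes \<beta> :: "nat \<Rightarrow> 'k::real_or_complex" and B :: real and \<iota> :: "nat \<Rightarrow> nat"
  assumes \<beta>: "\<And>k. norm (\<beta> k) \<le> B"
begin

lemma norm_weighted_le: "norm (\<beta> k * apply_bcontfun y (\<iota> k)) \<le> B * norm y"
  unfolding norm_mult using order_trans[OF norm_ge_zero \<beta>] \<beta>[of k] norm_bounded
  by (intro mult_mono) auto

lemma weighted_comp_apply: "weighted_comp \<beta> \<iota> y k = \<beta> k * y (\<iota> k)"
proof -
  have "bounded (range (\<lambda>k. \<beta> k * y (\<iota> k)))"
    by (rule boundedI[where B = "B * norm y"]) (use norm_weighted_le in blast)
  then show ?thesis unfolding weighted_comp_def by (subst discrete_bcontfun) auto
qed

lemma norm_weighted_comp_le: "norm (weighted_comp \<beta> \<iota> y) \<le> B * norm y"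
  by (rule norm_bound) (simp only: weighted_comp_apply norm_weighted_le)

lemma weighted_comp_c0:
  assumes \<iota>: "filterlim \<iota> at_top sequentially" and y: "y \<in> c0"
  shows "weighted_comp \<beta> \<iota> y \<in> c0"
proof -
  have "(\<lambda>k. y (\<iota> k)) \<longlonglongrightarrow> 0"
    using y filterlim_compose[OF _ \<iota>] unfolding c0_def by blast
  then have "(\<lambda>k. B * norm (y (\<iota> k))) \<longlonglongrightarrow> 0"
    by (intro tendsto_mult_right_zero tendsto_norm_zero)
  moreover have "\<forall>\<^sub>F k in sequentially. norm (\<beta> k * y (\<iota> k)) \<le> B * norm (y (\<iota> k))"
    unfolding norm_mult using \<beta> by (intro always_eventually allI mult_right_mono) auto
  ultimately have "(\<lambda>k. \<beta> k * y (\<iota> k)) \<longlonglongrightarrow> 0"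
    by (rule Lim_null_comparison[rotated])
  moreover have "apply_bcontfun (weighted_comp \<beta> \<iota> y) = (\<lambda>k. \<beta> k * y (\<iota> k))"
    by (rule ext) (rule weighted_comp_apply)
  ultimately show ?thesis by (simp add: c0_def)
qed

end

section \<open>The matrix of \<open>U V\<close> on \<open>c0\<close>\<close>

text \<open>\<open>V\<close> is a total function whose values are controlled only on
  \<open>c0\<close>, hence the membership conditions throughout.\<close>

locale c0_factorization =
  fixes U :: "('a::t2_space \<Rightarrow>\<^sub>C 'k::real_or_complex) \<Rightarrow>\<^sub>L (nat \<Rightarrow>\<^sub>C 'k)"
    and V :: "(nat \<Rightarrow>\<^sub>C 'k) \<Rightarrow> ('a \<Rightarrow>\<^sub>C 'k)" and C :: real
  assumes U: "U \<in> bounded_ops fun_scale fun_scale" "\<And>f. U f \<in> c0"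
    and V: "linear_on fun_scale fun_scale c0 V"
    and C: "0 \<le> C" "\<And>y. y \<in> c0 \<Longrightarrow> norm (V y) \<le> C * norm y"
begin

lemma U_scale: "U (fun_scale c f) = fun_scale c (U f)"
  using U(1) bounded_ops_iff[OF normed_space_over_fun_scale normed_space_over_fun_scale] by blast

lemma V_add: "y \<in> c0 \<Longrightarrow> z \<in> c0 \<Longrightarrow> V (y + z) = V y + V z"
  using V unfolding linear_on_def by blast

lemma V_scale: "y \<in> c0 \<Longrightarrow> V (fun_scale c y) = fun_scale c (V y)"
  using V unfolding linear_on_def by blast

lemma V_diff: "y \<in> c0 \<Longrightarrow> z \<in> c0 \<Longrightarrow> V (y - z) = V y - V z"
  by (rule linear_on_c0_diff[OF V])

lemma c0_unit_c0: "c0_unit k \<in> (c0 :: (nat \<Rightarrow>\<^sub>C 'k) set)"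
proof -
  have "(c0_unit k :: nat \<Rightarrow>\<^sub>C 'k) = finite_sequence (Suc k) (\<lambda>n. if n = k then 1 else 0)"
    by (rule bcontfun_eqI) (simp add: c0_unit_apply finite_sequence_apply)
  then show ?thesis by (simp add: finite_sequence_c0)
qed

lemma c0_scale: "y \<in> c0 \<Longrightarrow> fun_scale c y \<in> c0" for y :: "nat \<Rightarrow>\<^sub>C 'k"
proof -
  assume "y \<in> c0"
  then have "(\<lambda>n. c * y n) \<longlonglongrightarrow> 0" unfolding c0_def by (auto intro: tendsto_mult_right_zero)
  moreover have "apply_bcontfun (fun_scale c y) = (\<lambda>n. c * y n)" by (rule ext) simp
  ultimately show ?thesis by (simp add: c0_def)
qed

lemma V_finite_sequence: "V (finite_sequence N a) = (\<Sum>k<N. fun_scale (a k) (V (c0_unit k)))"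
proof (induction N)
  case 0
  have "V (fun_scale 0 0) = fun_scale 0 (V 0)"
    using finite_sequence_c0[of 0 a] by (intro V_scale) (simp add: finite_sequence_def)
  then show ?case by (simp add: finite_sequence_def)
next
  case (Suc N)
  have "finite_sequence (Suc N) a = finite_sequence N a + fun_scale (a N) (c0_unit N)"
    by (simp add: finite_sequence_def)
  then show ?case
    using Suc by (simp add: V_add finite_sequence_c0 c0_scale c0_unit_c0 V_scale)
qed

definition entry :: "nat \<Rightarrow> nat \<Rightarrow> 'k" where
  "entry n k = U (V (c0_unit k)) n"

lemma UV_finite_sequence: "U (V (finite_sequence N a)) n = (\<Sum>k<N. a k * entry n k)"
  by (simp add: V_finite_sequence blinfun.sum_right U_scale apply_bcontfun_sum entry_def)

lemma norm_UV_le: "y \<in> c0 \<Longrightarrow> norm (U (V y)) \<le> norm U * C * norm y"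
  using C(2)[of y] norm_blinfun[of U "V y"]
  by (smt (verit, best) mult.assoc mult_left_mono norm_ge_zero)

text \<open>Testing \<open>U V\<close> on the phases of row \<open>n\<close> produces the sum of the
  moduli of its first \<open>N\<close> entries.\<close>

lemma sum_norm_entry_le: "(\<Sum>k<N. norm (entry n k)) \<le> norm U * C"
proof -
  define y where "y = finite_sequence N (\<lambda>k. phase (entry n k))"
  have "norm y \<le> 1"
    by (rule norm_bound) (auto simp: y_def finite_sequence_apply norm_phase_le)
  have "U (V y) n = of_real (\<Sum>k<N. norm (entry n k))"
    by (simp add: y_def UV_finite_sequence phase_mult)
  then have "(\<Sum>k<N. norm (entry n k)) = norm (U (V y) n)"
    by (simp only: norm_of_real abs_of_nonneg sum_nonneg norm_ge_zero)
  also have "\<dots> \<le> norm (U (V y))" by (rule norm_bounded)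
  also have "\<dots> \<le> norm U * C * norm y"
    by (rule norm_UV_le) (simp add: y_def finite_sequence_c0)
  also have "\<dots> \<le> norm U * C * 1"
    using \<open>norm y \<le> 1\<close> C(1) by (intro mult_left_mono) auto
  finally show ?thesis by simp
qed

lemma summable_norm_entry: "summable (\<lambda>k. norm (entry n k))"
  by (rule summableI_nonneg_bounded[OF norm_ge_zero sum_norm_entry_le])

lemma finite_sequence_tendsto:
  assumes y: "y \<in> c0"
  shows "(\<lambda>N. finite_sequence N (apply_bcontfun y)) \<longlonglongrightarrow> y"
proof (rule LIMSEQ_I)
  fix e :: real assume e: "0 < e"
  then obtain M where M: "\<And>n. n \<ge> M \<Longrightarrow> norm (y n) < e/2"
    using LIMSEQ_D[of "apply_bcontfun y" 0 "e/2"] y unfolding c0_def by auto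
  have "norm (finite_sequence N y - y) < e" if "N \<ge> M" for N
  proof -
    have "norm (finite_sequence N y - y) \<le> e/2"
    proof (rule norm_bound)
      fix n
      show "norm ((finite_sequence N y - y) n) \<le> e/2"
        using M[of n] that e by (cases "n < N") (auto simp: finite_sequence_apply less_imp_le)
    qed
    then show ?thesis using e by simp
  qed
  then show "\<exists>M. \<forall>N\<ge>M. norm (finite_sequence N y - y) < e" by blast
qed

text \<open>The truncations of a sequence in \<open>c0\<close> converge to it in norm, and
  \<open>U V\<close> is continuous on \<open>c0\<close>.\<close>

lemma UV_sums:
  assumes y: "y \<in> c0"
  shows "(\<lambda>k. y k * entry n k) sums (U (V y) n)"
  unfolding sums_def
proof (rule LIM_zero_cancel, rule Lim_null_comparison)
  have "(\<lambda>N. norm (finite_sequence N y - y)) \<longlonglongrightarrow> 0"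
    using finite_sequence_tendsto[OF y] by (intro tendsto_norm_zero LIM_zero)
  then show "(\<lambda>N. norm U * C * norm (finite_sequence N y - y)) \<longlonglongrightarrow> 0"
    by (rule tendsto_mult_right_zero)
  have "norm ((\<Sum>k<N. y k * entry n k) - U (V y) n) \<le> norm U * C * norm (finite_sequence N y - y)" for N
  proof -
    have "(\<Sum>k<N. y k * entry n k) - U (V y) n = U (V (finite_sequence N y - y)) n"
      by (simp add: V_diff finite_sequence_c0 y blinfun.diff_right UV_finite_sequence)
    also have "norm \<dots> \<le> norm (U (V (finite_sequence N y - y)))" by (rule norm_bounded)
    also have "\<dots> \<le> norm U * C * norm (finite_sequence N y - y)"
      by (intro norm_UV_le c0_diff finite_sequence_c0 y)
    finally show ?thesis .
  qed
  then show "\<forall>\<^sub>F N in sequentially. norm ((\<Sum>k<N. y k * entry n k) - U (V y) n)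
      \<le> norm U * C * norm (finite_sequence N y - y)"
    by simp
qed

definition row_norm :: "nat \<Rightarrow> real" where
  "row_norm n = (\<Sum>k. norm (entry n k))"

lemma norm_UV_apply_le:
  assumes y: "y \<in> c0"
  shows "norm (U (V y) n) \<le> row_norm n * norm y"
proof -
  have le: "norm (y k * entry n k) \<le> norm y * norm (entry n k)" for k
    by (simp add: norm_mult mult_right_mono norm_bounded)
  have sm: "summable (\<lambda>k. norm y * norm (entry n k))"
    by (intro summable_mult summable_norm_entry)
  have sm': "summable (\<lambda>k. norm (y k * entry n k))"
    by (rule summable_comparison_test'[OF sm]) (use le in simp)
  have "norm (U (V y) n) = norm (\<Sum>k. y k * entry n k)"
    using UV_sums[OF y] by (simp add: sums_iff)
  also have "\<dots> \<le> (\<Sum>k. norm (y k * entry n k))" by (rule summable_norm[OF sm'])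
  also have "\<dots> \<le> (\<Sum>k. norm y * norm (entry n k))" by (rule suminf_le[OF le sm' sm])
  also have "\<dots> = row_norm n * norm y"
    using suminf_mult[OF summable_norm_entry, of "norm y" n] by (simp add: row_norm_def mult.commute)
  finally show ?thesis .
qed

text \<open>The columns are the images of the unit vectors, hence elements of
  \<open>c0\<close>.\<close>

lemma entry_tendsto_0: "(\<lambda>n. entry n k) \<longlonglongrightarrow> 0"
  using U(2)[of "V (c0_unit k)"] by (simp add: c0_def entry_def[abs_def])

text \<open>A product of two such operators has \<open>U V\<close> in the middle, so it is governed
  by the matrix entries that the two index maps select.\<close>

definition factor_op :: "(nat \<Rightarrow> 'k) \<Rightarrow> (nat \<Rightarrow> nat) \<Rightarrow> (('a \<Rightarrow>\<^sub>C 'k) \<Rightarrow>\<^sub>L ('a \<Rightarrow>\<^sub>C 'k))" where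
  "factor_op \<beta> \<iota> = Blinfun (\<lambda>f. V (weighted_comp \<beta> \<iota> (U f)))"

context
  fixes \<beta> :: "nat \<Rightarrow> 'k" and B :: real and \<iota> :: "nat \<Rightarrow> nat"
  assumes \<beta>: "\<And>k. norm (\<beta> k) \<le> B" and \<iota>: "filterlim \<iota> at_top sequentially"
begin

lemma factor_op_apply: "factor_op \<beta> \<iota> f = V (weighted_comp \<beta> \<iota> (U f))"
proof -
  note wc0 = weighted_comp_c0[of \<beta> B, OF \<beta> \<iota> U(2)] and w = weighted_comp_apply[of \<beta> B, OF \<beta>]
  have "bounded_linear (\<lambda>f. V (weighted_comp \<beta> \<iota> (U f)))"
  proof (rule bounded_linear_intro[where K = "C * (B * norm U)"])
    fix f g :: "'a \<Rightarrow>\<^sub>C 'k" and c :: real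
    have "weighted_comp \<beta> \<iota> (U (f + g)) = weighted_comp \<beta> \<iota> (U f) + weighted_comp \<beta> \<iota> (U g)"
      by (rule bcontfun_eqI) (simp add: w blinfun.add_right algebra_simps)
    then show "V (weighted_comp \<beta> \<iota> (U (f + g))) = V (weighted_comp \<beta> \<iota> (U f)) + V (weighted_comp \<beta> \<iota> (U g))"
      by (simp add: V_add wc0)
    have "weighted_comp \<beta> \<iota> (U (c *\<^sub>R f)) = fun_scale (of_real c) (weighted_comp \<beta> \<iota> (U f))"
      by (rule bcontfun_eqI) (simp add: w blinfun.scaleR_right scaleR_conv_of_real)
    then show "V (weighted_comp \<beta> \<iota> (U (c *\<^sub>R f))) = c *\<^sub>R V (weighted_comp \<beta> \<iota> (U f))"
      using V_scale[OF wc0, of "of_real c" f] by (simp only: fs.scale_of_real)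
    have B0: "0 \<le> B" using order_trans[OF norm_ge_zero \<beta>] .
    have "norm (V (weighted_comp \<beta> \<iota> (U f))) \<le> C * norm (weighted_comp \<beta> \<iota> (U f))"
      by (rule C(2)[OF wc0])
    also have "\<dots> \<le> C * (B * norm (U f))"
      using C(1) by (intro mult_left_mono norm_weighted_comp_le \<beta>)
    also have "\<dots> \<le> C * (B * (norm U * norm f))"
      using C(1) B0 by (intro mult_left_mono norm_blinfun)
    finally show "norm (V (weighted_comp \<beta> \<iota> (U f))) \<le> norm f * (C * (B * norm U))"
      by (simp add: mult_ac)
  qed
  then show ?thesis unfolding factor_op_def by (subst bounded_linear_Blinfun_apply) auto
qed

lemma factor_op_operator: "factor_op \<beta> \<iota> \<in> operators fun_scale"
  unfolding operators_iff
proof (intro allI)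
  fix c f
  note wc0 = weighted_comp_c0[of \<beta> B, OF \<beta> \<iota> U(2)] and w = weighted_comp_apply[of \<beta> B, OF \<beta>]
  have "weighted_comp \<beta> \<iota> (U (fun_scale c f)) = fun_scale c (weighted_comp \<beta> \<iota> (U f))"
    by (rule bcontfun_eqI) (simp add: w U_scale)
  then show "factor_op \<beta> \<iota> (fun_scale c f) = fun_scale c (factor_op \<beta> \<iota> f)"
    by (simp add: factor_op_apply V_scale wc0)
qed

end

end

section \<open>Values of a character on operators factoring through \<open>c0\<close>\<close>

context c0_factorization
begin

text \<open>\<open>S\<^sup>2 = V (U V) U\<close>. Keeping only the first \<open>N\<close>
  coordinates after \<open>U V\<close> gives an operator \<open>R\<close> of finite rank; the
  remaining coordinates are controlled by the row norms.\<close>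

lemma character_eq_0_if_row_norm_tendsto_0:
  assumes cpt: "compact (UNIV :: 'a set)" and inf: "infinite (UNIV :: 'a set)"
    and \<phi>: "character fun_scale \<phi>" and S: "S \<in> operators fun_scale" "\<And>f. S f = V (U f)"
    and lim: "row_norm \<longlonglongrightarrow> 0"
  shows "\<phi> S = 0"
proof -
  have bound: "norm (\<phi> S * \<phi> S) \<le> C * norm U * \<epsilon>" if \<epsilon>: "0 < \<epsilon>" for \<epsilon>
  proof -
    obtain N where N: "\<And>n. n \<ge> N \<Longrightarrow> row_norm n < \<epsilon>"
      using LIMSEQ_D[OF lim \<epsilon>] by (auto simp: abs_less_iff)
    define \<mu> where "\<mu> n = point_eval n o\<^sub>L (U o\<^sub>L S)" for n
    have \<mu>: "\<mu> n \<in> dual fun_scale" for n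
      using S(1) by (simp add: \<mu>_def dual_iff[OF normed_space_over_fun_scale] operators_iff
          U_scale point_eval_apply)
    define R where "R = (\<Sum>n<N. rank_one (V (c0_unit n)) (\<mu> n))"
    have R: "R \<in> operators fun_scale" "\<phi> R = 0"
      using character_sum[OF \<phi>, of "{..<N}" "\<lambda>n. rank_one (V (c0_unit n)) (\<mu> n)"]
      by (simp_all add: R_def rank_one_operator \<mu> character_rank_one[OF cpt inf \<phi>])
    have "norm ((S o\<^sub>L S) - R) \<le> C * norm U * \<epsilon>"
    proof (rule norm_blinfun_bound)
      fix f
      define z where "z = U (S f)"
      have z: "z \<in> c0" unfolding z_def by (rule U)
      have "R f = V (finite_sequence N z)"
        by (simp add: R_def blinfun.sum_left rank_one_apply \<mu>_def point_eval_apply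
            V_finite_sequence z_def)
      then have "((S o\<^sub>L S) - R) f = V (z - finite_sequence N z)"
        by (simp add: blinfun.diff_left S(2)[of "S f"] z_def[symmetric] V_diff z finite_sequence_c0)
      also have "norm \<dots> \<le> C * norm (z - finite_sequence N z)"
        by (intro C c0_diff z finite_sequence_c0)
      also have "\<dots> \<le> C * (\<epsilon> * norm (U f))"
      proof (intro mult_left_mono C(1), rule norm_bound)
        fix n
        show "norm ((z - finite_sequence N z) n) \<le> \<epsilon> * norm (U f)"
        proof (cases "n < N")
          case False
          have "norm (z n) \<le> row_norm n * norm (U f)"
            unfolding z_def S(2) by (rule norm_UV_apply_le[OF U(2)])
          also have "\<dots> \<le> \<epsilon> * norm (U f)"
            using N[of n] False by (intro mult_right_mono) auto
          finally show ?thesis using False by (simp add: finite_sequence_apply)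
        qed (use \<epsilon> in \<open>simp add: finite_sequence_apply\<close>)
      qed
      also have "\<dots> \<le> C * (\<epsilon> * (norm U * norm f))"
        using C(1) \<epsilon> by (intro mult_left_mono norm_blinfun) auto
      finally show "norm (((S o\<^sub>L S) - R) f) \<le> C * norm U * \<epsilon> * norm f" by (simp add: mult_ac)
    qed (use C(1) \<epsilon> in simp)
    then have "norm (\<phi> ((S o\<^sub>L S) - R)) \<le> C * norm U * \<epsilon>"
      using norm_character_le[OF \<phi> operators_minus[OF operators_compose[OF S(1) S(1)] R(1)]]
      by linarith
    then show ?thesis
      by (simp add: character_diff[OF \<phi>] operators_compose S(1) R character_compose[OF \<phi>])
  qed
  show ?thesis
  proof (rule ccontr)
    assume "\<phi> S \<noteq> 0"
    define q where "q = norm (\<phi> S * \<phi> S)"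
    have q: "0 < q" using \<open>\<phi> S \<noteq> 0\<close> by (simp add: q_def)
    define K where "K = C * norm U"
    have K: "0 \<le> K" using C(1) by (simp add: K_def)
    \<comment> \<open>This \<epsilon> makes the right-hand side smaller than \<open>q\<close>;
      \<open>K + 1\<close> avoids division by 0.\<close>
    have "q \<le> K * (q / (2 * (K + 1)))"
      unfolding q_def K_def by (rule bound) (use q K in \<open>simp add: q_def K_def\<close>)
    then have "K * q + q * 2 \<le> 0" using K by (simp add: field_simps)
    then show False using q mult_nonneg_nonneg[OF K, of q] by linarith
  qed
qed

text \<open>Given a column bound, a late row of norm at least \<delta> has little mass before it,
  because columns tend to 0. The next column bound then makes the tail of this row small, its
  entries being summable.\<close>

lemma gliding_hump:
  assumes \<delta>: "\<And>N. \<exists>n\<ge>N. \<delta> \<le> row_norm n" and \<eta>: "0 < \<eta>"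
  obtains n p where "strict_mono n" "strict_mono p" "p (0::nat) = (0::nat)"
    "\<And>j. \<delta> \<le> row_norm (n j)" "\<And>j. (\<Sum>k<p j. norm (entry (n j) k)) < \<eta>"
    "\<And>j. (\<Sum>k. norm (entry (n j) (k + p (Suc j)))) < \<eta>"
proof -
  define Q where "Q s s' \<longleftrightarrow> fst s < fst s' \<and> snd s < snd s' \<and> \<delta> \<le> row_norm (fst s') \<and>
      (\<Sum>k<snd s. norm (entry (fst s') k)) < \<eta> \<and> (\<Sum>k. norm (entry (fst s') (k + snd s'))) < \<eta>"
    for s s' :: "nat \<times> nat"
  have "\<exists>s'. Q s s'" for s
  proof -
    have "(\<lambda>n. \<Sum>k<snd s. norm (entry n k)) \<longlonglongrightarrow> (\<Sum>k<snd s. norm (0::'k))"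
      by (intro tendsto_sum tendsto_norm entry_tendsto_0)
    then have "\<forall>\<^sub>F n in sequentially. (\<Sum>k<snd s. norm (entry n k)) < \<eta>"
      using \<eta> by (intro order_tendstoD(2)[where y = "\<Sum>k<snd s. norm (0::'k)"]) auto
    then obtain N where N: "\<And>n. n \<ge> N \<Longrightarrow> (\<Sum>k<snd s. norm (entry n k)) < \<eta>"
      unfolding eventually_sequentially by blast
    obtain n where n: "n \<ge> max N (Suc (fst s))" "\<delta> \<le> row_norm n" using \<delta> by blast
    have "(\<lambda>p. \<Sum>k. norm (entry n (k + p))) \<longlonglongrightarrow> 0"
      by (rule suminf_exist_split2[OF summable_norm_entry])
    then have "\<forall>\<^sub>F p in sequentially. (\<Sum>k. norm (entry n (k + p))) < \<eta>"
      using \<eta> by (intro order_tendstoD(2)[where y = 0]) auto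
    then obtain M where M: "\<And>p. p \<ge> M \<Longrightarrow> (\<Sum>k. norm (entry n (k + p))) < \<eta>"
      unfolding eventually_sequentially by blast
    show ?thesis
      using n N[of n] M[of "max M (Suc (snd s))"]
      by (intro exI[of _ "(n, max M (Suc (snd s)))"]) (auto simp: Q_def)
  qed
  then obtain nxt where nxt: "\<And>s. Q s (nxt s)" by metis
  define st where "st j = (nxt ^^ j) (0, 0)" for j
  have Q: "Q (st j) (st (Suc j))" for j using nxt by (simp add: st_def)
  \<comment> \<open>The rows start with the second state: row \<open>n j\<close> is chosen after the
    bound \<open>p j\<close>, and \<open>p 0 = 0\<close> comes from the initial state.\<close>
  show ?thesis
  proof (rule that[of "\<lambda>j. fst (st (Suc j))" "\<lambda>j. snd (st j)"])
    show "strict_mono (\<lambda>j. fst (st (Suc j)))" "strict_mono (\<lambda>j. snd (st j))"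
      using Q by (auto simp: strict_mono_Suc_iff Q_def)
  qed (use Q in \<open>auto simp: Q_def st_def\<close>)
qed

text \<open>The rows \<open>n j\<close> and the blocks \<open>{p j..<p (j + 1)}\<close> of columns form an almost diagonal
  submatrix of \<open>U V\<close>. Its even and its odd part each carry a copy of \<open>c\<^sub>0\<close>, through which \<open>S\<close> factors.\<close>

lemma approximate_factorizations:
  assumes S: "\<And>f. blinfun_apply S f = V (U f)" and \<eta>: "0 < \<eta>" "\<eta> \<le> \<delta> / 4"
    and n: "strict_mono n" "\<And>j. \<delta> \<le> row_norm (n j)"
    and p: "strict_mono p" "p 0 = 0" "\<And>j. (\<Sum>k<p j. norm (entry (n j) k)) < \<eta>"
      "\<And>j. (\<Sum>k. norm (entry (n j) (k + p (Suc j)))) < \<eta>"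
  shows "\<exists>X Y. (\<forall>a. X a \<in> operators fun_scale \<and> Y a \<in> operators fun_scale) \<and>
    (\<forall>a<2. \<forall>b<2::nat. norm ((X a o\<^sub>L Y b) - (if a = b then S else 0)) \<le> 4 * C * norm U / \<delta> * \<eta>)"
proof -
  have \<delta>: "0 < \<delta>" using \<eta> by simp
  define \<alpha> where "\<alpha> j = (\<Sum>k\<in>{p j..<p (Suc j)}. norm (entry (n j) k))" for j
  have p_le: "p j \<le> p (Suc j)" for j using p(1) by (simp add: strict_mono_less_eq)
  have split: "sum f {..<p (Suc j)} = sum f {..<p j} + sum f {p j..<p (Suc j)}"
    for f :: "nat \<Rightarrow> 'c::comm_monoid_add" and j
    using p_le[of j] by (subst sum.union_disjoint[symmetric]) (auto simp: ivl_disj_un)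
  \<comment> \<open>Head and tail take at most \<open>2 * \<eta> \<le> \<delta> / 2\<close> from a
    row norm of at least \<delta>.\<close>
  have \<alpha>: "\<delta> / 2 \<le> \<alpha> j" for j
  proof -
    have "row_norm (n j) = (\<Sum>k. norm (entry (n j) (k + p (Suc j)))) + (\<Sum>k<p (Suc j). norm (entry (n j) k))"
      unfolding row_norm_def by (rule suminf_split_initial_segment[OF summable_norm_entry])
    then show ?thesis
      unfolding split \<alpha>_def[symmetric] using n(2)[of j] p(3,4)[of j] \<eta> by linarith
  qed
  define idx where "idx k = (LEAST j. k < p (Suc j))" for k
  have idx_eq: "idx k = j" if "p j \<le> k" "k < p (Suc j)" for j k
    unfolding idx_def
  proof (rule Least_equality)
    fix i assume i: "k < p (Suc i)"
    show "j \<le> i"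
    proof (rule ccontr)
      assume "\<not> j \<le> i"
      then have "p (Suc i) \<le> p j" using p(1) by (simp add: strict_mono_less_eq)
      with i that show False by simp
    qed
  qed (rule that)
  have idx_less: "k < p (Suc (idx k))" for k
    unfolding idx_def
    by (rule LeastI[of _ k]) (use strict_mono_imp_increasing[OF p(1), of "Suc k"] in simp)
  have idx_ge: "j \<le> idx k" if "p j \<le> k" for j k
  proof -
    have "p j < p (Suc (idx k))" using that idx_less[of k] by simp
    then show ?thesis using p(1) by (simp add: strict_mono_less)
  qed
  \<comment> \<open>Coordinate \<open>j\<close> belongs to both blocks \<open>2 * j\<close> and
    \<open>2 * j + 1\<close>; the parity of the block distinguishes the two copies of
    \<open>c0\<close>.\<close>
  define \<iota> where "\<iota> k = idx k div 2" for k
  have \<iota>: "filterlim \<iota> at_top sequentially"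
    unfolding filterlim_at_top eventually_sequentially
  proof (intro allI exI impI)
    fix Z k assume "p (2 * Z) \<le> k"
    then show "Z \<le> \<iota> k" using idx_ge[of "2 * Z" k] by (simp add: \<iota>_def)
  qed
  \<comment> \<open>Over a block of parity \<open>b\<close>, the products of the weights with the
    entries of its row sum to 1, as \<alpha> is the sum of their moduli.\<close>
  define \<beta> where "\<beta> b k = (if idx k mod 2 = b then phase (entry (n (idx k)) k) / of_real (\<alpha> (idx k)) else 0)"
    for b k
  have \<beta>: "norm (\<beta> b k) \<le> 2 / \<delta>" for b k
  proof -
    have "norm (phase (entry (n (idx k)) k)) / \<alpha> (idx k) \<le> 1 / (\<delta> / 2)"
      using \<alpha>[of "idx k"] \<delta> by (intro frac_le norm_phase_le) auto
    moreover have "0 < \<alpha> (idx k)" using \<alpha>[of "idx k"] \<delta> by linarith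
    ultimately show ?thesis using \<delta> by (auto simp: \<beta>_def norm_divide)
  qed
  \<comment> \<open>\<open>X a\<close> reads off the rows that belong to the blocks of parity
    \<open>a\<close>.\<close>
  define \<rho> where "\<rho> a j = n (2 * j + a)" for a j :: nat
  have \<rho>: "filterlim (\<rho> a) at_top sequentially" for a
    by (rule filterlim_subseq) (use n(1) in \<open>simp add: \<rho>_def strict_mono_def\<close>)
  have one: "norm (1::'k) \<le> 1" by simp
  define X where "X a = factor_op (\<lambda>_. 1) (\<rho> a)" for a
  define Y where "Y b = factor_op (\<beta> b) \<iota>" for b
  show ?thesis
  proof (rule exI[of _ X], rule exI[of _ Y], intro conjI allI impI)
    show "X a \<in> operators fun_scale" for a
      unfolding X_def by (rule factor_op_operator[of _ 1, OF one \<rho>])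
    show "Y b \<in> operators fun_scale" for b
      unfolding Y_def by (rule factor_op_operator[of _ "2 / \<delta>", OF \<beta> \<iota>])
    fix a b :: nat assume a: "a < 2" and b: "b < 2"
    show "norm ((X a o\<^sub>L Y b) - (if a = b then S else 0)) \<le> 4 * C * norm U / \<delta> * \<eta>"
    proof (rule norm_blinfun_bound)
      fix f
      define y where "y = U f"
      have y: "y \<in> c0" unfolding y_def by (rule U)
      define g where "g = weighted_comp (\<beta> b) \<iota> y"
      have g: "g \<in> c0" unfolding g_def by (rule weighted_comp_c0[of _ "2 / \<delta>", OF \<beta> \<iota> y])
      have g_apply: "g k = \<beta> b k * y (\<iota> k)" for k
        unfolding g_def by (rule weighted_comp_apply[of _ "2 / \<delta>", OF \<beta>])
      define h where "h = weighted_comp (\<lambda>_. 1) (\<rho> a) (U (V g))"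
      have h: "h \<in> c0" unfolding h_def by (rule weighted_comp_c0[of _ 1, OF one \<rho> U(2)])
      have h_apply: "h j = U (V g) (\<rho> a j)" for j
        unfolding h_def using weighted_comp_apply[of "\<lambda>_. 1" 1, OF one] by simp
      define y' where "y' = (if a = b then y else 0)"
      have V0: "V 0 = 0" using V_finite_sequence[of 0 "\<lambda>_. 0"] by (simp add: finite_sequence_def)
      have y': "y' \<in> c0" using y by (simp add: y'_def c0_def)
      \<comment> \<open>In row \<open>n J\<close> the block \<open>J\<close> reproduces
        \<open>y' j\<close> exactly; head and tail each contribute at most
        \<open>2 / \<delta> * norm y * \<eta>\<close>.\<close>
      have err: "norm ((h - y') j) \<le> 4 / \<delta> * \<eta> * norm y" for j
      proof -
        define J where "J = 2 * j + a"
        have J: "J mod 2 = a" "J div 2 = j" using a by (simp_all add: J_def)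
        define e where "e k = norm (entry (n J) k)" for k
        define s where "s k = g k * entry (n J) k" for k
        have s: "s sums h j"
          unfolding s_def h_apply \<rho>_def J_def[symmetric] by (rule UV_sums[OF g])
        have s_le: "norm (s k) \<le> 2 / \<delta> * norm y * e k" for k
        proof -
          have "norm (\<beta> b k) * norm (y (\<iota> k)) \<le> 2 / \<delta> * norm y"
            using \<beta> \<delta> by (intro mult_mono norm_bounded) auto
          then show ?thesis
            unfolding s_def g_apply norm_mult e_def by (intro mult_right_mono) auto
        qed
        have tail: "norm (\<Sum>k. s (k + p (Suc J))) \<le> 2 / \<delta> * norm y * \<eta>"
        proof -
          have sm: "summable (\<lambda>k. e (k + p (Suc J)))"
            unfolding e_def by (rule summable_ignore_initial_segment[OF summable_norm_entry])
          have sm2: "summable (\<lambda>k. 2 / \<delta> * norm y * e (k + p (Suc J)))"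
            by (rule summable_mult[OF sm])
          have sm3: "summable (\<lambda>k. norm (s (k + p (Suc J))))"
            by (rule summable_comparison_test'[OF sm2]) (use s_le in simp)
          have "norm (\<Sum>k. s (k + p (Suc J))) \<le> (\<Sum>k. norm (s (k + p (Suc J))))"
            by (rule summable_norm[OF sm3])
          also have "\<dots> \<le> (\<Sum>k. 2 / \<delta> * norm y * e (k + p (Suc J)))"
            by (rule suminf_le[OF s_le sm3 sm2])
          also have "\<dots> = 2 / \<delta> * norm y * (\<Sum>k. e (k + p (Suc J)))" by (rule suminf_mult[OF sm])
          also have "\<dots> \<le> 2 / \<delta> * norm y * \<eta>"
            using p(4)[of J] \<delta> by (intro mult_left_mono) (auto simp: e_def)
          finally show ?thesis .
        qed
        have head: "norm (sum s {..<p J}) \<le> 2 / \<delta> * norm y * \<eta>"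
        proof -
          have "norm (sum s {..<p J}) \<le> (\<Sum>k<p J. 2 / \<delta> * norm y * e k)"
            by (rule sum_norm_le) (rule s_le)
          also have "\<dots> = 2 / \<delta> * norm y * (\<Sum>k<p J. e k)" by (simp add: sum_distrib_left)
          also have "\<dots> \<le> 2 / \<delta> * norm y * \<eta>"
            using p(3)[of J] \<delta> by (intro mult_left_mono) (auto simp: e_def)
          finally show ?thesis .
        qed
        have block: "sum s {p J..<p (Suc J)} = y' j"
        proof (cases "a = b")
          case True
          have "s k = of_real (e k) * (y j / of_real (\<alpha> J))" if "k \<in> {p J..<p (Suc J)}" for k
          proof -
            have "idx k = J" using that by (intro idx_eq) auto
            then have "s k = (phase (entry (n J) k) * entry (n J) k) * (y j / of_real (\<alpha> J))"
              using J True by (simp add: s_def g_apply \<beta>_def \<iota>_def)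
            then show ?thesis by (simp add: phase_mult e_def)
          qed
          then have "sum s {p J..<p (Suc J)} = (\<Sum>k\<in>{p J..<p (Suc J)}. of_real (e k) * (y j / of_real (\<alpha> J)))"
            by (intro sum.cong) auto
          also have "\<dots> = of_real (\<alpha> J) * (y j / of_real (\<alpha> J))"
            by (simp only: sum_distrib_right[symmetric] of_real_sum[symmetric] \<alpha>_def e_def)
          also have "\<dots> = y j" using \<alpha>[of J] \<delta> by simp
          finally show ?thesis using True by (simp add: y'_def)
        next
          case False
          have "s k = 0" if "k \<in> {p J..<p (Suc J)}" for k
          proof -
            have "idx k = J" using that by (intro idx_eq) auto
            then show ?thesis using J False by (simp add: s_def g_apply \<beta>_def)
          qed
          then show ?thesis using False by (simp add: y'_def)
        qed
        have "h j = (\<Sum>k. s (k + p (Suc J))) + sum s {..<p (Suc J)}"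
          using suminf_split_initial_segment[OF sums_summable[OF s]] s by (simp add: sums_iff)
        then have "(h - y') j = (\<Sum>k. s (k + p (Suc J))) + sum s {..<p J}"
          by (simp add: split block)
        then have "norm ((h - y') j) \<le> norm (\<Sum>k. s (k + p (Suc J))) + norm (sum s {..<p J})"
          by (simp only: norm_triangle_ineq)
        also have "\<dots> \<le> 2 / \<delta> * norm y * \<eta> + 2 / \<delta> * norm y * \<eta>"
          by (rule add_mono[OF tail head])
        also have "\<dots> = 4 / \<delta> * \<eta> * norm y" by simp
        finally show ?thesis .
      qed
      have "((X a o\<^sub>L Y b) - (if a = b then S else 0)) f = V h - V y'"
        using factor_op_apply[of "\<lambda>_. 1" 1, OF one \<rho>] factor_op_apply[of "\<beta> b" "2 / \<delta>", OF \<beta> \<iota>]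
        by (simp add: X_def Y_def blinfun.diff_left h_def g_def y_def y'_def S V0)
      also have "\<dots> = V (h - y')" by (simp add: V_diff h y')
      also have "norm \<dots> \<le> C * norm (h - y')" by (intro C c0_diff h y')
      also have "\<dots> \<le> C * (4 / \<delta> * \<eta> * norm y)"
        by (intro mult_left_mono C(1) norm_bound err)
      also have "\<dots> \<le> C * (4 / \<delta> * \<eta> * (norm U * norm f))"
        unfolding y_def using C(1) \<delta> \<eta> by (intro mult_left_mono norm_blinfun) auto
      finally show "norm (((X a o\<^sub>L Y b) - (if a = b then S else 0)) f)
          \<le> 4 * C * norm U / \<delta> * \<eta> * norm f"
        by (simp add: field_simps)
    qed (use C(1) \<delta> \<eta> in simp)
  qed
qed

text \<open>With \<open>X 0 Y 0 \<approx> S \<approx> X 1 Y 1\<close> and \<open>X 0 Y 1 \<approx> 0 \<approx> X 1 Y 0\<close>, multiplicativity gives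
  \<open>\<phi>(S)\<^sup>2 \<approx> \<phi>(X 0) \<phi>(Y 0) \<phi>(X 1) \<phi>(Y 1) \<approx> 0\<close>.\<close>

lemma character_eq_0:
  assumes cpt: "compact (UNIV :: 'a set)" and inf: "infinite (UNIV :: 'a set)"
    and \<phi>: "character fun_scale \<phi>" and S: "S \<in> operators fun_scale" "\<And>f. S f = V (U f)"
  shows "\<phi> S = 0"
proof (cases "row_norm \<longlonglongrightarrow> 0")
  case True
  then show ?thesis using character_eq_0_if_row_norm_tendsto_0[OF cpt inf \<phi> S] by blast
next
  case False
  have "0 \<le> row_norm n" for n
    unfolding row_norm_def by (intro suminf_nonneg summable_norm_entry) simp
  then obtain \<delta> where \<delta>: "0 < \<delta>" "\<And>N. \<exists>n\<ge>N. \<delta> \<le> row_norm n"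
    using False unfolding LIMSEQ_iff by (auto simp: not_less)
  show ?thesis
  proof (rule ccontr)
    assume nz: "\<phi> S \<noteq> 0"
    define \<kappa> where "\<kappa> = 4 * C * norm U / \<delta>"
    have \<kappa>: "0 \<le> \<kappa>" using C(1) \<delta> by (simp add: \<kappa>_def)
    \<comment> \<open>The first bound is what the approximate factorizations require; the second
      makes their error \<open>\<kappa> * \<eta>\<close> at most a quarter of
      \<open>norm (\<phi> S)\<close>.\<close>
    define \<eta> where "\<eta> = min (\<delta> / 4) (norm (\<phi> S) / (4 * (\<kappa> + 1)))"
    have "0 < \<eta>" using \<delta> \<kappa> nz by (auto simp: \<eta>_def)
    moreover have "\<eta> \<le> \<delta> / 4" unfolding \<eta>_def by (rule min.cobounded1)
    ultimately have \<eta>: "0 < \<eta>" "\<eta> \<le> \<delta> / 4" by auto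
    have "\<kappa> * \<eta> \<le> (\<kappa> + 1) * (norm (\<phi> S) / (4 * (\<kappa> + 1)))"
      using \<kappa> \<eta> by (intro mult_mono) (auto simp: \<eta>_def)
    also have "\<dots> = norm (\<phi> S) / 4"
    proof -
      have "M * (x / (4 * M)) = x / 4" if "0 < M" for M x :: real using that by simp
      from this[of "\<kappa> + 1"] show ?thesis using \<kappa> by simp
    qed
    finally have small: "\<kappa> * \<eta> \<le> norm (\<phi> S) / 4" .
    obtain n p where np: "strict_mono n" "strict_mono p" "p (0::nat) = (0::nat)"
      "\<And>j. \<delta> \<le> row_norm (n j)" "\<And>j. (\<Sum>k<p j. norm (entry (n j) k)) < \<eta>"
      "\<And>j. (\<Sum>k. norm (entry (n j) (k + p (Suc j)))) < \<eta>"
      by (rule gliding_hump[OF \<delta>(2) \<eta>(1)]) (rule that)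
    obtain X Y where XY': "(\<forall>a. X a \<in> operators fun_scale \<and> Y a \<in> operators fun_scale) \<and>
      (\<forall>a<2. \<forall>b<2::nat. norm ((X a o\<^sub>L Y b) - (if a = b then S else 0)) \<le> \<kappa> * \<eta>)"
      using approximate_factorizations[OF S(2) \<eta> np(1,4,2,3,5,6)] unfolding \<kappa>_def by (elim exE)
    have XY: "X a \<in> operators fun_scale" "Y a \<in> operators fun_scale"
      "\<lbrakk>a < 2; b < 2\<rbrakk> \<Longrightarrow> norm ((X a o\<^sub>L Y b) - (if a = b then S else 0)) \<le> \<kappa> * \<eta>" for a b
      using XY' by blast+
    have diag: "norm (\<phi> (X a) * \<phi> (Y a) - \<phi> S) \<le> norm (\<phi> S) / 4" if "a < 2" for a
    proof -
      have "\<phi> ((X a o\<^sub>L Y a) - S) = \<phi> (X a) * \<phi> (Y a) - \<phi> S"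
        by (simp add: character_diff[OF \<phi>] character_compose[OF \<phi>] operators_compose XY S)
      then show ?thesis
        using norm_character_le[OF \<phi> operators_minus[OF operators_compose[OF XY(1,2)] S(1)], of a a]
          XY(3)[OF that that] small by simp
    qed
    have off: "norm (\<phi> (X a) * \<phi> (Y b)) \<le> norm (\<phi> S) / 4" if "a < 2" "b < 2" "a \<noteq> b" for a b
      using norm_character_le[OF \<phi> operators_compose[OF XY(1,2)], of a b] XY(3)[OF that(1,2)] small that(3)
      by (simp add: character_compose[OF \<phi>] XY)
    have low: "norm (\<phi> S) / 2 \<le> norm (\<phi> (X a) * \<phi> (Y a))" if "a < 2" for a
      using diag[OF that] norm_triangle_sub[of "\<phi> S" "\<phi> (X a) * \<phi> (Y a)"] norm_ge_zero[of "\<phi> S"]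
      unfolding norm_minus_commute[of "\<phi> S"] by linarith
    have "(norm (\<phi> S) / 2) * (norm (\<phi> S) / 2) \<le> norm (\<phi> (X 0) * \<phi> (Y 0)) * norm (\<phi> (X 1) * \<phi> (Y 1))"
      by (intro mult_mono low) auto
    \<comment> \<open>As scalars commute, the two diagonal products regroup into two off-diagonal
      ones; a quarter of the square of \<open>norm (\<phi> S)\<close> would then be at most a
      sixteenth of it.\<close>
    also have "\<dots> = norm (\<phi> (X 0) * \<phi> (Y 1)) * norm (\<phi> (X 1) * \<phi> (Y 0))"
      by (simp add: norm_mult)
    also have "\<dots> \<le> (norm (\<phi> S) / 4) * (norm (\<phi> S) / 4)"
      by (intro mult_mono off) auto
    finally show False using nz by simp
  qed
qed

end

theorem proposition44:
  fixes s :: "'k::real_or_complex \<Rightarrow> ('a::t2_space \<Rightarrow>\<^sub>C 'k) \<Rightarrow> ('a \<Rightarrow>\<^sub>C 'k)"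
  defines "s \<equiv> fun_scale"
  assumes "compact (UNIV :: 'a set)" and "infinite (UNIV :: 'a set)"
  shows "(\<forall>\<phi>. character s \<phi> \<longrightarrow> c0_factorable_ops s \<subseteq> character_ker s \<phi>) \<and>
    (grothendieck_space s \<longrightarrow>
       separable_range_ops s \<subseteq> strictly_singular_ops s \<and>
       c0_factorable_ops s \<subseteq> strictly_singular_ops s \<and>
       infinite_codimension (op_scale s) (separable_range_ops s) (operators s) \<and>
       infinite_codimension (op_scale s) (c0_factorable_ops s) (operators s))"
proof (intro conjI allI impI)
  note cpt = assms(2) and inf = assms(3)
  fix \<phi> assume \<phi>: "character s \<phi>"
  show "c0_factorable_ops s \<subseteq> character_ker s \<phi>"
  proof
    fix S assume "S \<in> c0_factorable_ops s"
    then obtain U :: "('a \<Rightarrow>\<^sub>C 'k) \<Rightarrow>\<^sub>L (nat \<Rightarrow>\<^sub>C 'k)" and V C where S: "S \<in> operators fun_scale"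
      and U: "U \<in> bounded_ops fun_scale fun_scale" "range U \<subseteq> c0" and V: "linear_on fun_scale fun_scale c0 V"
      and C: "\<And>y. y \<in> c0 \<Longrightarrow> norm (V y) \<le> C * norm y" and SV: "\<And>f. S f = V (U f)"
      unfolding c0_factorable_ops_def bounded_linear_on_def s_def by blast
    \<comment> \<open>The locale asks for a nonnegative constant.\<close>
    have "norm (V y) \<le> \<bar>C\<bar> * norm y" if "y \<in> c0" for y
      using C[OF that] mult_right_mono[OF abs_ge_self norm_ge_zero, of C y] by linarith
    then interpret c0_factorization U V "\<bar>C\<bar>"
      using U V by unfold_locales auto
    have "\<phi> S = 0" using character_eq_0[OF cpt inf \<phi>[unfolded s_def] S SV] .
    with S show "S \<in> character_ker s \<phi>" by (simp add: character_ker_def s_def)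
  qed
next
  assume G: "grothendieck_space s"
  note ss = separably_dominated_strictly_singular[OF assms(2) G[unfolded s_def]]
    and codim = infinite_codimension_separably_dominated[OF assms(2,3) G[unfolded s_def]]
  show "separable_range_ops s \<subseteq> strictly_singular_ops s" "c0_factorable_ops s \<subseteq> strictly_singular_ops s"
    unfolding s_def using ss separable_range_subset c0_factorable_subset by blast+
  show "infinite_codimension (op_scale s) (separable_range_ops s) (operators s)"
    "infinite_codimension (op_scale s) (c0_factorable_ops s) (operators s)"
    unfolding s_def by (intro codim separable_range_subset c0_factorable_subset)+
qed

end
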